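(* Let $\Omega$ be a non-empty open set in $\mathbb{R}^N$, let $l\in\mathbb{N}$ and $p\in[1,\infty[$. (i) If $pl<N$, then, with $q^*=\frac{Np}{N-pl}$, for every fixed $r\in\,]lq^*,\infty]$ the space $W^{l,p}(\Omega)$ contains a closed infinite dimensional linear subspace whose non-zero elements are nowhere $L^r$ functions. (ii) If $pl=N$ and $p\neq 1$, then the space $W^{l,p}(\Omega)$ contains a closed infinite dimensional linear subspace whose non-zero elements are nowhere bounded functions.
   Context: Here $\mathbb{N}=\{1,2,3,\dots\}$ and $]a,b[$, $]a,b]$, $[a,b[$ denote intervals open at the sides where the bracket is reversed. For $l\in\mathbb{N}$, $p\in[1,\infty]$ and $\Omega\subset\mathbb{R}^N$ open, $W^{l,p}(\Omega)$ is the Sobolev space of real valued functions in $L^p(\Omega)$ with distributional derivatives in $L^p(\Omega)$ up to order $l$, with norm $\|v\|_{W^{l,p}(\Omega)}=\sum_{0\le|\alpha|\le l}\|D^\alpha v\|_{L^p(\Omega)}$. "Closed" means closed in this norm. For $q\in[1,\infty]$, a real valued function $v$ defined (almost everywhere) on $\Omega$ is called nowhere $L^q$ if for every non-empty open subset $U$ of $\Omega$ the restriction $v|_U$ does not belong to $L^q(U)$. "Nowhere bounded" means nowhere $L^\infty$. *)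

theory Defs
  imports "HOL-Analysis.Analysis" "HOL-Probability.Essential_Supremum"
begin

text \<open>
  Functions on an open set \<open>\<Omega>\<close> are represented by total functions; their values outside \<open>\<Omega>\<close> are
  irrelevant. Elements of the spaces below are functions rather than classes of functions that
  agree almost everywhere on \<open>\<Omega>\<close>, so notions such as zero or linear dependence are taken
  almost everywhere on \<open>\<Omega>\<close>.
\<close>

section \<open>Lebesgue spaces\<close>

text \<open>Meaningful for exponents \<open>1 \<le> q \<le> \<infinity>\<close>.\<close>

definition Lp_space :: "ereal \<Rightarrow> 'a::euclidean_space set \<Rightarrow> ('a \<Rightarrow> real) set" where
  "Lp_space q \<Omega> = {f \<in> borel_measurable (lebesgue_on \<Omega>).
     if q = \<infinity> then esssup (lebesgue_on \<Omega>) (\<lambda>x. ereal \<bar>f x\<bar>) < \<infinity>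
     else integrable (lebesgue_on \<Omega>) (\<lambda>x. \<bar>f x\<bar> powr real_of_ereal q)}"

definition Lp_norm :: "ereal \<Rightarrow> 'a::euclidean_space set \<Rightarrow> ('a \<Rightarrow> real) \<Rightarrow> real" where
  "Lp_norm q \<Omega> f =
     (if q = \<infinity> then real_of_ereal (esssup (lebesgue_on \<Omega>) (\<lambda>x. ereal \<bar>f x\<bar>))
      else (LINT x|lebesgue_on \<Omega>. \<bar>f x\<bar> powr real_of_ereal q) powr (1 / real_of_ereal q))"

definition nowhere_Lp :: "ereal \<Rightarrow> 'a::euclidean_space set \<Rightarrow> ('a \<Rightarrow> real) \<Rightarrow> bool" where
  "nowhere_Lp q \<Omega> v \<longleftrightarrow> (\<forall>U. open U \<and> U \<noteq> {} \<and> U \<subseteq> \<Omega> \<longrightarrow> v \<notin> Lp_space q U)"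

abbreviation nowhere_bounded :: "'a::euclidean_space set \<Rightarrow> ('a \<Rightarrow> real) \<Rightarrow> bool" where
  "nowhere_bounded \<equiv> nowhere_Lp \<infinity>"

section \<open>Test functions\<close>

definition iter_partial :: "'a::euclidean_space list \<Rightarrow> ('a \<Rightarrow> real) \<Rightarrow> 'a \<Rightarrow> real" where
  "iter_partial bs f = foldr (\<lambda>b g x. frechet_derivative g (at x) b) bs f"

text \<open>Differentiability of all iterated partial derivatives also makes all of them continuous.\<close>

definition smooth :: "('a::euclidean_space \<Rightarrow> real) \<Rightarrow> bool" where
  "smooth f \<longleftrightarrow> (\<forall>bs \<in> lists Basis. iter_partial bs f differentiable_on UNIV)"

definition test_function :: "'a::euclidean_space set \<Rightarrow> ('a \<Rightarrow> real) \<Rightarrow> bool" where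
  "test_function \<Omega> \<phi> \<longleftrightarrow>
     smooth \<phi> \<and> compact (closure {x. \<phi> x \<noteq> 0}) \<and> closure {x. \<phi> x \<noteq> 0} \<subseteq> \<Omega>"

text \<open>
  A multi-index assigns a natural number to every coordinate direction. It is required to vanish
  off \<open>Basis\<close>, so that there are only finitely many multi-indices of a given order.
\<close>

definition multi_indices :: "nat \<Rightarrow> ('a::euclidean_space \<Rightarrow> nat) set" where
  "multi_indices l = {\<alpha>. (\<forall>b. b \<notin> Basis \<longrightarrow> \<alpha> b = 0) \<and> (\<Sum>b\<in>Basis. \<alpha> b) \<le> l}"

lemma finite_multi_indices: "finite (multi_indices l :: ('a::euclidean_space \<Rightarrow> nat) set)"
proof (rule finite_subset)
  show "(multi_indices l :: ('a \<Rightarrow> nat) set)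
    \<subseteq> {\<alpha>. \<forall>b. (b \<in> Basis \<longrightarrow> \<alpha> b \<in> {..l}) \<and> (b \<notin> Basis \<longrightarrow> \<alpha> b = 0)}"
    by (auto simp: multi_indices_def intro: order_trans[OF member_le_sum])
  show "finite {\<alpha> :: 'a \<Rightarrow> nat. \<forall>b. (b \<in> Basis \<longrightarrow> \<alpha> b \<in> {..l}) \<and> (b \<notin> Basis \<longrightarrow> \<alpha> b = 0)}"
    by (rule finite_set_of_finite_funs) auto
qed

text \<open>
  A fixed order of the coordinates, as \<open>Basis\<close> is unordered; on smooth functions \<open>D_alpha\<close> does not
  depend on it.
\<close>

definition basis_list :: "'a::euclidean_space list" where
  "basis_list = (SOME bs. distinct bs \<and> set bs = Basis)"

lemma basis_list: "distinct (basis_list :: 'a::euclidean_space list)"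
    "set (basis_list :: 'a::euclidean_space list) = Basis"
proof -
  have "\<exists>bs :: 'a list. distinct bs \<and> set bs = Basis"
    using finite_distinct_list[OF finite_Basis] by blast
  then have "distinct (basis_list :: 'a list) \<and> set (basis_list :: 'a list) = Basis"
    unfolding basis_list_def by (rule someI_ex)
  then show "distinct (basis_list :: 'a list)" "set (basis_list :: 'a list) = Basis"
    by auto
qed

definition D_alpha :: "('a::euclidean_space \<Rightarrow> nat) \<Rightarrow> ('a \<Rightarrow> real) \<Rightarrow> 'a \<Rightarrow> real" where
  "D_alpha \<alpha> \<phi> = iter_partial (concat (map (\<lambda>b. replicate (\<alpha> b) b) basis_list)) \<phi>"

section \<open>Sobolev spaces\<close>

definition locally_integrable :: "'a::euclidean_space set \<Rightarrow> ('a \<Rightarrow> real) \<Rightarrow> bool" where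
  "locally_integrable \<Omega> f \<longleftrightarrow> (\<forall>K. compact K \<and> K \<subseteq> \<Omega> \<longrightarrow> set_integrable lebesgue K f)"

definition has_weak_derivative ::
  "'a::euclidean_space set \<Rightarrow> ('a \<Rightarrow> nat) \<Rightarrow> ('a \<Rightarrow> real) \<Rightarrow> ('a \<Rightarrow> real) \<Rightarrow> bool" where
  "has_weak_derivative \<Omega> \<alpha> v g \<longleftrightarrow>
     locally_integrable \<Omega> v \<and> locally_integrable \<Omega> g \<and>
     (\<forall>\<phi>. test_function \<Omega> \<phi> \<longrightarrow>
        (LINT x|lebesgue_on \<Omega>. v x * D_alpha \<alpha> \<phi> x) =
        (-1) ^ (\<Sum>b\<in>Basis. \<alpha> b) * (LINT x|lebesgue_on \<Omega>. g x * \<phi> x))"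

text \<open>A representative; it is determined only almost everywhere on \<open>\<Omega>\<close>.\<close>

definition weak_derivative ::
  "'a::euclidean_space set \<Rightarrow> ('a \<Rightarrow> nat) \<Rightarrow> ('a \<Rightarrow> real) \<Rightarrow> 'a \<Rightarrow> real" where
  "weak_derivative \<Omega> \<alpha> v = (SOME g. has_weak_derivative \<Omega> \<alpha> v g)"

definition sobolev_space :: "nat \<Rightarrow> ereal \<Rightarrow> 'a::euclidean_space set \<Rightarrow> ('a \<Rightarrow> real) set" where
  "sobolev_space l p \<Omega> = {v \<in> Lp_space p \<Omega>.
     \<forall>\<alpha>\<in>multi_indices l. \<exists>g\<in>Lp_space p \<Omega>. has_weak_derivative \<Omega> \<alpha> v g}"

definition sobolev_norm :: "nat \<Rightarrow> ereal \<Rightarrow> 'a::euclidean_space set \<Rightarrow> ('a \<Rightarrow> real) \<Rightarrow> real" where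
  "sobolev_norm l p \<Omega> v = (\<Sum>\<alpha>\<in>multi_indices l. Lp_norm p \<Omega> (weak_derivative \<Omega> \<alpha> v))"

section \<open>Subspaces\<close>

definition ae_zero :: "'a::euclidean_space set \<Rightarrow> ('a \<Rightarrow> real) \<Rightarrow> bool" where
  "ae_zero \<Omega> v \<longleftrightarrow> (AE x in lebesgue_on \<Omega>. v x = 0)"

definition linear_subspace :: "('a \<Rightarrow> real) set \<Rightarrow> bool" where
  "linear_subspace V \<longleftrightarrow> (\<lambda>x. 0) \<in> V \<and>
     (\<forall>u\<in>V. \<forall>v\<in>V. (\<lambda>x. u x + v x) \<in> V) \<and> (\<forall>c. \<forall>v\<in>V. (\<lambda>x. c * v x) \<in> V)"

text \<open>Not spanned by finitely many elements, up to equality almost everywhere on \<open>\<Omega>\<close>.\<close>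

definition infinite_dimensional :: "'a::euclidean_space set \<Rightarrow> ('a \<Rightarrow> real) set \<Rightarrow> bool" where
  "infinite_dimensional \<Omega> V \<longleftrightarrow>
     \<not> (\<exists>B. finite B \<and> B \<subseteq> V \<and> (\<forall>v\<in>V. \<exists>c. ae_zero \<Omega> (\<lambda>x. v x - (\<Sum>b\<in>B. c b * b x))))"

text \<open>
  A set closed in this sense contains with \<open>v\<close> every function equal to \<open>v\<close> almost everywhere
  on \<open>\<Omega>\<close>, hence it is a union of equivalence classes.
\<close>

definition sobolev_closed ::
  "nat \<Rightarrow> ereal \<Rightarrow> 'a::euclidean_space set \<Rightarrow> ('a \<Rightarrow> real) set \<Rightarrow> bool" where
  "sobolev_closed l p \<Omega> V \<longleftrightarrow>
     (\<forall>v\<in>sobolev_space l p \<Omega>.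
        (\<forall>\<epsilon>>0. \<exists>u\<in>V. sobolev_norm l p \<Omega> (\<lambda>x. u x - v x) < \<epsilon>) \<longrightarrow> v \<in> V)"

end

theory Submission
  imports Defs "HOL-Computational_Algebra.Polynomial"
begin

text \<open>
  Scaled copies \<open>\<phi>(c(x - a))\<close> of one smooth cutoff (for \<open>p l = N\<close>: averages of many of them over
  the scales \<open>c = 4^i\<close>) yield peaks, supported in arbitrarily small sets, with small \<open>W^(l,p)\<close> norm but
  large \<open>L^r\<close> norm. A gliding hump picks peaks \<open>h m\<close> such that every open set and
  every \<open>k\<close> receive infinitely many peaks with label \<open>\<kappa> m = k\<close>, each so high that the earlier
  ones are negligible on its plateau and so much larger than the later supports that these cover at
  most half of it. With disjoint bumps \<open>e k\<close> of \<open>L^p\<close> norm one, the subspace consists of the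
  Sobolev functions \<open>\<Sum>k. c k * e k + \<Sum>m. c (\<kappa> m) * h m\<close> with bounded \<open>c\<close>. As \<open>\<Sum>m. h m\<close> is small
  in \<open>L^p\<close>, the \<open>L^p\<close> norm controls \<open>sup |c|\<close>, hence the subspace is closed; if \<open>c k \<noteq> 0\<close>, the
  peaks with label \<open>k\<close> prevent the function from lying in \<open>L^r\<close> on any open set.
\<close>

section \<open>A smooth ramp function\<close>

text \<open>Peaks of every label occur in every open set, so peaks with coefficients of opposite
  sign meet and could cancel. A peak can be made to beat its predecessors, which are known when it
  is chosen; its successors are not, so their supports are cut out of its plateau instead. The bumps
  \<open>e k\<close> are there to read off the coefficients. Shrinking to a point while their
  \<open>L^p\<close> norms stay 1, they are not uniformly bounded near it, so the peaks are placed
  in open sets on which all bumps share a bound. The smallness constant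
  \<open>2 powr (- (p + 1))\<close> for \<open>\<Sum>m. h m\<close> comes from the inequality |a +
  b|^p \<le> 2^p (|a|^p + |b|^p): multiplied by 2^p it leaves 1/2, so the term with
  \<open>sup |c|\<close> can be absorbed. Closedness is a matter of \<open>L^p\<close> alone: the
  limit is a Sobolev function by assumption, and only its representation as a series has to be
  found. With s = 1/r, where s = 0 stands for r = \<infinity>, both parts of the theorem become one
  construction, given the peaks.\<close>

fun Cn :: "nat \<Rightarrow> (real \<Rightarrow> real) \<Rightarrow> bool" where
  "Cn 0 f \<longleftrightarrow> True"
| "Cn (Suc n) f \<longleftrightarrow> (\<exists>f'. (\<forall>x. (f has_real_derivative f' x) (at x)) \<and> Cn n f')"

lemma Cn_SucI: "(\<And>x. (f has_real_derivative f' x) (at x)) \<Longrightarrow> Cn n f' \<Longrightarrow> Cn (Suc n) f"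
  by auto

lemma Cn_const: "Cn n (\<lambda>_. c)"
proof (induction n arbitrary: c)
  case (Suc n)
  then show ?case by (intro Cn_SucI[where f'="\<lambda>_. 0"]) auto
qed auto

lemma Cn_Suc_D: "Cn (Suc n) f \<Longrightarrow> Cn n f"
proof (induction n arbitrary: f)
  case (Suc n)
  then show ?case by (metis Cn.simps(2))
qed auto

lemma Cn_add: "Cn n f \<Longrightarrow> Cn n g \<Longrightarrow> Cn n (\<lambda>x. f x + g x)"
proof (induction n arbitrary: f g)
  case (Suc n)
  then obtain f' g' where d: "\<And>x. (f has_real_derivative f' x) (at x)" "Cn n f'"
    "\<And>x. (g has_real_derivative g' x) (at x)" "Cn n g'" by auto
  show ?case
  proof (rule Cn_SucI)
    show "((\<lambda>x. f x + g x) has_real_derivative f' x + g' x) (at x)" for x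
      by (rule DERIV_add[OF d(1) d(3)])
    show "Cn n (\<lambda>x. f' x + g' x)"
      by (rule Suc.IH[OF d(2) d(4)])
  qed
qed auto

lemma Cn_mult: "Cn n f \<Longrightarrow> Cn n g \<Longrightarrow> Cn n (\<lambda>x. f x * g x)"
proof (induction n arbitrary: f g)
  case (Suc n)
  then obtain f' g' where d: "\<And>x. (f has_real_derivative f' x) (at x)" "Cn n f'"
    "\<And>x. (g has_real_derivative g' x) (at x)" "Cn n g'" by auto
  show ?case
  proof (rule Cn_SucI)
    show "((\<lambda>x. f x * g x) has_real_derivative f' x * g x + g' x * f x) (at x)" for x
      by (rule DERIV_mult[OF d(1) d(3)])
    show "Cn n (\<lambda>x. f' x * g x + g' x * f x)"
      by (rule Cn_add[OF Suc.IH[OF d(2) Cn_Suc_D[OF Suc.prems(2)]]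
            Suc.IH[OF d(4) Cn_Suc_D[OF Suc.prems(1)]]])
  qed
qed auto

lemma Cn_inverse: "Cn n f \<Longrightarrow> (\<And>x. f x \<noteq> 0) \<Longrightarrow> Cn n (\<lambda>x. inverse (f x))"
proof (induction n)
  case (Suc n)
  then obtain f' where d: "\<And>x. (f has_real_derivative f' x) (at x)" "Cn n f'" by auto
  have "Cn n f" using Suc.prems(1) by (rule Cn_Suc_D)
  then have i: "Cn n (\<lambda>x. inverse (f x))" using Suc by blast
  show ?case
  proof (rule Cn_SucI)
    show "((\<lambda>x. inverse (f x)) has_real_derivative (-1) * (f' x * (inverse (f x) * inverse (f x)))) (at x)" for x
      using DERIV_inverse'[OF d(1)[of x]] Suc.prems(2)[of x] by (simp add: mult_ac)
    show "Cn n (\<lambda>x. (-1) * (f' x * (inverse (f x) * inverse (f x))))"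
      by (intro Cn_mult Cn_const d i)
  qed
qed auto

lemma Cn_affine: "Cn n f \<Longrightarrow> Cn n (\<lambda>x. f (a * x + b))"
proof (induction n arbitrary: f)
  case (Suc n)
  then obtain f' where d: "\<And>x. (f has_real_derivative f' x) (at x)" "Cn n f'" by auto
  show ?case
  proof (rule Cn_SucI)
    show "((\<lambda>x. f (a * x + b)) has_real_derivative a * f' (a * x + b)) (at x)" for x
      by (rule DERIV_cong[OF DERIV_chain2[OF d(1)]]) (auto intro!: derivative_eq_intros)
    show "Cn n (\<lambda>x. a * f' (a * x + b))"
      by (intro Cn_mult Cn_const Suc.IH d)
  qed
qed auto

text \<open>\<open>Cn\<close> only asserts that derivatives exist, which makes its closure
  properties plain inductions. Uniqueness of derivatives identifies the hidden witnesses with the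
  iterates of \<open>deriv\<close>, a form that names all orders at once, as
  \<open>smooth_prod\<close> requires.\<close>

lemma Cn_imp_derivs:
  assumes "\<And>n. Cn n f"
  shows "((deriv ^^ k) f has_real_derivative (deriv ^^ Suc k) f x) (at x)"
proof -
  have "\<forall>n. Cn n ((deriv ^^ k) f)" for k
  proof (induction k)
    case (Suc k)
    show ?case
    proof
      fix n
      from Suc have "Cn (Suc n) ((deriv ^^ k) f)" by blast
      then obtain f' where f': "\<And>x. ((deriv ^^ k) f has_real_derivative f' x) (at x)" "Cn n f'"
        by auto
      have "(deriv ^^ Suc k) f = f'"
        using f'(1) by (auto intro!: ext DERIV_imp_deriv)
      then show "Cn n ((deriv ^^ Suc k) f)" using f' by simp
    qed
  qed (use assms in auto)
  then have "Cn (Suc 0) ((deriv ^^ k) f)" by blast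
  then obtain f' where "\<And>x. ((deriv ^^ k) f has_real_derivative f' x) (at x)" by auto
  then show ?thesis using DERIV_imp_deriv by (metis funpow.simps(2) o_apply)
qed

section \<open>Functions that are flat at the origin\<close>

text \<open>The derivatives of exp(-1/x) are polynomials in 1/x times exp(-1/x). With the polynomial
  as a parameter the family is closed under differentiation, so smoothness follows by
  induction.\<close>

definition flat :: "real poly \<Rightarrow> real \<Rightarrow> real" where
  "flat P x = (if x \<le> 0 then 0 else poly P (1 / x) * exp (- (1 / x)))"

lemma poly_exp_tendsto_0: "((\<lambda>t. poly P t * exp (- t)) \<longlongrightarrow> 0) (at_top :: real filter)"
proof -
  have "((\<lambda>t. \<Sum>i\<le>degree P. coeff P i * (t ^ i / exp t)) \<longlongrightarrow> (\<Sum>i\<le>degree P. coeff P i * 0)) at_top"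
    by (intro tendsto_sum tendsto_mult tendsto_const tendsto_power_div_exp_0)
  then show ?thesis
    by (simp add: poly_altdef sum_distrib_right sum_divide_distrib exp_minus field_simps)
qed

text \<open>With t = 1/x and dt/dx = -t^2, the derivative of P(t) exp(-t) is t^2 (P(t) - P'(t))
  exp(-t). At the origin exponential decay beats every polynomial.\<close>

lemma DERIV_flat: "(flat P has_real_derivative flat ([:0,0,1:] * (P - pderiv P)) x) (at x)"
proof -
  consider "x < 0" | "x = 0" | "x > 0" by linarith
  then show ?thesis
  proof cases
    case 1
    have "((\<lambda>_. 0) has_real_derivative 0) (at x)" by simp
    then have "(flat P has_real_derivative 0) (at x)"
      by (rule DERIV_cong_ev[THEN iffD1, rotated -1])
        (use 1 in \<open>auto simp: flat_def eventually_nhds intro!: exI[of _ "{..<0}"]\<close>)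
    then show ?thesis using 1 by (simp add: flat_def)
  next
    case 2
    have r: "((\<lambda>h. (flat P (0 + h) - flat P 0) / h) \<longlongrightarrow> 0) (at_right 0)"
    proof -
      \<comment> \<open>Dividing by \<open>h\<close> is multiplying by t = 1/h, that is, passing
        from \<open>P\<close> to \<open>pCons 0 P\<close>.\<close>
      have "((\<lambda>t. poly (pCons 0 P) t * exp (- t)) \<longlongrightarrow> 0) at_top" by (rule poly_exp_tendsto_0)
      then have "((\<lambda>h. poly (pCons 0 P) (inverse h) * exp (- inverse h)) \<longlongrightarrow> 0) (at_right 0)"
        by (rule filterlim_compose[OF _ filterlim_inverse_at_top_right])
      then show ?thesis
        by (rule Lim_transform_eventually)
          (auto simp: eventually_at_right_field flat_def field_simps intro!: exI[of _ 1])
    qed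
    have l: "((\<lambda>h. (flat P (0 + h) - flat P 0) / h) \<longlongrightarrow> 0) (at_left 0)"
      by (rule tendsto_eventually)
        (auto simp: eventually_at_left_field flat_def intro!: exI[of _ "-1"])
    have "(flat P has_real_derivative 0) (at 0)"
      unfolding DERIV_def using l r by (simp add: filterlim_split_at)
    then show ?thesis using 2 by (simp add: flat_def)
  next
    case 3
    have i: "((\<lambda>x. 1 / x) has_real_derivative - (1 / x\<^sup>2)) (at x)"
      using DERIV_inverse[of x] 3 by (simp add: divide_inverse power2_eq_square)
    have "((\<lambda>x. poly P (1 / x) * exp (- (1 / x))) has_real_derivative
        poly (pderiv P) (1 / x) * (- (1 / x\<^sup>2)) * exp (- (1 / x)) +
        exp (- (1 / x)) * (- (- (1 / x\<^sup>2))) * poly P (1 / x)) (at x)"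
      by (rule DERIV_mult[OF DERIV_chain2[OF poly_DERIV i] DERIV_chain2[OF DERIV_exp DERIV_minus[OF i]]])
    also have "poly (pderiv P) (1 / x) * (- (1 / x\<^sup>2)) * exp (- (1 / x)) +
        exp (- (1 / x)) * (- (- (1 / x\<^sup>2))) * poly P (1 / x)
        = flat ([:0,0,1:] * (P - pderiv P)) x"
      using 3 by (simp add: flat_def power2_eq_square algebra_simps)
    finally have "((\<lambda>x. poly P (1 / x) * exp (- (1 / x))) has_real_derivative
        flat ([:0,0,1:] * (P - pderiv P)) x) (at x)" .
    then show ?thesis
      by (rule DERIV_cong_ev[THEN iffD1, rotated -1])
        (use 3 in \<open>auto simp: flat_def eventually_nhds intro!: exI[of _ "{0<..}"]\<close>)
  qed
qed

lemma Cn_flat: "Cn n (flat P)"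
proof (induction n arbitrary: P)
  case (Suc n)
  show ?case by (rule Cn_SucI[OF DERIV_flat Suc])
qed auto

definition ramp :: "real \<Rightarrow> real" where
  "ramp x = flat 1 x * inverse (flat 1 x + flat 1 (1 - x))"

lemma flat_one: "flat 1 x \<ge> 0" "x > 0 \<Longrightarrow> flat 1 x > 0" "x \<le> 0 \<Longrightarrow> flat 1 x = 0"
  by (auto simp: flat_def)

text \<open>The numbers x and 1 - x are never both nonpositive; hence the denominator of
  \<open>ramp\<close> does not vanish.\<close>

lemma flat_one_sum_pos: "flat 1 x + flat 1 (1 - x) > 0"
  using flat_one(1,2)[of x] flat_one(1,2)[of "1 - x"] by (cases "x > 0") (auto intro: add_pos_nonneg add_nonneg_pos)

lemma Cn_ramp: "Cn n ramp"
proof -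
  have "Cn n (\<lambda>x. flat 1 x * inverse (flat 1 x + flat 1 ((-1) * x + 1)))"
    using flat_one_sum_pos
    by (intro Cn_mult Cn_inverse Cn_add Cn_flat Cn_affine) (simp add: less_imp_neq[THEN not_sym])
  then show ?thesis by (simp add: ramp_def[abs_def])
qed

lemma ramp_bounds: "0 \<le> ramp x" "ramp x \<le> 1"
  using flat_one_sum_pos[of x] flat_one(1)[of x] flat_one(1)[of "1 - x"]
  by (auto simp: ramp_def field_simps)

lemma ramp_eq: "x \<le> 0 \<Longrightarrow> ramp x = 0" "x \<ge> 1 \<Longrightarrow> ramp x = 1"
  using flat_one_sum_pos[of x] by (auto simp: ramp_def flat_one less_imp_neq[OF flat_one(2), THEN not_sym])

section \<open>Iterated partial derivatives and box cutoffs\<close>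

lemma iter_partial_Nil [simp]: "iter_partial [] f = f"
  by (simp add: iter_partial_def)

lemma iter_partial_Cons:
  "iter_partial (b # bs) f = (\<lambda>x. frechet_derivative (iter_partial bs f) (at x) b)"
  by (simp add: iter_partial_def)

lemma iter_partial_append: "iter_partial (as @ bs) f = iter_partial as (iter_partial bs f)"
  by (simp add: iter_partial_def)

lemma smoothD:
  assumes "smooth f" "set bs \<subseteq> Basis"
  shows "(iter_partial bs f has_derivative frechet_derivative (iter_partial bs f) (at x)) (at x)"
proof -
  have "bs \<in> lists Basis" using assms(2) by auto
  then have "iter_partial bs f differentiable_on UNIV" using assms(1) by (auto simp: smooth_def)
  then show ?thesis by (simp add: differentiable_on_def frechet_derivative_works)
qed

lemma smoothI:
  "(\<And>bs x. set bs \<subseteq> Basis \<Longrightarrow> iter_partial bs f differentiable (at x)) \<Longrightarrow> smooth f"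
  by (auto simp: smooth_def differentiable_on_def in_lists_conv_set subset_iff)

lemma smooth_iter_partial:
  assumes "smooth f" "set bs \<subseteq> Basis" shows "smooth (iter_partial bs f)"
proof (rule smoothI)
  fix as :: "'a list" and x assume "set as \<subseteq> Basis"
  then show "iter_partial as (iter_partial bs f) differentiable (at x)"
    using smoothD[OF assms(1), of "as @ bs" x] assms(2)
    by (auto simp: iter_partial_append differentiable_def)
qed

lemma continuous_iter_partial:
  assumes "smooth f" "set bs \<subseteq> Basis" shows "continuous_on UNIV (iter_partial bs f)"
  using smoothD[OF assms] by (auto intro!: continuous_at_imp_continuous_on has_derivative_continuous)

lemma iter_partial_measurable [measurable]:
  assumes "smooth f" "set bs \<subseteq> Basis" shows "iter_partial bs f \<in> borel_measurable borel"
  using continuous_iter_partial[OF assms] by (rule borel_measurable_continuous_onI)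

lemma iter_partial_lincomb:
  assumes "smooth f" "smooth g" "set bs \<subseteq> Basis"
  shows "iter_partial bs (\<lambda>x. c * f x + d * g x) = (\<lambda>x. c * iter_partial bs f x + d * iter_partial bs g x)"
  using assms(3)
proof (induction bs)
  case (Cons b bs)
  have "((\<lambda>x. c * iter_partial bs f x + d * iter_partial bs g x) has_derivative
      (\<lambda>h. c * frechet_derivative (iter_partial bs f) (at x) h + d * frechet_derivative (iter_partial bs g) (at x) h)) (at x)" for x
    using Cons.prems assms by (intro has_derivative_add has_derivative_mult_right smoothD) auto
  from frechet_derivative_at[OF this, symmetric] show ?case
    using Cons by (simp add: iter_partial_Cons)
qed simp

lemma smooth_lincomb:
  assumes "smooth f" "smooth g" shows "smooth (\<lambda>x. c * f x + d * g x)"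
proof (rule smoothI)
  fix bs :: "'a list" and x assume bs: "set bs \<subseteq> Basis"
  have "((\<lambda>x. c * iter_partial bs f x + d * iter_partial bs g x) has_derivative
      (\<lambda>h. c * frechet_derivative (iter_partial bs f) (at x) h + d * frechet_derivative (iter_partial bs g) (at x) h)) (at x)"
    using bs assms by (intro has_derivative_add has_derivative_mult_right smoothD) auto
  then show "iter_partial bs (\<lambda>x. c * f x + d * g x) differentiable at x"
    by (simp add: iter_partial_lincomb[OF assms bs] differentiableI)
qed

lemma iter_partial_zero: "iter_partial bs (\<lambda>_. 0) = (\<lambda>_. 0)"
  by (induction bs) (auto simp: iter_partial_Cons)

lemma smooth_zero: "smooth (\<lambda>_. 0)"
  by (rule smoothI) (simp add: iter_partial_zero)

lemma smooth_cmult: "smooth f \<Longrightarrow> smooth (\<lambda>x. c * f x)"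
  using smooth_lincomb[of f f c 0] by simp

lemma iter_partial_cmult:
  "smooth f \<Longrightarrow> set bs \<subseteq> Basis \<Longrightarrow> iter_partial bs (\<lambda>x. c * f x) = (\<lambda>x. c * iter_partial bs f x)"
  using iter_partial_lincomb[of f f bs c 0] by simp

text \<open>The two claims are proved together: in the induction step, linearity of the iterated
  derivative presupposes that the sum over the smaller set is smooth.\<close>

lemma
  assumes "\<And>i. i \<in> I \<Longrightarrow> smooth (f i)"
  shows smooth_sum: "smooth (\<lambda>x. \<Sum>i\<in>I. f i x)"
    and iter_partial_sum:
      "set bs \<subseteq> Basis \<Longrightarrow> iter_partial bs (\<lambda>x. \<Sum>i\<in>I. f i x) = (\<lambda>x. \<Sum>i\<in>I. iter_partial bs (f i) x)"
proof -
  have "smooth (\<lambda>x. \<Sum>i\<in>I. f i x) \<and>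
    (set bs \<subseteq> Basis \<longrightarrow> iter_partial bs (\<lambda>x. \<Sum>i\<in>I. f i x) = (\<lambda>x. \<Sum>i\<in>I. iter_partial bs (f i) x))" for bs
    using assms
  proof (induction I rule: infinite_finite_induct)
    case (insert j I)
    then show ?case
      using smooth_lincomb[of "f j" "\<lambda>x. \<Sum>i\<in>I. f i x" 1 1]
        iter_partial_lincomb[of "f j" "\<lambda>x. \<Sum>i\<in>I. f i x" bs 1 1] by auto
  qed (auto simp: smooth_zero iter_partial_zero)
  then show "smooth (\<lambda>x. \<Sum>i\<in>I. f i x)"
    "set bs \<subseteq> Basis \<Longrightarrow> iter_partial bs (\<lambda>x. \<Sum>i\<in>I. f i x) = (\<lambda>x. \<Sum>i\<in>I. iter_partial bs (f i) x)"
    by blast+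
qed

text \<open>Each derivative of a dilated function brings out a factor \<open>c\<close>. This power
  of \<open>c\<close>, against the factor c^(-N) from the measure of the support, decides the size
  of a peak in \<open>W^(l,p)\<close>.\<close>

lemma
  fixes f :: "'a::euclidean_space \<Rightarrow> real"
  assumes "smooth f"
  shows iter_partial_scale: "set bs \<subseteq> Basis \<Longrightarrow>
      iter_partial bs (\<lambda>x. f (c *\<^sub>R (x - a))) = (\<lambda>x. c ^ length bs * iter_partial bs f (c *\<^sub>R (x - a)))"
    and smooth_scale: "smooth (\<lambda>x. f (c *\<^sub>R (x - a)))"
proof -
  have D: "((\<lambda>x. c ^ length bs * iter_partial bs f (c *\<^sub>R (x - a))) has_derivative
      (\<lambda>h. c ^ length bs * frechet_derivative (iter_partial bs f) (at (c *\<^sub>R (x - a))) (c *\<^sub>R h))) (at x)"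
    if "set bs \<subseteq> Basis" for bs x
  proof (rule has_derivative_mult_right)
    have "((\<lambda>x. c *\<^sub>R (x - a)) has_derivative (\<lambda>h. c *\<^sub>R h)) (at x)"
      by (auto intro!: derivative_eq_intros)
    from has_derivative_compose[OF this smoothD[OF assms that]]
    show "((\<lambda>x. iter_partial bs f (c *\<^sub>R (x - a))) has_derivative
        (\<lambda>h. frechet_derivative (iter_partial bs f) (at (c *\<^sub>R (x - a))) (c *\<^sub>R h))) (at x)" .
  qed
  have E: "iter_partial bs (\<lambda>x. f (c *\<^sub>R (x - a))) = (\<lambda>x. c ^ length bs * iter_partial bs f (c *\<^sub>R (x - a)))"
    if "set bs \<subseteq> Basis" for bs
    using that
  proof (induction bs)
    case (Cons b bs)
    have "frechet_derivative (iter_partial bs f) (at y) (c *\<^sub>R b) = c * frechet_derivative (iter_partial bs f) (at y) b" for y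
      using has_derivative_linear[OF smoothD[OF assms, of bs y]] Cons.prems by (simp add: linear_cmul)
    then show ?case
      using frechet_derivative_at[OF D, of bs, symmetric] Cons by (simp add: iter_partial_Cons mult_ac)
  qed simp
  then show "set bs \<subseteq> Basis \<Longrightarrow>
      iter_partial bs (\<lambda>x. f (c *\<^sub>R (x - a))) = (\<lambda>x. c ^ length bs * iter_partial bs f (c *\<^sub>R (x - a)))" .
  show "smooth (\<lambda>x. f (c *\<^sub>R (x - a)))"
    by (rule smoothI) (use D E in \<open>auto simp: differentiable_def\<close>)
qed

text \<open>Locally constant functions have vanishing derivatives of positive order, and of order
  zero if the constant is 0. One statement covers the two uses: off the support of a function (c =
  0) and inside the plateau of a bump (c = 1).\<close>

lemma iter_partial_local_zero:
  assumes "open U" "\<And>x. x \<in> U \<Longrightarrow> f x = c" "bs \<noteq> [] \<or> c = 0" "x \<in> U"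
  shows "iter_partial bs f x = 0"
proof -
  have "iter_partial bs f x = (if bs = [] then c else 0)" if "x \<in> U" for x
    using that
  proof (induction bs arbitrary: x)
    case (Cons b bs)
    have "(iter_partial bs f has_derivative (\<lambda>_. 0)) (at x)"
      by (rule has_derivative_transform_within_open[OF has_derivative_const assms(1) Cons.prems])
        (simp add: Cons.IH)
    from frechet_derivative_at[OF this, symmetric] show ?case by (simp add: iter_partial_Cons)
  qed (use assms(2) in simp)
  then show ?thesis using assms(3,4) by auto
qed

text \<open>\<open>F i k\<close> stands for the \<open>k\<close>-th derivative of the
  \<open>i\<close>-th factor. A partial derivative in direction \<open>b\<close> raises the order of
  the factor \<open>b\<close> by one, so all iterated partials are again such products, with the
  orders counted by \<open>count_list\<close>.\<close>

lemma smooth_prod: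
  fixes F :: "'a::euclidean_space \<Rightarrow> nat \<Rightarrow> real \<Rightarrow> real"
  assumes F: "\<And>i k t. i \<in> Basis \<Longrightarrow> (F i k has_real_derivative F i (Suc k) t) (at t)"
  shows "smooth (\<lambda>x. \<Prod>i\<in>Basis. F i 0 (x \<bullet> i))"
proof -
  have D: "((\<lambda>x. \<Prod>i\<in>Basis. F i (k i) (x \<bullet> i)) has_derivative
      (\<lambda>h. \<Sum>i\<in>Basis. F i (Suc (k i)) (x \<bullet> i) * (h \<bullet> i) * (\<Prod>j\<in>Basis - {i}. F j (k j) (x \<bullet> j)))) (at x)"
    for k :: "'a \<Rightarrow> nat" and x
  proof (rule has_derivative_prod)
    fix i :: 'a assume i: "i \<in> Basis"
    have "((\<lambda>x. x \<bullet> i) has_derivative (\<lambda>h. h \<bullet> i)) (at x)"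
      by (auto intro!: derivative_eq_intros)
    from has_derivative_compose[OF this F[OF i, of "k i", unfolded has_field_derivative_def]]
    show "((\<lambda>x. F i (k i) (x \<bullet> i)) has_derivative (\<lambda>h. F i (Suc (k i)) (x \<bullet> i) * (h \<bullet> i))) (at x)" .
  qed
  have Db: "frechet_derivative (\<lambda>x. \<Prod>i\<in>Basis. F i (k i) (x \<bullet> i)) (at x) b =
      (\<Prod>i\<in>Basis. F i (if i = b then Suc (k i) else k i) (x \<bullet> i))" if b: "b \<in> Basis" for k x b
  proof -
    have "frechet_derivative (\<lambda>x. \<Prod>i\<in>Basis. F i (k i) (x \<bullet> i)) (at x) b =
      (\<Sum>i\<in>Basis. F i (Suc (k i)) (x \<bullet> i) * (b \<bullet> i) * (\<Prod>j\<in>Basis - {i}. F j (k j) (x \<bullet> j)))"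
      using frechet_derivative_at[OF D[of k x], symmetric] by simp
    also have "\<dots> = (\<Sum>i\<in>Basis. if i = b then F b (Suc (k b)) (x \<bullet> b) * (\<Prod>j\<in>Basis - {b}. F j (k j) (x \<bullet> j)) else 0)"
      using b by (intro sum.cong) (auto simp: inner_Basis)
    also have "\<dots> = F b (Suc (k b)) (x \<bullet> b) * (\<Prod>j\<in>Basis - {b}. F j (k j) (x \<bullet> j))"
      using b by simp
    also have "\<dots> = (\<Prod>i\<in>Basis. F i (if i = b then Suc (k i) else k i) (x \<bullet> i))"
      using b by (subst prod.remove[of _ b]) (auto intro!: prod.cong)
    finally show ?thesis .
  qed
  have E: "iter_partial bs (\<lambda>x. \<Prod>i\<in>Basis. F i 0 (x \<bullet> i)) = (\<lambda>x. \<Prod>i\<in>Basis. F i (count_list bs i) (x \<bullet> i))"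
    if "set bs \<subseteq> Basis" for bs
    using that
  proof (induction bs)
    case (Cons b bs)
    then show ?case
      by (auto simp: iter_partial_Cons Db intro!: ext prod.cong)
  qed simp
  show "smooth (\<lambda>x. \<Prod>i\<in>Basis. F i 0 (x \<bullet> i))"
    by (rule smoothI) (use D E in \<open>auto simp: differentiable_def\<close>)
qed

section \<open>Cutoffs of boxes\<close>

text \<open>The slope \<open>n\<close> serves two purposes: as n tends to infinity the cutoffs
  approximate the indicator of the box, and for n = 2 on [-1,1]^N the cutoff has the plateau
  [-1/2,1/2]^N, from which all bumps are rescaled.\<close>

definition box_cutoff :: "real \<Rightarrow> 'a \<Rightarrow> 'a \<Rightarrow> 'a::euclidean_space \<Rightarrow> real" where
  "box_cutoff n a b x = (\<Prod>i\<in>Basis. ramp (n * (x \<bullet> i - a \<bullet> i)) * ramp (n * (b \<bullet> i - x \<bullet> i)))"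

lemma smooth_box_cutoff: "smooth (box_cutoff n a b)"
proof -
  define f where "f i t = ramp (n * t + (- n * (a \<bullet> i))) * ramp ((- n) * t + n * (b \<bullet> i))" for i t
  have "Cn m (f i)" for m i
    unfolding f_def by (intro Cn_mult Cn_affine Cn_ramp)
  then have "smooth (\<lambda>x. \<Prod>i\<in>Basis. ((deriv ^^ 0) (f i)) (x \<bullet> i))"
    by (intro smooth_prod[where F = "\<lambda>i k. (deriv ^^ k) (f i)"] Cn_imp_derivs)
  moreover have "(\<lambda>x. \<Prod>i\<in>Basis. ((deriv ^^ 0) (f i)) (x \<bullet> i)) = box_cutoff n a b"
    by (auto simp: box_cutoff_def f_def algebra_simps intro!: ext prod.cong)
  ultimately show ?thesis by simp
qed

lemma box_cutoff_bounds: "0 \<le> box_cutoff n a b x" "box_cutoff n a b x \<le> 1"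
  unfolding box_cutoff_def
  by (auto intro!: prod_nonneg prod_le_1 mult_nonneg_nonneg mult_le_one ramp_bounds)

lemma box_cutoff_eq_0: "n \<ge> 0 \<Longrightarrow> x \<notin> box a b \<Longrightarrow> box_cutoff n a b x = 0"
  by (auto simp: box_cutoff_def mem_box not_less prod_zero_iff mult_nonneg_nonpos
      intro!: ramp_eq(1) mult_nonneg_nonpos bexI[rotated])

lemma box_cutoff_eq_1:
  "(\<And>i. i \<in> Basis \<Longrightarrow> n * (x \<bullet> i - a \<bullet> i) \<ge> 1 \<and> n * (b \<bullet> i - x \<bullet> i) \<ge> 1) \<Longrightarrow> box_cutoff n a b x = 1"
  by (auto simp: box_cutoff_def ramp_eq(2))

lemma test_function_box_cutoff:
  assumes "n \<ge> 0" "cbox a b \<subseteq> \<Omega>"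
  shows "test_function \<Omega> (box_cutoff n a b)"
proof -
  have "{x. box_cutoff n a b x \<noteq> 0} \<subseteq> box a b" using box_cutoff_eq_0[OF assms(1)] by blast
  then have *: "closure {x. box_cutoff n a b x \<noteq> 0} \<subseteq> cbox a b"
    by (meson closure_minimal closed_cbox box_subset_cbox order_trans)
  then have "compact (closure {x. box_cutoff n a b x \<noteq> 0})"
    using bounded_cbox bounded_subset compact_eq_bounded_closed by blast
  then show ?thesis
    using * assms smooth_box_cutoff by (auto simp: test_function_def)
qed

section \<open>Integration by parts and the fundamental lemma\<close>

lemma iter_partial_eq_0_outside:
  assumes "closed K" "\<And>x. x \<notin> K \<Longrightarrow> f x = 0" "x \<notin> K"
  shows "iter_partial bs f x = 0"
  by (rule iter_partial_local_zero[of "- K" f 0]) (use assms in auto)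

lemma borel_imp_lebesgue_measurable:
  "f \<in> borel_measurable borel \<Longrightarrow> f \<in> borel_measurable lebesgue"
  by (rule measurable_completion) simp

lemma integrable_compact_support:
  fixes f :: "'a::euclidean_space \<Rightarrow> real"
  assumes "continuous_on UNIV f" "compact K" "\<And>x. x \<notin> K \<Longrightarrow> f x = 0"
  shows "integrable lborel f"
proof -
  have "integrable lborel (\<lambda>x. indicator K x *\<^sub>R f x)"
    using assms by (intro borel_integrable_compact) (auto intro: continuous_on_subset)
  also have "(\<lambda>x. indicator K x *\<^sub>R f x) = f"
    using assms(3) by (auto simp: indicator_def intro!: ext)
  finally show ?thesis .
qed

lemma bounded_compact_support:
  fixes f :: "'a::euclidean_space \<Rightarrow> real"
  assumes "continuous_on UNIV f" "compact K" "\<And>x. x \<notin> K \<Longrightarrow> f x = 0"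
  obtains C where "C \<ge> 0" "\<And>x. \<bar>f x\<bar> \<le> C"
proof -
  have "bounded (f ` K)"
    using assms by (intro compact_imp_bounded compact_continuous_image) (auto intro: continuous_on_subset)
  then obtain C where C: "\<And>x. x \<in> K \<Longrightarrow> \<bar>f x\<bar> \<le> C" by (auto simp: bounded_iff)
  show ?thesis
  proof (rule that[of "max C 0"])
    show "\<bar>f x\<bar> \<le> max C 0" for x
      using C[of x] assms(3)[of x] by (cases "x \<in> K") auto
  qed auto
qed

text \<open>By translation invariance the difference quotients have integral zero.\<close>

lemma integral_partial_derivative_eq_0:
  fixes F :: "'a::euclidean_space \<Rightarrow> real"
  assumes F: "\<And>x. (F has_derivative F' x) (at x)" and cont: "continuous_on UNIV (\<lambda>x. F' x b)"
    and K: "compact K" "\<And>x. x \<notin> K \<Longrightarrow> F x = 0"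
  shows "(LINT x|lborel. F' x b) = 0"
proof -
  define t where "t n = 1 / real (Suc n)" for n
  have t: "0 < t n" "t n \<le> 1" for n by (auto simp: t_def)
  have t0: "t \<longlonglongrightarrow> 0" unfolding t_def using LIMSEQ_inverse_real_of_nat by (simp add: divide_inverse)
  define s where "s n x = (F (t n *\<^sub>R b + x) - F x) / t n" for n x
  have contF: "continuous_on UNIV F"
    using F by (auto intro!: continuous_at_imp_continuous_on has_derivative_continuous)
  then have [measurable]: "F \<in> borel_measurable borel" by (rule borel_measurable_continuous_onI)
  have [measurable]: "(\<lambda>x. F' x b) \<in> borel_measurable borel"
    using cont by (rule borel_measurable_continuous_onI)
  have F0: "F' x b = 0" if "x \<notin> K" for x
  proof -
    have "(F has_derivative (\<lambda>_. 0)) (at x)"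
      by (rule has_derivative_transform_within_open[OF has_derivative_const, of "- K" _ 0])
        (use K that in \<open>auto simp: compact_imp_closed\<close>)
    then show ?thesis using F[of x] has_derivative_unique by metis
  qed
  obtain C where C: "C \<ge> 0" "\<And>x. \<bar>F' x b\<bar> \<le> C"
    using bounded_compact_support[OF cont K(1) F0] by blast
  \<comment> \<open>By the mean value theorem the difference quotient is a nearby value of the
    derivative, which yields both its limit and the uniform bound \<open>C\<close>.\<close>
  have mvt: "\<exists>z. 0 < z \<and> z < t n \<and> s n x = F' (z *\<^sub>R b + x) b" for n x
  proof -
    have "((\<lambda>u. F (u *\<^sub>R b + x)) has_real_derivative F' (u *\<^sub>R b + x) b) (at u)" for u
    proof -
      have "((\<lambda>u. u *\<^sub>R b + x) has_derivative (\<lambda>h. h *\<^sub>R b)) (at u)"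
        by (auto intro!: derivative_eq_intros)
      from has_derivative_compose[OF this F[of "u *\<^sub>R b + x"]]
      have "((\<lambda>u. F (u *\<^sub>R b + x)) has_derivative (\<lambda>h. F' (u *\<^sub>R b + x) (h *\<^sub>R b))) (at u)" .
      moreover have "F' (u *\<^sub>R b + x) (h *\<^sub>R b) = F' (u *\<^sub>R b + x) b * h" for h
        using has_derivative_linear[OF F[of "u *\<^sub>R b + x"]] by (simp add: linear_cmul)
      ultimately show ?thesis by (simp add: has_field_derivative_def)
    qed
    from MVT2[OF t(1)[of n] this] obtain z where
      "0 < z" "z < t n" "F (t n *\<^sub>R b + x) - F (0 *\<^sub>R b + x) = (t n - 0) * F' (z *\<^sub>R b + x) b" by blast
    then show ?thesis using t(1)[of n] by (intro exI[of _ z]) (auto simp: s_def field_simps)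
  qed
  obtain R where R: "\<And>x. x \<in> K \<Longrightarrow> norm x \<le> R"
    using compact_imp_bounded[OF K(1)] unfolding bounded_iff by blast
  have "(\<lambda>n. LINT x|lborel. s n x) \<longlonglongrightarrow> (LINT x|lborel. F' x b)"
  \<comment> \<open>Since \<open>t n \<le> 1\<close>, a shift by \<open>t n *\<^sub>R b\<close>
    moves no point further than \<open>norm b\<close>, so all difference quotients vanish outside
    this ball.\<close>
  proof (rule integral_dominated_convergence[where w = "\<lambda>x. indicator (cball 0 (R + norm b)) x *\<^sub>R C"])
    show "integrable lborel (\<lambda>x. indicator (cball 0 (R + norm b)) x *\<^sub>R C)"
      by (intro borel_integrable_compact) auto
    show "AE x in lborel. (\<lambda>n. s n x) \<longlonglongrightarrow> F' x b"
    proof (rule AE_I2)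
      fix x
      obtain z where z: "\<And>n. 0 < z n" "\<And>n. z n < t n" "\<And>n. s n x = F' (z n *\<^sub>R b + x) b"
        using mvt[of _ x] by metis
      have "z \<longlonglongrightarrow> 0"
        by (rule tendsto_sandwich[OF _ _ tendsto_const t0])
          (simp_all add: less_imp_le[OF z(1)] less_imp_le[OF z(2)])
      then have "(\<lambda>n. z n *\<^sub>R b + x) \<longlonglongrightarrow> 0 *\<^sub>R b + x" by (intro tendsto_intros)
      then have "(\<lambda>n. F' (z n *\<^sub>R b + x) b) \<longlonglongrightarrow> F' (0 *\<^sub>R b + x) b"
        by (rule continuous_on_tendsto_compose[OF cont]) auto
      then show "(\<lambda>n. s n x) \<longlonglongrightarrow> F' x b" using z(3) by simp
    qed
    fix n
    show "AE x in lborel. norm (s n x) \<le> indicator (cball 0 (R + norm b)) x *\<^sub>R C"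
    proof (rule AE_I2)
      fix x
      show "norm (s n x) \<le> indicator (cball 0 (R + norm b)) x *\<^sub>R C"
      proof (cases "x \<in> cball 0 (R + norm b)")
        case True
        then show ?thesis using mvt[of n x] C(2) by auto
      next
        case False
        have "norm x \<le> norm (t n *\<^sub>R b + x) + norm (t n *\<^sub>R b)"
          by (metis add_diff_cancel_left' norm_triangle_sub norm_minus_commute add.commute)
        moreover have "norm (t n *\<^sub>R b) \<le> norm b" using t[of n] by (simp add: mult_left_le_one_le)
        ultimately have "t n *\<^sub>R b + x \<notin> K" "x \<notin> K"
          using R[of "t n *\<^sub>R b + x"] R[of x] False norm_ge_zero[of b] by (auto simp: not_le) (smt (verit) norm_ge_zero)+
        then show ?thesis using K(2) C(1) by (simp add: s_def)
      qed
    qed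
  qed (auto simp: s_def)
  moreover have "(LINT x|lborel. s n x) = 0" for n
  proof -
    have i: "integrable lborel F" by (rule integrable_compact_support[OF contF K])
    have i2: "integrable lborel (\<lambda>x. F (t n *\<^sub>R b + x))"
      using i integrable_distr_eq[of "(+) (t n *\<^sub>R b)" lborel borel F] by (simp add: lborel_distr_plus)
    have "(LINT x|lborel. F (t n *\<^sub>R b + x)) = (LINT x|lborel. F x)"
      using integral_distr[of "(+) (t n *\<^sub>R b)" lborel borel F] by (simp add: lborel_distr_plus)
    then show ?thesis unfolding s_def using i i2 by simp
  qed
  ultimately show ?thesis using LIMSEQ_unique[OF _ tendsto_const] by simp
qed

text \<open>One derivative is moved at a time, the outermost first, so the list arrives reversed on
  \<open>f\<close>. The weak derivatives of a series are later taken along that reversed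
  list.\<close>

lemma integration_by_parts:
  fixes f g :: "'a::euclidean_space \<Rightarrow> real"
  assumes f: "smooth f" and g: "smooth g" and K: "compact K" "\<And>x. x \<notin> K \<Longrightarrow> g x = 0"
    and bs: "set bs \<subseteq> Basis"
  shows "(LINT x|lborel. f x * iter_partial bs g x) =
    (-1) ^ length bs * (LINT x|lborel. iter_partial (rev bs) f x * g x)"
  using f bs
proof (induction bs arbitrary: f)
  case (Cons b bs)
  define G where "G = iter_partial bs g"
  have G: "smooth G" unfolding G_def using Cons.prems by (intro smooth_iter_partial g) auto
  have G0: "x \<notin> K \<Longrightarrow> G x = 0" for x
    unfolding G_def using K by (intro iter_partial_eq_0_outside[of K]) (auto simp: compact_imp_closed)
  have G0': "x \<notin> K \<Longrightarrow> iter_partial [b] G x = 0" for x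
    using K G0 by (intro iter_partial_eq_0_outside[of K]) (auto simp: compact_imp_closed)
  have cf: "continuous_on UNIV f" "continuous_on UNIV (iter_partial [b] f)"
    "continuous_on UNIV G" "continuous_on UNIV (iter_partial [b] G)"
    using continuous_iter_partial[of f "[]"] continuous_iter_partial[of f "[b]"]
      continuous_iter_partial[of G "[]"] continuous_iter_partial[of G "[b]"] G Cons.prems by auto
  have D: "((\<lambda>x. f x * G x) has_derivative
      (\<lambda>h. f x * frechet_derivative G (at x) h + frechet_derivative f (at x) h * G x)) (at x)" for x
    using smoothD[of f "[]" x] smoothD[of G "[]" x] Cons.prems G by (intro has_derivative_mult) auto
  have "(LINT x|lborel. f x * iter_partial [b] G x + iter_partial [b] f x * G x) = 0"
    using integral_partial_derivative_eq_0[OF D _ K(1), of b] cf G0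
    by (simp add: iter_partial_Cons continuous_on_add continuous_on_mult)
  moreover have "integrable lborel (\<lambda>x. f x * iter_partial [b] G x)"
    by (rule integrable_compact_support[OF _ K(1)]) (use cf G0' in \<open>auto intro!: continuous_intros\<close>)
  moreover have "integrable lborel (\<lambda>x. iter_partial [b] f x * G x)"
    by (rule integrable_compact_support[OF _ K(1)]) (use cf G0 in \<open>auto intro!: continuous_intros\<close>)
  ultimately have "(LINT x|lborel. f x * iter_partial [b] G x) = - (LINT x|lborel. iter_partial [b] f x * G x)"
    by simp
  also have "(LINT x|lborel. iter_partial [b] f x * G x) =
      (-1) ^ length bs * (LINT x|lborel. iter_partial (rev bs) (iter_partial [b] f) x * g x)"
    unfolding G_def using Cons.prems by (intro Cons.IH smooth_iter_partial) auto
  finally show ?case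
    by (simp add: G_def iter_partial_append[symmetric])
qed simp

lemma lebesgue_on_integral_eq:
  fixes f :: "'a::euclidean_space \<Rightarrow> real"
  assumes "\<Omega> \<in> sets lebesgue" "\<And>x. x \<notin> \<Omega> \<Longrightarrow> f x = 0"
  shows "(LINT x|lebesgue_on \<Omega>. f x) = (LINT x|lebesgue. f x)"
    and "integrable (lebesgue_on \<Omega>) f \<longleftrightarrow> integrable lebesgue f"
proof -
  have "(\<lambda>x. indicator \<Omega> x *\<^sub>R f x) = f" using assms(2) by (auto simp: indicator_def intro!: ext)
  then show "(LINT x|lebesgue_on \<Omega>. f x) = (LINT x|lebesgue. f x)"
    "integrable (lebesgue_on \<Omega>) f \<longleftrightarrow> integrable lebesgue f"
    using assms(1) by (auto simp: integral_restrict_space integrable_restrict_space)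
qed

section \<open>The fundamental lemma of the calculus of variations\<close>

text \<open>Boxes form an intersection-stable generator of the Borel sets, so a Dynkin argument
  carries the vanishing of the integral to all Borel sets. The whole space is not a box;
  \<open>f0\<close> is what handles complements.\<close>

lemma AE_eq_0_if_integral_boxes_eq_0:
  fixes f :: "'a::euclidean_space \<Rightarrow> real"
  assumes f: "integrable lborel f" and f0: "(LINT x|lborel. f x) = 0"
    and box: "\<And>a b. (LINT x:box a b|lborel. f x) = 0"
  shows "AE x in lborel. f x = 0"
proof -
  have si: "set_integrable lborel A f" if "A \<in> sets borel" for A
    unfolding set_integrable_def by (rule integrable_mult_indicator) (use f that in auto)
  have "(LINT x:A|lborel. f x) = 0" if "A \<in> sets borel" for A
  proof -
    let ?G = "range (\<lambda>(a, b). box a b :: 'a set)"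
    have "Int_stable ?G" by (auto simp: Int_stable_def box_Int_box)
    moreover have "?G \<subseteq> Pow UNIV" by auto
    moreover have "A \<in> sigma_sets UNIV ?G" using that by (simp add: borel_eq_box)
    ultimately show ?thesis
    proof (induction rule: sigma_sets_induct_disjoint)
      case (basic A) then show ?case using box by auto
    next
      case (compl A)
      have "A \<in> sets borel" using compl by (simp add: borel_eq_box)
      then have "(LINT x:A|lborel. f x) + (LINT x:UNIV - A|lborel. f x) = (LINT x:A \<union> (UNIV - A)|lborel. f x)"
        by (intro set_integral_Un[symmetric] si) auto
      then show ?case using compl f0 by (simp add: set_lebesgue_integral_def Un_Diff_cancel)
    next
      case (union A)
      have [measurable]: "A i \<in> sets borel" for i using union(2) by (auto simp: borel_eq_box)
      then have "(LINT x:(\<Union>i. A i)|lborel. f x) = (\<Sum>i. (LINT x:(A i)|lborel. f x))"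
        using union by (intro lebesgue_integral_countable_add si) (auto simp: disjoint_family_on_def)
      then show ?case using union by simp
    qed (simp add: set_lebesgue_integral_def)
  qed
  then show ?thesis
    using density_unique_real[OF f, of "\<lambda>_. 0"] by (simp add: set_lebesgue_integral_def)
qed

lemma box_cutoff_tendsto_indicator: "(\<lambda>n. box_cutoff (real n) a b x) \<longlonglongrightarrow> indicator (box a b) x"
proof (cases "x \<in> box a b")
  case True
  have "\<forall>\<^sub>F n in sequentially. \<forall>i\<in>Basis. real n * (x \<bullet> i - a \<bullet> i) \<ge> 1 \<and> real n * (b \<bullet> i - x \<bullet> i) \<ge> 1"
  proof (rule eventually_ball_finite[OF finite_Basis], rule ballI)
    fix i :: 'a assume "i \<in> Basis"
    then have *: "x \<bullet> i - a \<bullet> i > 0" "b \<bullet> i - x \<bullet> i > 0" using True by (auto simp: mem_box)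
    have "\<forall>\<^sub>F n in sequentially. real n * y \<ge> 1" if "y > 0" for y
      using filterlim_real_sequentially[unfolded filterlim_at_top, rule_format, of "1 / y"]
      by eventually_elim (use that in \<open>simp add: field_simps\<close>)
    then show "\<forall>\<^sub>F n in sequentially. real n * (x \<bullet> i - a \<bullet> i) \<ge> 1 \<and> real n * (b \<bullet> i - x \<bullet> i) \<ge> 1"
      using * by (intro eventually_conj) auto
  qed
  then have "\<forall>\<^sub>F n in sequentially. box_cutoff (real n) a b x = indicator (box a b) x"
    by eventually_elim (use True in \<open>simp add: box_cutoff_eq_1\<close>)
  then show ?thesis by (rule tendsto_eventually)
next
  case False
  then show ?thesis by (simp add: box_cutoff_eq_0)
qed

lemma test_functionD:
  assumes "test_function \<Omega> \<phi>"
  obtains K where "compact K" "K \<subseteq> \<Omega>" "\<And>x. x \<notin> K \<Longrightarrow> \<phi> x = 0" "smooth \<phi>"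
proof (rule that[of "closure {x. \<phi> x \<noteq> 0}"])
  show "x \<notin> closure {x. \<phi> x \<noteq> 0} \<Longrightarrow> \<phi> x = 0" for x
    using closure_subset[of "{x. \<phi> x \<noteq> 0}"] by blast
qed (use assms in \<open>auto simp: test_function_def\<close>)

text \<open>On a closed box inside \<Omega> the function is integrable, and box cutoffs turn the
  hypothesis into vanishing integrals over open boxes. The boundary of the closed box is null, and
  countably many such boxes cover \<Omega>.\<close>

theorem AE_eq_0_if_integral_test_functions_eq_0:
  fixes g :: "'a::euclidean_space \<Rightarrow> real"
  assumes "open \<Omega>" and g: "locally_integrable \<Omega> g"
    and test: "\<And>\<phi>. test_function \<Omega> \<phi> \<Longrightarrow> (LINT x|lebesgue_on \<Omega>. g x * \<phi> x) = 0"
  shows "AE x in lebesgue_on \<Omega>. g x = 0"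
proof -
  have lebesgue\<Omega>: "\<Omega> \<in> sets lebesgue" using assms(1) by auto
  have [measurable]: "box a b \<in> sets lebesgue" for a b :: 'a
    by (intro sets_completionI_sets) auto
  have *: "AE x in lebesgue. x \<in> cbox c d \<longrightarrow> g x = 0" if cd: "cbox c d \<subseteq> \<Omega>" for c d
  proof -
    have gi: "set_integrable lebesgue (cbox c d) g"
      using g cd by (auto simp: locally_integrable_def)
    define f where "f x = indicator (box c d) x * g x" for x
    have fi: "integrable lebesgue f"
      using set_integrable_subset[OF gi, of "box c d"] box_subset_cbox[of c d]
      by (simp add: set_integrable_def f_def[abs_def])
    have gm: "(\<lambda>x. indicator (cbox c d) x * g x) \<in> borel_measurable lebesgue"
      using gi by (auto simp: set_integrable_def)
    have fb: "(LINT x|lebesgue. indicator (box a b) x * f x) = 0" for a b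
    proof -
      \<comment> \<open>Restricting to \<open>box c d\<close> replaces \<open>box a b\<close> by a
        smaller box; if it is not empty, its closure lies in \<Omega>, so its cutoffs are test
        functions.\<close>
      obtain a' b' where ab: "box a b \<inter> box c d = box a' b'" by (rule that[OF box_Int_box])
      show ?thesis
      proof (cases "box a' b' = {}")
        case True
        then have "(\<lambda>x. indicator (box a b) x * f x) = (\<lambda>_. 0)"
          using ab by (auto simp: f_def indicator_def fun_eq_iff)
        then show ?thesis by simp
      next
        case False
        have "box a' b' \<subseteq> cbox c d" using ab box_subset_cbox[of c d] by blast
        then have "closure (box a' b') \<subseteq> cbox c d" by (rule closure_minimal[OF _ closed_cbox])
        then have cb: "cbox a' b' \<subseteq> cbox c d" by (simp add: closure_box[OF False])
        have eq: "indicator (box a b) x * f x = indicator (cbox c d) x * g x * indicator (box a' b') x" for x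
          using ab box_subset_cbox[of c d] by (auto simp: f_def indicator_def split: if_splits)
        have "(\<lambda>n. LINT x|lebesgue. indicator (cbox c d) x * g x * box_cutoff (real n) a' b' x)
          \<longlonglongrightarrow> (LINT x|lebesgue. indicator (cbox c d) x * g x * indicator (box a' b') x)"
        proof (rule integral_dominated_convergence[where w="\<lambda>x. norm (indicator (cbox c d) x * g x)"])
          have [measurable]: "box_cutoff (real n) a' b' \<in> borel_measurable lebesgue" for n
            using iter_partial_measurable[OF smooth_box_cutoff, of "[]" "real n" a' b'] by (intro borel_imp_lebesgue_measurable) simp
          show "(\<lambda>x. indicator (cbox c d) x * g x * box_cutoff (real n) a' b' x) \<in> borel_measurable lebesgue" for n
            using gm by (rule borel_measurable_times) simp
          show "(\<lambda>x. indicator (cbox c d) x * g x * indicator (box a' b') x) \<in> borel_measurable lebesgue"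
            using gm by (rule borel_measurable_times) (simp add: borel_imp_lebesgue_measurable)
          show "integrable lebesgue (\<lambda>x. norm (indicator (cbox c d) x * g x))"
            using gi by (auto simp: set_integrable_def)
          show "AE x in lebesgue. norm (indicator (cbox c d) x * g x * box_cutoff (real n) a' b' x)
              \<le> norm (indicator (cbox c d) x * g x)" for n
            using box_cutoff_bounds[of "real n" a' b'] by (auto simp: abs_mult mult_left_le)
          show "AE x in lebesgue. (\<lambda>n. indicator (cbox c d) x * g x * box_cutoff (real n) a' b' x)
              \<longlonglongrightarrow> indicator (cbox c d) x * g x * indicator (box a' b') x"
            by (intro AE_I2 tendsto_mult tendsto_const box_cutoff_tendsto_indicator)
        qed
        moreover have "(LINT x|lebesgue. indicator (cbox c d) x * g x * box_cutoff (real n) a' b' x) = 0" for n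
        proof -
          have z: "box_cutoff (real n) a' b' x = 0" if "x \<notin> cbox c d" for x
            using box_cutoff_eq_0[of "real n" x a' b'] that cb box_subset_cbox[of a' b'] by auto
          have "(\<lambda>x. indicator (cbox c d) x * g x * box_cutoff (real n) a' b' x) = (\<lambda>x. g x * box_cutoff (real n) a' b' x)"
            using z by (auto simp: indicator_def intro!: ext)
          moreover have "(LINT x|lebesgue_on \<Omega>. g x * box_cutoff (real n) a' b' x) = 0"
            using cb cd by (intro test test_function_box_cutoff) auto
          ultimately show ?thesis
            using lebesgue_on_integral_eq(1)[OF lebesgue\<Omega>, of "\<lambda>x. g x * box_cutoff (real n) a' b' x"] z cd by auto
        qed
        ultimately show ?thesis unfolding eq using LIMSEQ_unique[OF _ tendsto_const] by simp
      qed
    qed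
    \<comment> \<open>The argument with boxes runs over \<open>lborel\<close>, so \<open>f\<close>
      is replaced by a Borel function that agrees with it almost everywhere.\<close>
    obtain f' where f'[measurable]: "f' \<in> borel_measurable lborel" and ff: "AE x in lborel. f x = f' x"
      using completion_ex_borel_measurable_real[of f lborel] fi by auto
    have ff': "AE x in lebesgue. f x = f' x" using ff by (rule AE_completion)
    have f'm[measurable]: "f' \<in> borel_measurable lebesgue" by (rule measurable_completion[OF f'])
    have [measurable]: "f \<in> borel_measurable lebesgue" using fi by auto
    have i1: "integrable lebesgue f'"
      using integrable_cong_AE_imp[OF fi f'm ] ff' by auto
    then have i: "integrable lborel f'" using integrable_completion[OF f'] by simp
    have b: "(LINT x:box a b|lborel. f' x) = 0" for a b
    proof -
      have "(LINT x:box a b|lborel. f' x) = (LINT x|lebesgue. indicator (box a b) x * f' x)"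
        unfolding set_lebesgue_integral_def using f' by (subst integral_completion) auto
      also have "\<dots> = (LINT x|lebesgue. indicator (box a b) x * f x)"
        using ff' by (intro integral_cong_AE) auto
      finally show ?thesis using fb by simp
    qed
    have "(LINT x|lborel. f' x) = (LINT x|lebesgue. f' x)"
      using f' by (subst integral_completion) auto
    also have "\<dots> = (LINT x|lebesgue. f x)"
      using ff' by (intro integral_cong_AE) auto
    also have "\<dots> = (LINT x|lebesgue. indicator (box c d) x * f x)"
      by (rule arg_cong[where f="integral\<^sup>L lebesgue"]) (auto simp: f_def indicator_def)
    finally have "AE x in lborel. f' x = 0"
      using fb b i by (intro AE_eq_0_if_integral_boxes_eq_0) auto
    then have "AE x in lebesgue. f' x = 0" by (rule AE_completion)
    moreover have "AE x in lebesgue. x \<notin> cbox c d - box c d"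
      using negligible_frontier_interval[of c d] by (intro AE_not_in) (simp add: negligible_iff_null_sets)
    ultimately show ?thesis
      using ff' by eventually_elim (auto simp: f_def indicator_def split: if_splits)
  qed
  obtain D where D: "countable D" "\<And>X. X \<in> D \<Longrightarrow> \<exists>a b. X = cbox a b" "\<Union>D = \<Omega>"
    using open_countable_Union_open_cbox[OF assms(1)] by metis
  have "AE x in lebesgue. \<forall>X\<in>D. x \<in> X \<longrightarrow> g x = 0"
    unfolding AE_ball_countable[OF D(1)]
  proof
    fix X assume "X \<in> D"
    then obtain c d where "X = cbox c d" using D(2) by blast
    then show "AE x in lebesgue. x \<in> X \<longrightarrow> g x = 0"
      using * D(3) \<open>X \<in> D\<close> by blast
  qed
  then have "AE x in lebesgue. x \<in> \<Omega> \<longrightarrow> g x = 0"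
    by eventually_elim (use D(3) in blast)
  then show ?thesis using lebesgue\<Omega> by (simp add: AE_restrict_space_iff)
qed

section \<open>Weak derivatives and Sobolev spaces\<close>

lemma Lp_space_ereal:
  "f \<in> Lp_space (ereal p) \<Omega> \<longleftrightarrow>
    f \<in> borel_measurable (lebesgue_on \<Omega>) \<and> integrable (lebesgue_on \<Omega>) (\<lambda>x. \<bar>f x\<bar> powr p)"
  by (simp add: Lp_space_def)

lemma powr_abs_add_le:
  fixes a b p :: real
  assumes "0 \<le> p"
  shows "\<bar>a + b\<bar> powr p \<le> 2 powr p * (\<bar>a\<bar> powr p + \<bar>b\<bar> powr p)"
proof -
  have "\<bar>a + b\<bar> powr p \<le> (2 * max \<bar>a\<bar> \<bar>b\<bar>) powr p"
    using assms by (intro powr_mono2) auto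
  also have "\<dots> = 2 powr p * max \<bar>a\<bar> \<bar>b\<bar> powr p" by (simp add: powr_mult)
  also have "\<dots> \<le> 2 powr p * (\<bar>a\<bar> powr p + \<bar>b\<bar> powr p)"
    by (intro mult_left_mono) (auto simp: max_def)
  finally show ?thesis .
qed

lemma Lp_space_lincomb:
  assumes "0 \<le> p" "f \<in> Lp_space (ereal p) \<Omega>" "g \<in> Lp_space (ereal p) \<Omega>"
  shows "(\<lambda>x. c * f x + d * g x) \<in> Lp_space (ereal p) \<Omega>"
proof -
  have [measurable]: "f \<in> borel_measurable (lebesgue_on \<Omega>)" "g \<in> borel_measurable (lebesgue_on \<Omega>)"
    using assms by (auto simp: Lp_space_ereal)
  have "integrable (lebesgue_on \<Omega>) (\<lambda>x. \<bar>c * f x + d * g x\<bar> powr p)"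
  proof (rule Bochner_Integration.integrable_bound)
    show "integrable (lebesgue_on \<Omega>) (\<lambda>x. 2 powr p * (\<bar>c\<bar> powr p * \<bar>f x\<bar> powr p + \<bar>d\<bar> powr p * \<bar>g x\<bar> powr p))"
      using assms by (auto simp: Lp_space_ereal)
    show "AE x in lebesgue_on \<Omega>. norm (\<bar>c * f x + d * g x\<bar> powr p)
        \<le> norm (2 powr p * (\<bar>c\<bar> powr p * \<bar>f x\<bar> powr p + \<bar>d\<bar> powr p * \<bar>g x\<bar> powr p))"
      using powr_abs_add_le[OF assms(1), of "c * f _" "d * g _"]
      by (auto simp: abs_mult powr_mult)
  qed simp
  then show ?thesis by (simp add: Lp_space_ereal)
qed

lemma abs_le_1_plus_powr:
  fixes a p :: real assumes "1 \<le> p" shows "\<bar>a\<bar> \<le> 1 + \<bar>a\<bar> powr p"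
proof (cases "\<bar>a\<bar> \<le> 1")
  case False
  then have "\<bar>a\<bar> powr 1 \<le> \<bar>a\<bar> powr p" using assms by (intro powr_mono) auto
  then show ?thesis using False by simp
qed (use powr_ge_zero[of "\<bar>a\<bar>" p] in linarith)

lemma locally_integrable_Lp:
  assumes "\<Omega> \<in> sets lebesgue" "1 \<le> p" "f \<in> Lp_space (ereal p) \<Omega>"
  shows "locally_integrable \<Omega> f"
  unfolding locally_integrable_def
proof (intro allI impI)
  fix K assume K: "compact K \<and> K \<subseteq> \<Omega>"
  then have Kl: "K \<in> lmeasurable" by (simp add: lmeasurable_compact)
  have "f \<in> borel_measurable (lebesgue_on \<Omega>)" using assms by (simp add: Lp_space_ereal)
  then have m: "(\<lambda>x. indicator \<Omega> x *\<^sub>R f x) \<in> borel_measurable lebesgue"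
    using assms(1) by (simp add: borel_measurable_restrict_space_iff mult.commute)
  have i: "integrable lebesgue (\<lambda>x. indicator \<Omega> x * \<bar>f x\<bar> powr p)"
    using assms by (simp add: Lp_space_ereal integrable_restrict_space)
  show "set_integrable lebesgue K f"
    unfolding set_integrable_def
  proof (rule Bochner_Integration.integrable_bound)
    show "integrable lebesgue (\<lambda>x. indicator K x + indicator \<Omega> x * \<bar>f x\<bar> powr p)"
      using Kl i by (intro Bochner_Integration.integrable_add integrable_real_indicator) (auto simp: fmeasurable_def)
    have "(\<lambda>x. indicator K x *\<^sub>R f x) = (\<lambda>x. indicator K x * (indicator \<Omega> x *\<^sub>R f x))"
      using K by (auto simp: indicator_def fun_eq_iff)
    then show "(\<lambda>x. indicator K x *\<^sub>R f x) \<in> borel_measurable lebesgue"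
      using m fmeasurableD[OF Kl] by simp
    show "AE x in lebesgue. norm (indicator K x *\<^sub>R f x) \<le> norm (indicator K x + indicator \<Omega> x * \<bar>f x\<bar> powr p)"
      using K abs_le_1_plus_powr[OF assms(2), of "f _"] by (intro AE_I2) (auto simp: indicator_def)
  qed
qed

lemma integrable_mult_compact_support:
  fixes f \<psi> :: "'a::euclidean_space \<Rightarrow> real"
  assumes f: "locally_integrable \<Omega> f" and K: "compact K" "K \<subseteq> \<Omega>" "\<And>x. x \<notin> K \<Longrightarrow> \<psi> x = 0"
    and cont: "continuous_on UNIV \<psi>"
  shows "integrable lebesgue (\<lambda>x. f x * \<psi> x)"
proof -
  obtain C where C: "C \<ge> 0" "\<And>x. \<bar>\<psi> x\<bar> \<le> C"
    using bounded_compact_support[OF cont K(1,3)] by blast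
  have fK: "integrable lebesgue (\<lambda>x. indicator K x *\<^sub>R f x)"
    using f K by (auto simp: locally_integrable_def set_integrable_def)
  have [measurable]: "\<psi> \<in> borel_measurable lebesgue"
    using borel_measurable_continuous_onI[OF cont] by (rule borel_imp_lebesgue_measurable)
  have eq: "(\<lambda>x. f x * \<psi> x) = (\<lambda>x. (indicator K x *\<^sub>R f x) * \<psi> x)"
    using K(3) by (auto simp: indicator_def fun_eq_iff)
  show ?thesis
    unfolding eq
  proof (rule Bochner_Integration.integrable_bound)
    show "integrable lebesgue (\<lambda>x. C * (indicator K x *\<^sub>R f x))" using fK by simp
    show "(\<lambda>x. (indicator K x *\<^sub>R f x) * \<psi> x) \<in> borel_measurable lebesgue"
      using borel_measurable_integrable[OF fK] by (rule borel_measurable_times) simp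
    show "AE x in lebesgue. norm (indicator K x *\<^sub>R f x * \<psi> x) \<le> norm (C * (indicator K x *\<^sub>R f x))"
      using C by (intro AE_I2) (auto simp: indicator_def abs_mult mult.commute intro: mult_right_mono)
  qed
qed

lemma integrable_mult_test_function:
  fixes f :: "'a::euclidean_space \<Rightarrow> real"
  assumes "\<Omega> \<in> sets lebesgue" "locally_integrable \<Omega> f" "test_function \<Omega> \<phi>" "set bs \<subseteq> Basis"
  shows "integrable (lebesgue_on \<Omega>) (\<lambda>x. f x * iter_partial bs \<phi> x)"
proof -
  obtain K where K: "compact K" "K \<subseteq> \<Omega>" "\<And>x. x \<notin> K \<Longrightarrow> \<phi> x = 0" and s: "smooth \<phi>"
    using test_functionD[OF assms(3)] by blast
  have 0: "x \<notin> K \<Longrightarrow> iter_partial bs \<phi> x = 0" for x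
    using iter_partial_eq_0_outside[of K \<phi>] K by (auto simp: compact_imp_closed)
  then have "integrable lebesgue (\<lambda>x. f x * iter_partial bs \<phi> x)"
    using integrable_mult_compact_support[OF assms(2) K(1,2), of "iter_partial bs \<phi>"]
      continuous_iter_partial[OF s assms(4)] by blast
  then show ?thesis
    using lebesgue_on_integral_eq(2)[OF assms(1), of "\<lambda>x. f x * iter_partial bs \<phi> x"] 0 K(2) by auto
qed

definition index_list :: "('a::euclidean_space \<Rightarrow> nat) \<Rightarrow> 'a list" where
  "index_list \<alpha> = concat (map (\<lambda>b. replicate (\<alpha> b) b) basis_list)"

lemma set_index_list: "set (index_list \<alpha>) \<subseteq> Basis"
  by (auto simp: index_list_def basis_list)

lemma length_index_list: "length (index_list \<alpha>) = (\<Sum>b\<in>Basis. \<alpha> b)"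
proof -
  have "length (index_list \<alpha>) = sum_list (map \<alpha> basis_list)"
    by (simp add: index_list_def length_concat o_def)
  also have "\<dots> = (\<Sum>b\<in>Basis. \<alpha> b)"
    using sum_list_distinct_conv_sum_set[OF basis_list(1)] by (simp add: basis_list(2))
  finally show ?thesis .
qed

lemma D_alpha_eq: "D_alpha \<alpha> \<phi> = iter_partial (index_list \<alpha>) \<phi>"
  by (simp add: D_alpha_def index_list_def)

lemma has_weak_derivative_lincomb:
  assumes \<Omega>: "\<Omega> \<in> sets lebesgue"
    and u: "has_weak_derivative \<Omega> \<alpha> u g" and v: "has_weak_derivative \<Omega> \<alpha> v h"
  shows "has_weak_derivative \<Omega> \<alpha> (\<lambda>x. c * u x + d * v x) (\<lambda>x. c * g x + d * h x)"
proof -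
  have li: "locally_integrable \<Omega> (\<lambda>x. c * u x + d * v x)"
    if "locally_integrable \<Omega> u" "locally_integrable \<Omega> v" for u v
    unfolding locally_integrable_def
  proof (intro allI impI set_integral_add(1) set_integrable_mult_right)
    fix K assume "compact K \<and> K \<subseteq> \<Omega>"
    then show "set_integrable lebesgue K u" "set_integrable lebesgue K v"
      using that by (auto simp: locally_integrable_def)
  qed
  have l: "locally_integrable \<Omega> u" "locally_integrable \<Omega> v" "locally_integrable \<Omega> g" "locally_integrable \<Omega> h"
    using u v by (auto simp: has_weak_derivative_def)
  show ?thesis
    unfolding has_weak_derivative_def
  proof (intro conjI allI impI li l)
    fix \<phi> assume \<phi>: "test_function \<Omega> \<phi>"
    note i = integrable_mult_test_function[OF \<Omega> _ \<phi>]
    have i1: "integrable (lebesgue_on \<Omega>) (\<lambda>x. w x * D_alpha \<alpha> \<phi> x)"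
      "integrable (lebesgue_on \<Omega>) (\<lambda>x. w x * \<phi> x)" if "locally_integrable \<Omega> w" for w
      using i[OF that set_index_list] i[OF that, of "[]"] by (auto simp: D_alpha_eq)
    have e: "(LINT x|lebesgue_on \<Omega>. (c * w x + d * z x) * \<psi> x) =
       c * (LINT x|lebesgue_on \<Omega>. w x * \<psi> x) + d * (LINT x|lebesgue_on \<Omega>. z x * \<psi> x)"
      if "integrable (lebesgue_on \<Omega>) (\<lambda>x. w x * \<psi> x)" "integrable (lebesgue_on \<Omega>) (\<lambda>x. z x * \<psi> x)" for w z \<psi> :: "'a \<Rightarrow> real"
      using that by (simp add: distrib_right mult.assoc)
    show "(LINT x|lebesgue_on \<Omega>. (c * u x + d * v x) * D_alpha \<alpha> \<phi> x) =
         (-1) ^ (\<Sum>b\<in>Basis. \<alpha> b) * (LINT x|lebesgue_on \<Omega>. (c * g x + d * h x) * \<phi> x)"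
      using u v \<phi> by (simp add: e i1 l has_weak_derivative_def distrib_left mult.left_commute)
  qed
qed

lemma sobolev_space_lincomb:
  assumes \<Omega>: "\<Omega> \<in> sets lebesgue" and p: "0 \<le> p"
    and u: "u \<in> sobolev_space l (ereal p) \<Omega>" and v: "v \<in> sobolev_space l (ereal p) \<Omega>"
  shows "(\<lambda>x. c * u x + d * v x) \<in> sobolev_space l (ereal p) \<Omega>"
  unfolding sobolev_space_def
proof (intro CollectI conjI ballI)
  show "(\<lambda>x. c * u x + d * v x) \<in> Lp_space (ereal p) \<Omega>"
    using u v p by (intro Lp_space_lincomb) (auto simp: sobolev_space_def)
  fix \<alpha> :: "'a \<Rightarrow> nat" assume "\<alpha> \<in> multi_indices l"
  then obtain g h where "g \<in> Lp_space (ereal p) \<Omega>" "has_weak_derivative \<Omega> \<alpha> u g"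
    "h \<in> Lp_space (ereal p) \<Omega>" "has_weak_derivative \<Omega> \<alpha> v h"
    using u v unfolding sobolev_space_def by blast
  then show "\<exists>g\<in>Lp_space (ereal p) \<Omega>. has_weak_derivative \<Omega> \<alpha> (\<lambda>x. c * u x + d * v x) g"
    using has_weak_derivative_lincomb[OF \<Omega>] Lp_space_lincomb[OF p]
    by (intro bexI[of _ "\<lambda>x. c * g x + d * h x"]) auto
qed

section \<open>From the Sobolev norm to the L^p norm\<close>

text \<open>Both \<open>v\<close> and the representative picked by \<open>SOME\<close> are weak
  derivatives of order zero, so their difference annihilates every test function.\<close>

lemma ae_eq_weak_derivative_0:
  assumes "open \<Omega>" "1 \<le> p" "v \<in> Lp_space (ereal p) \<Omega>"
  shows "AE x in lebesgue_on \<Omega>. weak_derivative \<Omega> (\<lambda>_. 0) v x = v x"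
proof -
  have \<Omega>: "\<Omega> \<in> sets lebesgue" using assms(1) by auto
  have lv: "locally_integrable \<Omega> v" using locally_integrable_Lp[OF \<Omega> assms(2,3)] .
  have D0: "D_alpha (\<lambda>_. 0) \<phi> = \<phi>" for \<phi> :: "'a \<Rightarrow> real"
  proof -
    have "index_list (\<lambda>_. 0) = ([] :: 'a list)" using length_index_list[of "\<lambda>_. 0 :: nat"] by simp
    then show ?thesis by (simp add: D_alpha_eq)
  qed
  define g where "g = weak_derivative \<Omega> (\<lambda>_. 0) v"
  have "has_weak_derivative \<Omega> (\<lambda>_. 0) v v" using lv by (simp add: has_weak_derivative_def D0)
  then have g: "has_weak_derivative \<Omega> (\<lambda>_. 0) v g"
    unfolding g_def weak_derivative_def by (rule someI[of "has_weak_derivative \<Omega> (\<lambda>_. 0) v"])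
  then have lg: "locally_integrable \<Omega> g" by (simp add: has_weak_derivative_def)
  have "AE x in lebesgue_on \<Omega>. g x - v x = 0"
  proof (rule AE_eq_0_if_integral_test_functions_eq_0[OF assms(1)])
    show "locally_integrable \<Omega> (\<lambda>x. g x - v x)"
      using lg lv by (auto simp: locally_integrable_def intro: set_integral_diff(1))
    fix \<phi> assume \<phi>: "test_function \<Omega> \<phi>"
    then have "(LINT x|lebesgue_on \<Omega>. v x * \<phi> x) = (LINT x|lebesgue_on \<Omega>. g x * \<phi> x)"
      using g by (simp add: has_weak_derivative_def D0)
    then show "(LINT x|lebesgue_on \<Omega>. (g x - v x) * \<phi> x) = 0"
      using integrable_mult_test_function[OF \<Omega> lg \<phi>, of "[]"] integrable_mult_test_function[OF \<Omega> lv \<phi>, of "[]"]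
      by (simp add: left_diff_distrib)
  qed
  then show ?thesis by eventually_elim (simp add: g_def)
qed

text \<open>The order zero summand is at most the whole norm. This estimate is all that the proof of
  closedness draws from Sobolev convergence.\<close>

lemma integral_powr_less_if_sobolev_norm_less:
  assumes \<Omega>: "open \<Omega>" and p: "1 \<le> p" and v: "v \<in> Lp_space (ereal p) \<Omega>"
    and less: "sobolev_norm l (ereal p) \<Omega> v < \<epsilon>"
  shows "(LINT x|lebesgue_on \<Omega>. \<bar>v x\<bar> powr p) < \<epsilon> powr p"
proof -
  let ?w = "weak_derivative \<Omega> (\<lambda>_. 0) v"
  have nn: "0 \<le> Lp_norm (ereal p) \<Omega> f" for f by (simp add: Lp_norm_def)
  have "Lp_norm (ereal p) \<Omega> ?w \<le> sobolev_norm l (ereal p) \<Omega> v"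
    unfolding sobolev_norm_def
    by (rule member_le_sum[of "\<lambda>_. 0", OF _ nn finite_multi_indices]) (simp add: multi_indices_def)
  then have *: "(LINT x|lebesgue_on \<Omega>. \<bar>?w x\<bar> powr p) powr (1 / p) < \<epsilon>"
    using less by (simp add: Lp_norm_def)
  have ae: "AE x in lebesgue_on \<Omega>. ?w x = v x" by (rule ae_eq_weak_derivative_0[OF \<Omega> p v])
  have i: "integrable (lebesgue_on \<Omega>) (\<lambda>x. \<bar>v x\<bar> powr p)" using v by (simp add: Lp_space_ereal)
  \<comment> \<open>Measurability of the chosen representative comes from its a.e. equality with
    \<open>v\<close>, as Lebesgue measure is complete.\<close>
  have "?w \<in> borel_measurable (lebesgue_on \<Omega>)"
  proof -
    have \<Omega>': "\<Omega> \<in> sets lebesgue" using \<Omega> by auto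
    have "v \<in> borel_measurable (lebesgue_on \<Omega>)" using v by (simp add: Lp_space_ereal)
    then have "(\<lambda>x. v x * indicator \<Omega> x) \<in> borel_measurable lebesgue"
      using \<Omega>' by (simp add: borel_measurable_restrict_space_iff mult.commute)
    moreover have "AE x in lebesgue. v x * indicator \<Omega> x = ?w x * indicator \<Omega> x"
      using ae[unfolded AE_restrict_space_iff[of \<Omega> lebesgue, simplified, OF \<Omega>']]
      by eventually_elim (auto simp: indicator_def)
    ultimately have "(\<lambda>x. ?w x * indicator \<Omega> x) \<in> borel_measurable lebesgue"
      by (rule borel_measurable_AE)
    then show ?thesis
      using \<Omega>' by (simp add: borel_measurable_restrict_space_iff mult.commute)
  qed
  then have "(LINT x|lebesgue_on \<Omega>. \<bar>?w x\<bar> powr p) = (LINT x|lebesgue_on \<Omega>. \<bar>v x\<bar> powr p)"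
    using ae i by (intro integral_cong_AE) auto
  then have lt: "(LINT x|lebesgue_on \<Omega>. \<bar>v x\<bar> powr p) powr (1 / p) < \<epsilon>" using * by simp
  have "(LINT x|lebesgue_on \<Omega>. \<bar>v x\<bar> powr p) = ((LINT x|lebesgue_on \<Omega>. \<bar>v x\<bar> powr p) powr (1 / p)) powr p"
    using p by (simp add: powr_powr powr_one integral_nonneg_AE)
  also have "\<dots> < \<epsilon> powr p" using lt p by (intro powr_less_mono2) auto
  finally show ?thesis .
qed

section \<open>Series of test functions\<close>

text \<open>The sum is dominated termwise: \<open>\<Sum>|a m| \<le> sup (2 ^ (m + 1) * |a m|)\<close>, whose \<open>p\<close>-th power is at
  most the sum of the \<open>p\<close>-th powers of the scaled terms.\<close>

lemma
  fixes a :: "nat \<Rightarrow> 'x \<Rightarrow> real"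
  assumes p: "1 \<le> p" and \<kappa>: "0 \<le> \<kappa>"
    and [measurable]: "\<And>m. a m \<in> borel_measurable M"
    and i: "\<And>m. integrable M (\<lambda>x. \<bar>a m x\<bar> powr p)"
    and bound: "\<And>m. (LINT x|M. \<bar>a m x\<bar> powr p) \<le> \<kappa> * 2 powr (- (real m + 1) * (p + 1))"
  shows AE_summable_Lp: "AE x in M. summable (\<lambda>m. \<bar>a m x\<bar>)"
    and integrable_suminf_Lp: "integrable M (\<lambda>x. (\<Sum>m. \<bar>a m x\<bar>) powr p)"
    and integral_suminf_Lp_le: "(LINT x|M. (\<Sum>m. \<bar>a m x\<bar>) powr p) \<le> \<kappa>"
proof -
  \<comment> \<open>The exponent \<open>p + 1\<close> in the bound splits: \<open>p\<close> of it
    pays for this weight, and the remaining 1 leaves the factors 2^(-(m+1)), which sum to 1.\<close>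
  define b where "b m x = 2 powr ((real m + 1) * p) * \<bar>a m x\<bar> powr p" for m x
  have b0: "0 \<le> b m x" for m x by (simp add: b_def)
  have [measurable]: "b m \<in> borel_measurable M" for m by (simp add: b_def[abs_def])
  have bi: "integrable M (b m)" for m using i by (simp add: b_def[abs_def])
  have bI: "(LINT x|M. b m x) \<le> \<kappa> * (1/2) ^ Suc m" for m
  proof -
    have "(LINT x|M. b m x) = 2 powr ((real m + 1) * p) * (LINT x|M. \<bar>a m x\<bar> powr p)" by (simp add: b_def)
    also have "\<dots> \<le> 2 powr ((real m + 1) * p) * (\<kappa> * 2 powr (- (real m + 1) * (p + 1)))"
      by (intro mult_left_mono bound) auto
    also have "\<dots> = \<kappa> * 2 powr ((real m + 1) * p + (- (real m + 1) * (p + 1)))"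
      by (simp add: powr_add)
    also have "(real m + 1) * p + (- (real m + 1) * (p + 1)) = - real (Suc m)" by (simp add: algebra_simps)
    also have "2 powr (- real (Suc m)) = (1/2) ^ Suc m"
      by (simp only: powr_minus powr_realpow) (simp add: power_one_over inverse_eq_divide)
    finally show ?thesis .
  qed
  have geo: "(\<lambda>m. \<kappa> * (1/2) ^ Suc m) sums \<kappa>"
    using sums_mult[OF power_half_series, of \<kappa>] by simp
  have nonneg: "0 \<le> (LINT x|M. b m x)" for m using b0 by (simp add: integral_nonneg_AE)
  have sI: "summable (\<lambda>m. LINT x|M. b m x)"
    by (rule summable_comparison_test'[OF sums_summable[OF geo], of 0]) (use bI nonneg in \<open>simp del: power_Suc\<close>)
  have S: "AE x in M. summable (\<lambda>m. b m x)"
  proof -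
    have "(\<integral>\<^sup>+x. (\<Sum>m. ennreal (b m x)) \<partial>M) = (\<Sum>m. \<integral>\<^sup>+x. ennreal (b m x) \<partial>M)"
      by (intro nn_integral_suminf) auto
    also have "\<dots> = (\<Sum>m. ennreal (LINT x|M. b m x))"
      by (intro arg_cong[where f=suminf] ext nn_integral_eq_integral bi) (use b0 in auto)
    also have "\<dots> \<noteq> \<infinity>"
      using ennreal_suminf_neq_top[OF sI nonneg] by simp
    finally have "AE x in M. (\<Sum>m. ennreal (b m x)) \<noteq> \<infinity>"
      by (intro nn_integral_PInf_AE) auto
    then show ?thesis by eventually_elim (use b0 in \<open>auto intro: summable_suminf_not_top\<close>)
  qed
  have pt: "summable (\<lambda>m. \<bar>a m x\<bar>) \<and> (\<Sum>m. \<bar>a m x\<bar>) powr p \<le> (\<Sum>m. b m x)"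
    if s: "summable (\<lambda>m. b m x)" for x
  proof -
    define T where "T = (\<Sum>m. b m x) powr (1 / p)"
    have pos: "0 \<le> (\<Sum>m. b m x)" using s b0 by (intro suminf_nonneg) auto
    have le: "\<bar>a m x\<bar> \<le> T * (1/2) ^ Suc m" for m
    proof -
      have "b m x \<le> (\<Sum>m. b m x)" using sum_le_suminf[OF s, of "{m}"] b0 by simp
      then have "b m x powr (1 / p) \<le> T" unfolding T_def using p b0 by (intro powr_mono2) auto
      also have "b m x powr (1 / p) = 2 powr (real (Suc m)) * \<bar>a m x\<bar>"
        using p by (simp add: b_def powr_mult powr_powr add.commute)
      also have "2 powr (real (Suc m)) = (2::real) ^ Suc m" by (rule powr_realpow) simp
      finally show ?thesis by (simp add: field_simps power_one_over)
    qed
    have geoT: "(\<lambda>m. T * (1/2) ^ Suc m) sums T"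
      using sums_mult[OF power_half_series, of T] by simp
    have sa: "summable (\<lambda>m. \<bar>a m x\<bar>)"
      by (rule summable_comparison_test'[OF sums_summable[OF geoT], of 0]) (use le in \<open>simp del: power_Suc\<close>)
    have "(\<Sum>m. \<bar>a m x\<bar>) \<le> T"
      using suminf_le[OF le sa sums_summable[OF geoT]] sums_unique[OF geoT] by simp
    then have "(\<Sum>m. \<bar>a m x\<bar>) powr p \<le> T powr p"
      using p sa by (intro powr_mono2) (auto intro: suminf_nonneg)
    also have "T powr p = (\<Sum>m. b m x)" using p pos by (simp add: T_def powr_powr)
    finally show ?thesis using sa by blast
  qed
  show "AE x in M. summable (\<lambda>m. \<bar>a m x\<bar>)" using S by eventually_elim (use pt in blast)
  have Sn: "AE x in M. summable (\<lambda>m. norm (b m x))" using S b0 by simp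
  have sn: "summable (\<lambda>m. LINT x|M. norm (b m x))" using sI b0 by simp
  have iS: "integrable M (\<lambda>x. \<Sum>m. b m x)" by (rule integrable_suminf[OF bi Sn sn])
  have IS: "(LINT x|M. (\<Sum>m. b m x)) \<le> \<kappa>"
    using integral_suminf[OF bi Sn sn] suminf_le[OF bI sI sums_summable[OF geo]] sums_unique[OF geo] by simp
  have dom: "AE x in M. (\<Sum>m. \<bar>a m x\<bar>) powr p \<le> (\<Sum>m. b m x)"
    using S by eventually_elim (use pt in blast)
  show *: "integrable M (\<lambda>x. (\<Sum>m. \<bar>a m x\<bar>) powr p)"
    by (rule Bochner_Integration.integrable_bound[OF iS]) (use dom in \<open>auto elim!: eventually_mono\<close>)
  show "(LINT x|M. (\<Sum>m. \<bar>a m x\<bar>) powr p) \<le> \<kappa>"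
    using integral_mono_AE[OF * iS dom] IS by simp
qed

lemma Lp_space_UNIV_subset:
  assumes "\<Omega> \<in> sets lebesgue" "f \<in> Lp_space (ereal p) UNIV"
  shows "f \<in> Lp_space (ereal p) \<Omega>"
proof -
  have f: "f \<in> borel_measurable lebesgue" "integrable lebesgue (\<lambda>x. \<bar>f x\<bar> powr p)"
    using assms(2) by (auto simp: Lp_space_ereal lebesgue_on_UNIV_eq)
  have "integrable lebesgue (\<lambda>x. indicator \<Omega> x *\<^sub>R \<bar>f x\<bar> powr p)"
    by (rule integrable_mult_indicator[OF assms(1) f(2)])
  then show ?thesis
    using f assms(1) by (auto simp: Lp_space_ereal integrable_restrict_space measurable_restrict_space1)
qed

lemma Lp_space_suminf:
  fixes a :: "nat \<Rightarrow> 'a::euclidean_space \<Rightarrow> real"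
  assumes p: "1 \<le> p" and \<kappa>: "0 \<le> \<kappa>"
    and m[measurable]: "\<And>m. a m \<in> borel_measurable lebesgue"
    and i: "\<And>m. integrable lebesgue (\<lambda>x. \<bar>a m x\<bar> powr p)"
    and bound: "\<And>m. (LINT x|lebesgue. \<bar>a m x\<bar> powr p) \<le> \<kappa> * 2 powr (- (real m + 1) * (p + 1))"
  shows "(\<lambda>x. \<Sum>m. \<bar>a m x\<bar>) \<in> Lp_space (ereal p) UNIV"
    and "(\<lambda>x. \<Sum>m. a m x) \<in> Lp_space (ereal p) UNIV"
proof -
  note s = AE_summable_Lp[OF p \<kappa> m i bound]
  note int = integrable_suminf_Lp[OF p \<kappa> m i bound]
  have "integrable lebesgue (\<lambda>x. \<bar>\<Sum>m. \<bar>a m x\<bar>\<bar> powr p)"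
    by (rule integrable_cong_AE_imp[OF int]) (use s in \<open>auto elim!: eventually_mono simp: suminf_nonneg\<close>)
  then show "(\<lambda>x. \<Sum>m. \<bar>a m x\<bar>) \<in> Lp_space (ereal p) UNIV"
    by (simp add: Lp_space_ereal lebesgue_on_UNIV_eq)
  have "integrable lebesgue (\<lambda>x. \<bar>\<Sum>m. a m x\<bar> powr p)"
  proof (rule Bochner_Integration.integrable_bound[OF int])
    show "AE x in lebesgue. norm (\<bar>\<Sum>m. a m x\<bar> powr p) \<le> norm ((\<Sum>m. \<bar>a m x\<bar>) powr p)"
      using s by eventually_elim (use p in \<open>auto intro!: powr_mono2 summable_rabs\<close>)
  qed simp
  then show "(\<lambda>x. \<Sum>m. a m x) \<in> Lp_space (ereal p) UNIV"
    by (simp add: Lp_space_ereal lebesgue_on_UNIV_eq)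
qed

text \<open>All partial sums lie below the \<open>L^p\<close> function \<Sum>|a m|, whose product
  with a bounded \<psi> of compact support is integrable; dominated convergence applies.\<close>

lemma sums_integral_mult_compact_support:
  fixes a :: "nat \<Rightarrow> 'a::euclidean_space \<Rightarrow> real"
  assumes p: "1 \<le> p" and \<kappa>: "0 \<le> \<kappa>"
    and m[measurable]: "\<And>m. a m \<in> borel_measurable lebesgue"
    and i: "\<And>m. integrable lebesgue (\<lambda>x. \<bar>a m x\<bar> powr p)"
    and bound: "\<And>m. (LINT x|lebesgue. \<bar>a m x\<bar> powr p) \<le> \<kappa> * 2 powr (- (real m + 1) * (p + 1))"
    and cont: "continuous_on UNIV \<psi>" and K: "compact K" "\<And>x. x \<notin> K \<Longrightarrow> \<psi> x = 0"
  shows "(\<lambda>m. LINT x|lebesgue. a m x * \<psi> x) sums (LINT x|lebesgue. (\<Sum>m. a m x) * \<psi> x)"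
proof -
  have [measurable]: "\<psi> \<in> borel_measurable lebesgue"
    using borel_measurable_continuous_onI[OF cont] by (rule borel_imp_lebesgue_measurable)
  have li: "locally_integrable UNIV f" if "f \<in> Lp_space (ereal p) UNIV" for f :: "'a \<Rightarrow> real"
    using locally_integrable_Lp[OF _ p that] by simp
  have int: "integrable lebesgue (\<lambda>x. f x * \<psi> x)" if "f \<in> Lp_space (ereal p) UNIV" for f
    using integrable_mult_compact_support[OF li[OF that] K(1) _ K(2) cont] by simp
  have ai: "integrable lebesgue (\<lambda>x. a m x * \<psi> x)" for m
    using i by (intro int) (simp add: Lp_space_ereal lebesgue_on_UNIV_eq)
  note s = AE_summable_Lp[OF p \<kappa> m i bound]
  have "(\<lambda>n. LINT x|lebesgue. (\<Sum>m<n. a m x) * \<psi> x) \<longlonglongrightarrow> (LINT x|lebesgue. (\<Sum>m. a m x) * \<psi> x)"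
  proof (rule integral_dominated_convergence[where w="\<lambda>x. norm ((\<Sum>m. \<bar>a m x\<bar>) * \<psi> x)"])
    show "integrable lebesgue (\<lambda>x. norm ((\<Sum>m. \<bar>a m x\<bar>) * \<psi> x))"
      by (intro integrable_norm int Lp_space_suminf(1)[OF p \<kappa> m i bound])
    show "AE x in lebesgue. (\<lambda>n. (\<Sum>m<n. a m x) * \<psi> x) \<longlonglongrightarrow> (\<Sum>m. a m x) * \<psi> x"
      using s by eventually_elim
        (auto intro!: tendsto_mult summable_LIMSEQ dest: summable_rabs_cancel)
    show "AE x in lebesgue. norm ((\<Sum>m<n. a m x) * \<psi> x) \<le> norm ((\<Sum>m. \<bar>a m x\<bar>) * \<psi> x)" for n
      using s
    proof eventually_elim
      case (elim x)
      have "\<bar>\<Sum>m<n. a m x\<bar> \<le> (\<Sum>m<n. \<bar>a m x\<bar>)" by (rule sum_abs)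
      also have "\<dots> \<le> (\<Sum>m. \<bar>a m x\<bar>)" using elim by (intro sum_le_suminf) auto
      also have "\<dots> \<le> \<bar>\<Sum>m. \<bar>a m x\<bar>\<bar>" by simp
      finally show ?case by (simp add: abs_mult mult_right_mono)
    qed
  qed simp_all
  moreover have "(LINT x|lebesgue. (\<Sum>m<n. a m x) * \<psi> x) = (\<Sum>m<n. LINT x|lebesgue. a m x * \<psi> x)" for n
    using ai by (simp add: sum_distrib_right)
  ultimately show ?thesis by (simp add: sums_def)
qed

lemma test_function_iter_partial:
  assumes "test_function UNIV h" "set bs \<subseteq> Basis" "0 < p"
  shows "integrable lebesgue (\<lambda>x. \<bar>iter_partial bs h x\<bar> powr p)"
    and "(LINT x|lebesgue. \<bar>iter_partial bs h x\<bar> powr p) = (LINT x|lborel. \<bar>iter_partial bs h x\<bar> powr p)"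
    and "iter_partial bs h \<in> borel_measurable lebesgue"
proof -
  obtain K where K: "compact K" "\<And>x. x \<notin> K \<Longrightarrow> h x = 0" and s: "smooth h"
    using test_functionD[OF assms(1)] by metis
  have 0: "x \<notin> K \<Longrightarrow> iter_partial bs h x = 0" for x
    using iter_partial_eq_0_outside[of K h] K by (auto simp: compact_imp_closed)
  have c: "continuous_on UNIV (iter_partial bs h)" by (rule continuous_iter_partial[OF s assms(2)])
  then have c': "continuous_on UNIV (\<lambda>x. \<bar>iter_partial bs h x\<bar> powr p)"
    using assms(3) by (intro continuous_on_powr' continuous_on_rabs) auto
  have b: "(\<lambda>x. \<bar>iter_partial bs h x\<bar> powr p) \<in> borel_measurable lborel"
    using borel_measurable_continuous_onI[OF c'] by simp
  have "integrable lborel (\<lambda>x. \<bar>iter_partial bs h x\<bar> powr p)"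
    by (rule integrable_compact_support[OF c' K(1)]) (simp add: 0)
  then show "integrable lebesgue (\<lambda>x. \<bar>iter_partial bs h x\<bar> powr p)"
    using integrable_completion[OF b] by simp
  show "(LINT x|lebesgue. \<bar>iter_partial bs h x\<bar> powr p) = (LINT x|lborel. \<bar>iter_partial bs h x\<bar> powr p)"
    by (rule integral_completion[OF b])
  show "iter_partial bs h \<in> borel_measurable lebesgue"
    by (rule borel_imp_lebesgue_measurable[OF borel_measurable_continuous_onI[OF c]])
qed

section \<open>Termwise weak differentiation\<close>

text \<open>Each term is integrated by parts classically, and both sides are summed over
  \<open>m\<close>. The weak derivative is the series of derivatives along the reversed index list,
  which is why the bound is imposed on arbitrary lists of directions.\<close>

lemma sobolev_space_suminf:
  fixes h :: "nat \<Rightarrow> 'a::euclidean_space \<Rightarrow> real"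
  assumes \<Omega>: "\<Omega> \<in> sets lebesgue" and p: "1 \<le> p" and \<kappa>: "0 \<le> \<kappa>"
    and h: "\<And>m. test_function UNIV (h m)"
    and bound: "\<And>m bs. set bs \<subseteq> Basis \<Longrightarrow> length bs \<le> l \<Longrightarrow>
      (LINT x|lborel. \<bar>iter_partial bs (h m) x\<bar> powr p) \<le> \<kappa> * 2 powr (- (real m + 1) * (p + 1))"
  shows "(\<lambda>x. \<Sum>m. h m x) \<in> sobolev_space l (ereal p) \<Omega>"
proof -
  define D where "D bs = (\<lambda>x. \<Sum>m. iter_partial bs (h m) x)" for bs
  have p0: "0 < p" using p by simp
  note T = test_function_iter_partial[OF h _ p0]
  have b: "(LINT x|lebesgue. \<bar>iter_partial bs (h m) x\<bar> powr p) \<le> \<kappa> * 2 powr (- (real m + 1) * (p + 1))"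
    if "set bs \<subseteq> Basis" "length bs \<le> l" for bs m
    using bound[OF that] T(2)[OF that(1)] by simp
  have DL: "D bs \<in> Lp_space (ereal p) \<Omega>" if "set bs \<subseteq> Basis" "length bs \<le> l" for bs
    unfolding D_def using T(1,3) b that
    by (intro Lp_space_UNIV_subset[OF \<Omega>] Lp_space_suminf(2)[OF p \<kappa>]) auto
  have weak: "has_weak_derivative \<Omega> \<alpha> (D []) (D (rev (index_list \<alpha>)))" if \<alpha>: "\<alpha> \<in> multi_indices l" for \<alpha>
    unfolding has_weak_derivative_def
  proof (intro conjI allI impI)
    let ?bs = "index_list \<alpha>"
    have len: "length ?bs \<le> l" using \<alpha> by (simp add: length_index_list multi_indices_def)
    have set: "set ?bs \<subseteq> Basis" by (rule set_index_list)
    show "locally_integrable \<Omega> (D [])" "locally_integrable \<Omega> (D (rev ?bs))"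
      using set len by (intro locally_integrable_Lp[OF \<Omega> p] DL; simp)+
    fix \<phi> :: "'a \<Rightarrow> real" assume "test_function \<Omega> \<phi>"
    then obtain K where K: "compact K" "K \<subseteq> \<Omega>" "\<And>x. x \<notin> K \<Longrightarrow> \<phi> x = 0" and s: "smooth \<phi>"
      using test_functionD by metis
    have 0: "x \<notin> K \<Longrightarrow> iter_partial ?bs \<phi> x = 0" for x
      using iter_partial_eq_0_outside[of K \<phi>] K by (auto simp: compact_imp_closed)
    have bm: "iter_partial bs (h m) \<in> borel_measurable lborel" if "set bs \<subseteq> Basis" for bs m
      using h[of m] that iter_partial_measurable[of "h m" bs] by (simp add: test_function_def)
    have \<phi>m: "iter_partial ?bs \<phi> \<in> borel_measurable lborel" "\<phi> \<in> borel_measurable lborel"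
      using iter_partial_measurable[OF s, of ?bs] iter_partial_measurable[OF s, of "[]"] set by auto
    have c: "continuous_on UNIV (iter_partial ?bs \<phi>)" "continuous_on UNIV \<phi>"
      using continuous_iter_partial[OF s, of ?bs] continuous_iter_partial[OF s, of "[]"] set by auto
    have 1: "(LINT x|lebesgue. iter_partial [] (h m) x * iter_partial ?bs \<phi> x)
      = (-1) ^ length ?bs * (LINT x|lebesgue. iter_partial (rev ?bs) (h m) x * \<phi> x)" for m
    proof -
      have "(LINT x|lebesgue. iter_partial [] (h m) x * iter_partial ?bs \<phi> x)
        = (LINT x|lborel. iter_partial [] (h m) x * iter_partial ?bs \<phi> x)"
        using bm[of "[]"] \<phi>m by (intro integral_completion borel_measurable_times) auto
      also have "\<dots> = (-1) ^ length ?bs * (LINT x|lborel. iter_partial (rev ?bs) (h m) x * \<phi> x)"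
        using integration_by_parts[OF _ s K(1,3) set, of "h m"] h[of m] by (simp add: test_function_def)
      also have "(LINT x|lborel. iter_partial (rev ?bs) (h m) x * \<phi> x) = (LINT x|lebesgue. iter_partial (rev ?bs) (h m) x * \<phi> x)"
        using bm[of "rev ?bs"] \<phi>m set by (intro integral_completion[symmetric] borel_measurable_times) auto
      finally show ?thesis .
    qed
    have S: "(\<lambda>m. LINT x|lebesgue. iter_partial bs (h m) x * \<psi> x) sums (LINT x|lebesgue. D bs x * \<psi> x)"
      if "set bs \<subseteq> Basis" "length bs \<le> l" "continuous_on UNIV \<psi>" "\<And>x. x \<notin> K \<Longrightarrow> \<psi> x = 0" for bs \<psi>
      unfolding D_def
      by (rule sums_integral_mult_compact_support[OF p \<kappa> T(3)[OF that(1)] T(1)[OF that(1)] b[OF that(1,2)] that(3) K(1) that(4)])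
    have "(\<lambda>m. LINT x|lebesgue. iter_partial [] (h m) x * iter_partial ?bs \<phi> x) sums (LINT x|lebesgue. D [] x * iter_partial ?bs \<phi> x)"
      by (rule S) (use c 0 in simp_all)
    moreover have "(\<lambda>m. (-1) ^ length ?bs * (LINT x|lebesgue. iter_partial (rev ?bs) (h m) x * \<phi> x))
        sums ((-1) ^ length ?bs * (LINT x|lebesgue. D (rev ?bs) x * \<phi> x))"
      by (rule sums_mult[OF S]) (use c K(3) set len in simp_all)
    ultimately have "(LINT x|lebesgue. D [] x * iter_partial ?bs \<phi> x) = (-1) ^ length ?bs * (LINT x|lebesgue. D (rev ?bs) x * \<phi> x)"
      unfolding 1 by (rule sums_unique2)
    moreover have "(LINT x|lebesgue_on \<Omega>. D [] x * iter_partial ?bs \<phi> x) = (LINT x|lebesgue. D [] x * iter_partial ?bs \<phi> x)"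
      using 0 K(2) by (intro lebesgue_on_integral_eq(1)[OF \<Omega>]) auto
    moreover have "(LINT x|lebesgue_on \<Omega>. D (rev ?bs) x * \<phi> x) = (LINT x|lebesgue. D (rev ?bs) x * \<phi> x)"
      using K(2,3) by (intro lebesgue_on_integral_eq(1)[OF \<Omega>]) auto
    ultimately show "(LINT x|lebesgue_on \<Omega>. D [] x * D_alpha \<alpha> \<phi> x) =
      (-1) ^ (\<Sum>b\<in>Basis. \<alpha> b) * (LINT x|lebesgue_on \<Omega>. D (rev ?bs) x * \<phi> x)"
      by (simp add: D_alpha_eq length_index_list)
  qed
  have "D [] \<in> sobolev_space l (ereal p) \<Omega>"
    unfolding sobolev_space_def
  proof (intro CollectI conjI ballI)
    show "D [] \<in> Lp_space (ereal p) \<Omega>" by (rule DL) auto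
    fix \<alpha> :: "'a \<Rightarrow> nat" assume \<alpha>: "\<alpha> \<in> multi_indices l"
    then have "D (rev (index_list \<alpha>)) \<in> Lp_space (ereal p) \<Omega>"
      using set_index_list by (intro DL) (auto simp: length_index_list multi_indices_def)
    then show "\<exists>g\<in>Lp_space (ereal p) \<Omega>. has_weak_derivative \<Omega> \<alpha> (D []) g"
      using weak[OF \<alpha>] by blast
  qed
  then show ?thesis by (simp add: D_def)
qed

section \<open>Peaks\<close>

text \<open>Parametrised by the dilation factor: \<open>1 / c\<close> is half the side length, so
  that the bump of scale \<open>c\<close> lives on \<open>cube a c\<close> and equals 1 on
  \<open>cube a (2 * c)\<close>.\<close>

definition cube :: "'a \<Rightarrow> real \<Rightarrow> 'a::euclidean_space set" where
  "cube a c = cbox (a - (1 / c) *\<^sub>R One) (a + (1 / c) *\<^sub>R One)"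

definition bump :: "'a \<Rightarrow> real \<Rightarrow> 'a::euclidean_space \<Rightarrow> real" where
  "bump a c x = box_cutoff 2 (- One) One (c *\<^sub>R (x - a))"

lemma mem_cube: "c > 0 \<Longrightarrow> x \<in> cube a c \<longleftrightarrow> (\<forall>i\<in>Basis. c * \<bar>(x - a) \<bullet> i\<bar> \<le> 1)"
proof -
  assume "c > 0"
  then have "c * \<bar>y\<bar> \<le> 1 \<longleftrightarrow> - (1 / c) \<le> y \<and> y \<le> 1 / c" for y
    by (simp add: mult.commute[of c] pos_le_divide_eq[symmetric] abs_le_iff minus_le_iff) (simp only: conj_commute)
  then show ?thesis
    by (auto simp: cube_def mem_box inner_diff_left inner_add_left diff_le_eq le_diff_eq add.commute)
qed

lemma mult_abs_le_iff: "0 \<le> c \<Longrightarrow> c * \<bar>y\<bar> \<le> r \<longleftrightarrow> - r \<le> c * y \<and> c * y \<le> (r::real)"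
  using abs_le_iff[of "c * y" r] by (auto simp: abs_mult)

lemma measure_cube: "c > 0 \<Longrightarrow> measure lebesgue (cube (a::'a::euclidean_space) c) = (2 / c) ^ DIM('a)"
proof -
  assume c: "c > 0"
  have "measure lborel (cube a c) = (\<Prod>i\<in>(Basis::'a set). (a + (1 / c) *\<^sub>R One) \<bullet> i - (a - (1 / c) *\<^sub>R One) \<bullet> i)"
    unfolding cube_def by (rule content_cbox) (use c in \<open>auto simp: inner_diff_left inner_add_left\<close>)
  also have "\<dots> = (2 / c) ^ DIM('a)"
    by (simp add: inner_diff_left inner_add_left)
  finally show ?thesis by (simp add: cube_def)
qed

lemma cube_subset_open:
  assumes "open U" "(a::'a::euclidean_space) \<in> U"
  shows "\<forall>\<^sub>F c in at_top. cube a c \<subseteq> U"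
proof -
  obtain r where r: "r > 0" "ball a r \<subseteq> U" using assms openE by blast
  show ?thesis
    using eventually_gt_at_top[of "real DIM('a) / r"] eventually_gt_at_top[of 0]
  proof eventually_elim
    case (elim c)
    have "x \<in> ball a r" if "x \<in> cube a c" for x
    proof -
      have "norm (x - a) \<le> (\<Sum>i\<in>Basis. \<bar>(x - a) \<bullet> i\<bar>)" by (rule norm_le_l1)
      also have "\<dots> \<le> (\<Sum>i\<in>(Basis::'a set). 1 / c)"
        using that elim by (intro sum_mono) (auto simp: mem_cube field_simps)
      also have "\<dots> < r" using elim r by (simp add: field_simps)
      finally show ?thesis by (simp add: dist_norm norm_minus_commute)
    qed
    then show ?case using r by blast
  qed
qed

lemma smooth_bump: "smooth (bump a c)"
  unfolding bump_def[abs_def] by (rule smooth_scale[OF smooth_box_cutoff])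

lemma bump_bounds: "0 \<le> bump a c x" "bump a c x \<le> 1"
  by (simp_all add: bump_def box_cutoff_bounds)

lemma bump_eq_0: "c > 0 \<Longrightarrow> x \<notin> cube a c \<Longrightarrow> bump a c x = 0"
  unfolding bump_def
  by (rule box_cutoff_eq_0) (auto simp: mem_cube mem_box mult_abs_le_iff intro: less_imp_le)

lemma bump_eq_1:
  assumes "c > 0" "x \<in> cube a (2 * c)"
  shows "bump a c x = 1"
  unfolding bump_def
proof (rule box_cutoff_eq_1)
  fix i :: 'a assume i: "i \<in> Basis"
  then have "2 * c * \<bar>(x - a) \<bullet> i\<bar> \<le> 1" using assms by (simp add: mem_cube)
  then have "- 1 \<le> 2 * c * ((x - a) \<bullet> i) \<and> 2 * c * ((x - a) \<bullet> i) \<le> 1"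
    using assms(1) by (subst (asm) mult_abs_le_iff) auto
  then show "1 \<le> 2 * ((c *\<^sub>R (x - a)) \<bullet> i - (- One) \<bullet> i) \<and> 1 \<le> 2 * (One \<bullet> i - (c *\<^sub>R (x - a)) \<bullet> i)"
    using i by simp
qed

lemma iter_partial_bump_eq_0:
  assumes "c > 0" "x \<notin> cube a c" shows "iter_partial bs (bump a c) x = 0"
  by (rule iter_partial_eq_0_outside[of "cube a c"]) (use assms bump_eq_0 in \<open>auto simp: cube_def\<close>)

text \<open>The cube of scale \<open>4 * c\<close> lies in the interior of the plateau, where the
  bump is locally constant. This is the origin of the ratio 4 between consecutive scales in the
  critical case.\<close>

lemma iter_partial_bump_eq_0_inner:
  assumes c: "c > 0" and x: "x \<in> cube a (4 * c)" and bs: "bs \<noteq> []"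
  shows "iter_partial bs (bump a c) x = 0"
proof (rule iter_partial_local_zero[of "box (a - (1 / (2 * c)) *\<^sub>R One) (a + (1 / (2 * c)) *\<^sub>R One)" _ 1])
  show "x \<in> box (a - (1 / (2 * c)) *\<^sub>R One) (a + (1 / (2 * c)) *\<^sub>R One)"
    unfolding mem_box
  proof
    fix i :: 'a assume i: "i \<in> Basis"
    have "4 * (c * \<bar>(x - a) \<bullet> i\<bar>) \<le> 1" using x i c by (auto simp: mem_cube mult.assoc)
    then have "2 * (c * \<bar>(x - a) \<bullet> i\<bar>) < 1" by linarith
    then have "\<bar>(x - a) \<bullet> i\<bar> < 1 / (2 * c)" using c by (simp add: field_simps)
    then show "(a - (1 / (2 * c)) *\<^sub>R One) \<bullet> i < x \<bullet> i \<and> x \<bullet> i < (a + (1 / (2 * c)) *\<^sub>R One) \<bullet> i"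
      using i by (auto simp: inner_diff_left inner_add_left abs_less_iff)
  qed
  show "bump a c y = 1" if "y \<in> box (a - (1 / (2 * c)) *\<^sub>R One) (a + (1 / (2 * c)) *\<^sub>R One)" for y
    using that box_subset_cbox[of "a - (1 / (2 * c)) *\<^sub>R One" "a + (1 / (2 * c)) *\<^sub>R One"] c
    by (intro bump_eq_1) (auto simp: cube_def)
qed (use bs in auto)

lemma finite_index_lists: "finite {bs :: 'a::euclidean_space list. set bs \<subseteq> Basis \<and> length bs \<le> l}"
  by (rule finite_lists_length_le) simp

lemma integral_powr_le_on_cube:
  fixes f :: "'a::euclidean_space \<Rightarrow> real"
  assumes "f \<in> borel_measurable borel" "c > 0" "0 \<le> p" "\<And>x. x \<notin> cube a c \<Longrightarrow> f x = 0" "\<And>x. \<bar>f x\<bar> \<le> C"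
  shows "(LINT x|lborel. \<bar>f x\<bar> powr p) \<le> C powr p * (2 / c) ^ DIM('a)"
    and "integrable lborel (\<lambda>x. \<bar>f x\<bar> powr p)"
proof -
  have fin: "emeasure lborel (cube a c) < \<infinity>" by (simp add: cube_def emeasure_lborel_cbox_eq)
  have i: "integrable lborel (\<lambda>x. C powr p * indicator (cube a c) x)"
    using fin by (intro integrable_mult_right integrable_real_indicator) (auto simp: cube_def)
  have le: "\<bar>f x\<bar> powr p \<le> C powr p * indicator (cube a c) x" for x
    using assms(4)[of x] assms(3,5) by (cases "x \<in> cube a c") (auto intro: powr_mono2)
  show i2: "integrable lborel (\<lambda>x. \<bar>f x\<bar> powr p)"
    by (rule Bochner_Integration.integrable_bound[OF i]) (use assms(1) le in auto)
  have "(LINT x|lborel. \<bar>f x\<bar> powr p) \<le> (LINT x|lborel. C powr p * indicator (cube a c) x)"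
    using i i2 le by (intro integral_mono)
  also have "\<dots> = C powr p * measure lborel (cube a c)" by simp
  also have "measure lborel (cube a c) = (2 / c) ^ DIM('a)"
    using measure_cube[OF assms(2), of a] by (simp add: cube_def)
  finally show "(LINT x|lborel. \<bar>f x\<bar> powr p) \<le> C powr p * (2 / c) ^ DIM('a)" .
qed

text \<open>At most \<open>l\<close> derivatives contribute at most c^l, as c \<ge> 1, and the
  support has measure (2/c)^N. The constant is uniform in \<open>a\<close>, \<open>c\<close> and
  \<open>bs\<close> because all bumps are rescaled from one function, which has finitely many
  derivatives of order up to \<open>l\<close>.\<close>

lemma integral_iter_partial_bump_le:
  fixes p :: real
  assumes p: "0 \<le> p"
  shows "\<exists>C\<ge>0. \<forall>(a::'a::euclidean_space) c bs. 1 \<le> c \<longrightarrow> set bs \<subseteq> Basis \<longrightarrow> length bs \<le> l \<longrightarrow>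
    (LINT x|lborel. \<bar>iter_partial bs (bump a c) x\<bar> powr p) \<le> C * c powr (real l * p - real DIM('a))"
proof -
  let ?\<phi> = "box_cutoff 2 (- One) One :: 'a \<Rightarrow> real"
  let ?L = "{bs :: 'a list. set bs \<subseteq> Basis \<and> length bs \<le> l}"
  have "\<forall>bs\<in>?L. \<exists>C. \<forall>x. \<bar>iter_partial bs ?\<phi> x\<bar> \<le> C"
  proof
    fix bs assume that: "bs \<in> ?L"
    have c: "continuous_on UNIV (iter_partial bs ?\<phi>)"
      using that by (intro continuous_iter_partial smooth_box_cutoff) auto
    have "?\<phi> x = 0" if "x \<notin> cbox (- One) One" for x
      using that box_subset_cbox by (intro box_cutoff_eq_0) auto
    then have z: "iter_partial bs ?\<phi> x = 0" if "x \<notin> cbox (- One) One" for x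
      using that by (intro iter_partial_eq_0_outside[of "cbox (- One) One"]) auto
    obtain C where "\<And>x. \<bar>iter_partial bs ?\<phi> x\<bar> \<le> C"
      using bounded_compact_support[OF c compact_cbox[of "- One" One] z] by metis
    then show "\<exists>C. \<forall>x. \<bar>iter_partial bs ?\<phi> x\<bar> \<le> C" by blast
  qed
  from bchoice[OF this] obtain C where C: "\<forall>bs\<in>?L. \<forall>x. \<bar>iter_partial bs ?\<phi> x\<bar> \<le> C bs" by blast
  define C0 where "C0 = Max (C ` ?L)"
  have C0: "\<bar>iter_partial bs ?\<phi> x\<bar> \<le> C0" if "bs \<in> ?L" for bs x
  proof -
    have "\<bar>iter_partial bs ?\<phi> x\<bar> \<le> C bs" using C that by blast
    also have "\<dots> \<le> C0" unfolding C0_def using that by (intro Max_ge finite_imageI finite_index_lists imageI)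
    finally show ?thesis .
  qed
  have C00: "0 \<le> C0" using C0[of "[]" 0] by (auto intro: order_trans[OF abs_ge_zero])
  show ?thesis
  proof (intro exI[of _ "C0 powr p * 2 ^ DIM('a)"] conjI allI impI)
    fix a :: 'a and c :: real and bs :: "'a list"
    assume c: "1 \<le> c" and bs: "set bs \<subseteq> Basis" "length bs \<le> l"
    have m: "iter_partial bs (bump a c) \<in> borel_measurable borel"
      by (rule iter_partial_measurable[OF smooth_bump bs(1)])
    have "\<bar>iter_partial bs (bump a c) x\<bar> \<le> c ^ l * C0" for x
    proof -
      have "iter_partial bs (bump a c) x = c ^ length bs * iter_partial bs ?\<phi> (c *\<^sub>R (x - a))"
        unfolding bump_def[abs_def] using iter_partial_scale[OF smooth_box_cutoff bs(1)] by metis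
      also have "\<bar>\<dots>\<bar> = c ^ length bs * \<bar>iter_partial bs ?\<phi> (c *\<^sub>R (x - a))\<bar>"
        using c by (simp add: abs_mult)
      also have "\<dots> \<le> c ^ l * C0"
        using c bs C0 by (intro mult_mono power_increasing) auto
      finally show ?thesis .
    qed
    then have "(LINT x|lborel. \<bar>iter_partial bs (bump a c) x\<bar> powr p) \<le> (c ^ l * C0) powr p * (2 / c) ^ DIM('a)"
      using c p by (intro integral_powr_le_on_cube(1)[OF m _ _ iter_partial_bump_eq_0]) auto
    also have "(c ^ l * C0) powr p * (2 / c) ^ DIM('a) = C0 powr p * 2 ^ DIM('a) * c powr (real l * p - real DIM('a))"
    proof -
      have "(c ^ l * C0) powr p = c powr (real l * p) * C0 powr p"
        using c C00 by (simp add: powr_mult powr_powr powr_realpow[symmetric])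
      moreover have "(2 / c) ^ DIM('a) = 2 ^ DIM('a) * c powr (- real DIM('a))"
      proof -
        have "c powr (- real DIM('a)) = inverse (c ^ DIM('a))" using c by (simp add: powr_minus powr_realpow)
        then show ?thesis unfolding power_divide by (simp only: divide_inverse)
      qed
      ultimately show ?thesis by (simp add: powr_diff powr_minus divide_inverse)
    qed
    finally show "(LINT x|lborel. \<bar>iter_partial bs (bump a c) x\<bar> powr p)
      \<le> C0 powr p * 2 ^ DIM('a) * c powr (real l * p - real DIM('a))" .
  qed simp
qed

text \<open>A peak of height \<open>t\<close> on \<open>B\<close> that is large in \<open>L^(1/s)\<close> (in \<open>L^\<infinity>\<close> for \<open>s = 0\<close>) but small in
  \<open>W^(l,p)\<close>.\<close>

definition peak ::
  "nat \<Rightarrow> real \<Rightarrow> real \<Rightarrow> 'a::euclidean_space set \<Rightarrow> real \<Rightarrow> real \<Rightarrow> ('a \<Rightarrow> real) \<Rightarrow> 'a set \<Rightarrow> 'a set \<Rightarrow> real \<Rightarrow> bool" where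
  "peak l p s U \<epsilon> M h K B t \<longleftrightarrow> smooth h \<and> (\<forall>x. 0 \<le> h x) \<and>
    compact K \<and> K \<subseteq> U \<and> (\<forall>x. x \<notin> K \<longrightarrow> h x = 0) \<and> measure lebesgue K \<le> \<epsilon> \<and>
    compact B \<and> B \<subseteq> U \<and> 0 < measure lebesgue B \<and> measure lebesgue B \<le> 1 \<and>
    (\<forall>x\<in>B. t \<le> h x) \<and> 0 \<le> t \<and> M \<le> t * measure lebesgue B powr s \<and>
    (\<forall>bs. set bs \<subseteq> Basis \<longrightarrow> length bs \<le> l \<longrightarrow> (LINT x|lborel. \<bar>iter_partial bs h x\<bar> powr p) \<le> \<epsilon>)"

lemma cube_mono: "0 < c \<Longrightarrow> c \<le> d \<Longrightarrow> cube a d \<subseteq> cube a c"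
proof
  fix x assume *: "0 < c" "c \<le> d" "x \<in> cube a d"
  have "c * \<bar>(x - a) \<bullet> i\<bar> \<le> 1" if "i \<in> Basis" for i
  proof -
    have "c * \<bar>(x - a) \<bullet> i\<bar> \<le> d * \<bar>(x - a) \<bullet> i\<bar>" using * by (intro mult_right_mono) auto
    also have "\<dots> \<le> 1" using * that by (auto simp: mem_cube)
    finally show ?thesis .
  qed
  then show "x \<in> cube a c" using * by (simp add: mem_cube)
qed

lemma compact_cube: "compact (cube a c)" by (simp add: cube_def)

lemma tendsto_measure_cube: "((\<lambda>c. (2 / c) ^ DIM('a::euclidean_space)) \<longlongrightarrow> 0) (at_top :: real filter)"
proof -
  have "((\<lambda>c::real. 2 / c) \<longlongrightarrow> 0) at_top" by (rule tendsto_divide_0[OF tendsto_const filterlim_at_top_imp_at_infinity[OF filterlim_ident]])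
  from tendsto_power[OF this, of "DIM('a)"] show ?thesis by (simp add: power_0_left)
qed

section \<open>Existence of peaks\<close>

text \<open>A single bump suffices. Its plateau has measure c^(-N), so the height M' c^(N s) makes
  the product in \<open>peak\<close> equal to M' for every \<open>c\<close>. The derivatives then
  cost at most M'^p C c^(N s p + l p - N), and \<open>sub\<close> says that this exponent is
  negative.\<close>

lemma ex_peak_subcritical:
  fixes U :: "'a::euclidean_space set"
  assumes p: "1 \<le> p" and s: "0 \<le> s" and sub: "real DIM('a) * s * p + real l * p < real DIM('a)"
    and U: "open U" "U \<noteq> {}" and \<epsilon>: "0 < \<epsilon>"
  shows "\<exists>h K B t. peak l p s U \<epsilon> M h K B t"
proof -
  obtain a where a: "a \<in> U" using U by auto
  have p0: "0 \<le> p" using p by simp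
  define N where "N = real DIM('a)"
  \<comment> \<open>The required size may be negative, a height may not.\<close>
  define M' where "M' = max M 0"
  obtain C where C: "0 \<le> C" "\<And>(a::'a) c bs. 1 \<le> c \<Longrightarrow> set bs \<subseteq> Basis \<Longrightarrow> length bs \<le> l \<Longrightarrow>
    (LINT x|lborel. \<bar>iter_partial bs (bump a c) x\<bar> powr p) \<le> C * c powr (real l * p - real DIM('a))"
    using integral_iter_partial_bump_le[OF p0, where l=l and ?'a='a] by blast
  have neg: "N * s * p + (real l * p - N) < 0" using sub by (simp add: N_def)
  have "((\<lambda>c. M' powr p * C * c powr (N * s * p + (real l * p - N))) \<longlongrightarrow> M' powr p * C * 0) at_top"
    by (intro tendsto_mult tendsto_const tendsto_neg_powr[OF neg filterlim_ident])
  then have e1: "\<forall>\<^sub>F c in at_top. M' powr p * C * c powr (N * s * p + (real l * p - N)) < \<epsilon>"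
    using \<epsilon> by (auto dest: order_tendstoD(2)[of _ _ _ \<epsilon>])
  have e2: "\<forall>\<^sub>F c in at_top. (2 / c) ^ DIM('a) < \<epsilon>"
    using order_tendstoD(2)[OF tendsto_measure_cube, of \<epsilon>] \<epsilon> by blast
  have "\<forall>\<^sub>F c in at_top. M' powr p * C * c powr (N * s * p + (real l * p - N)) < \<epsilon> \<and> (2 / c) ^ DIM('a) < \<epsilon>
      \<and> 1 \<le> c \<and> cube a c \<subseteq> U"
    using e1 e2 eventually_ge_at_top[of 1] cube_subset_open[OF U(1) a] by eventually_elim auto
  then obtain c where c: "M' powr p * C * c powr (N * s * p + (real l * p - N)) < \<epsilon>" "(2 / c) ^ DIM('a) < \<epsilon>"
    "1 \<le> c" "cube a c \<subseteq> U" by (auto simp: eventually_at_top_linorder)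
  define t where "t = M' * c powr (N * s)"
  have t: "0 \<le> t" by (simp add: t_def M'_def)
  have mB: "measure lebesgue (cube a (2 * c)) = c powr (- N)"
    using c measure_cube[of "2 * c" a] by (simp add: N_def powr_minus powr_realpow power_divide divide_inverse[symmetric] inverse_eq_divide)
  have "peak l p s U \<epsilon> M (\<lambda>x. t * bump a c x) (cube a c) (cube a (2 * c)) t"
    unfolding peak_def
  proof (intro conjI allI impI ballI)
    show "smooth (\<lambda>x. t * bump a c x)" by (intro smooth_cmult smooth_bump)
    show "measure lebesgue (cube a c) \<le> \<epsilon>" using c by (simp add: measure_cube)
    show "cube a (2 * c) \<subseteq> U" using c cube_mono[of c "2 * c" a] by auto
    show "0 < measure lebesgue (cube a (2 * c))" "measure lebesgue (cube a (2 * c)) \<le> 1"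
      using c powr_mono[of "-N" 0 c] by (auto simp: mB N_def)
    show "M \<le> t * measure lebesgue (cube a (2 * c)) powr s"
      using c by (simp add: mB t_def powr_powr powr_add[symmetric] mult.assoc M'_def)
    fix bs :: "'a list" assume bs: "set bs \<subseteq> Basis" "length bs \<le> l"
    have "(LINT x|lborel. \<bar>iter_partial bs (\<lambda>x. t * bump a c x) x\<bar> powr p)
      = t powr p * (LINT x|lborel. \<bar>iter_partial bs (bump a c) x\<bar> powr p)"
      using t by (simp add: iter_partial_cmult[OF smooth_bump bs(1)] abs_mult powr_mult)
    also have "\<dots> \<le> t powr p * (C * c powr (real l * p - real DIM('a)))"
      using C(2)[OF c(3) bs] by (intro mult_left_mono) auto
    also have "\<dots> = M' powr p * C * c powr (N * s * p + (real l * p - N))"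
      by (simp add: t_def powr_mult powr_powr N_def powr_add M'_def)
    finally show "(LINT x|lborel. \<bar>iter_partial bs (\<lambda>x. t * bump a c x) x\<bar> powr p) \<le> \<epsilon>" using c(1) by simp
  qed (use t c bump_bounds[of a c] bump_eq_0[of c _ a] bump_eq_1[of c _ a] in \<open>auto simp: compact_cube\<close>)
  then show ?thesis by blast
qed

text \<open>Away from order zero the derivatives of the summands have disjoint supports, so that their
  \<open>p\<close>-th powers add up to \<open>m * (1/m) ^ p\<close>, which tends to zero as \<open>p > 1\<close>.\<close>

lemma ex_peak_critical:
  fixes U :: "'a::euclidean_space set"
  assumes p: "1 < p" and crit: "real l * p = real DIM('a)"
    and U: "open U" "U \<noteq> {}" and \<epsilon>: "0 < \<epsilon>"
  shows "\<exists>h K B t. peak l p 0 U \<epsilon> M h K B t"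
proof -
  obtain a where a: "a \<in> U" using U by auto
  have p0: "0 \<le> p" using p by simp
  define M' where "M' = max M 0"
  have M': "0 \<le> M'" by (simp add: M'_def)
  obtain C where C: "0 \<le> C" "\<And>(a::'a) c bs. 1 \<le> c \<Longrightarrow> set bs \<subseteq> Basis \<Longrightarrow> length bs \<le> l \<Longrightarrow>
    (LINT x|lborel. \<bar>iter_partial bs (bump a c) x\<bar> powr p) \<le> C * c powr (real l * p - real DIM('a))"
    using integral_iter_partial_bump_le[OF p0, where l=l and ?'a='a] by blast
  have f4: "filterlim (\<lambda>m. (4::real) ^ m) at_top sequentially"
  proof (rule filterlim_at_top_mono[OF filterlim_real_sequentially], rule always_eventually, rule allI)
    fix m :: nat
    have "real m \<le> 2 ^ m" using of_nat_less_two_power[of m] by (rule less_imp_le)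
    also have "\<dots> \<le> (4::real) ^ m" by (rule power_mono) auto
    finally show "real m \<le> 4 ^ m" .
  qed
  have "((\<lambda>m. M' powr p * C * real m powr (1 - p)) \<longlonglongrightarrow> M' powr p * C * 0)"
    using p by (intro tendsto_mult tendsto_const tendsto_neg_powr[OF _ filterlim_real_sequentially]) auto
  then have e1: "\<forall>\<^sub>F m in sequentially. M' powr p * C * real m powr (1 - p) < \<epsilon>"
    using \<epsilon> by (auto dest: order_tendstoD(2)[of _ _ _ \<epsilon>])
  have l4: "((\<lambda>m. (2 / 4 ^ m) ^ DIM('a)) \<longlonglongrightarrow> (0::real))"
    using filterlim_compose[OF tendsto_measure_cube[where ?'a='a] f4] .
  have e2: "\<forall>\<^sub>F m in sequentially. (2 / 4 ^ m) ^ DIM('a) < \<epsilon>"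
    using order_tendstoD(2)[OF l4, of \<epsilon>] \<epsilon> by blast
  have "((\<lambda>m. M' powr p * (2 / 4 ^ m) ^ DIM('a)) \<longlonglongrightarrow> M' powr p * 0)"
    by (intro tendsto_mult tendsto_const l4)
  then have e3: "\<forall>\<^sub>F m in sequentially. M' powr p * (2 / 4 ^ m) ^ DIM('a) < \<epsilon>"
    using \<epsilon> by (auto dest: order_tendstoD(2)[of _ _ _ \<epsilon>])
  have e4: "\<forall>\<^sub>F m in sequentially. cube a (4 ^ m) \<subseteq> U"
    using cube_subset_open[OF U(1) a] f4 by (rule eventually_compose_filterlim)
  have "\<forall>\<^sub>F m in sequentially. M' powr p * C * real m powr (1 - p) < \<epsilon> \<and> (2 / 4 ^ m) ^ DIM('a) < \<epsilon>
      \<and> M' powr p * (2 / 4 ^ m) ^ DIM('a) < \<epsilon> \<and> cube a (4 ^ m) \<subseteq> U \<and> 1 \<le> m"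
    using e1 e2 e3 e4 eventually_ge_at_top[of 1] by eventually_elim auto
  then obtain m where m: "M' powr p * C * real m powr (1 - p) < \<epsilon>" "(2 / 4 ^ m) ^ DIM('a) < \<epsilon>"
    "M' powr p * (2 / 4 ^ m) ^ DIM('a) < \<epsilon>" "cube a (4 ^ m) \<subseteq> U" "1 \<le> m"
    by (auto simp: eventually_sequentially)
  \<comment> \<open>Starting at the scale 4^m makes the support shrink as m grows; having m scales
    gives each bump the weight M'/m.\<close>
  define I where "I = {m..<2 * m}"
  have I: "finite I" "card I = m" by (auto simp: I_def)
  define h where "h = (\<lambda>x. M' / real m * (\<Sum>i\<in>I. bump a (4 ^ i) x))"
  have sm: "smooth (\<lambda>x. \<Sum>i\<in>I. bump a (4 ^ i) x)" by (intro smooth_sum smooth_bump)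
  have h0: "0 \<le> h x" for x
    using M' by (auto simp: h_def intro!: mult_nonneg_nonneg divide_nonneg_nonneg sum_nonneg bump_bounds)
  have hM: "h x \<le> M'" for x
  proof -
    have "(\<Sum>i\<in>I. bump a (4 ^ i) x) \<le> (\<Sum>i\<in>I. 1)" by (intro sum_mono bump_bounds)
    then have "(\<Sum>i\<in>I. bump a (4 ^ i) x) \<le> real m" using I by simp
    then have "M' / real m * (\<Sum>i\<in>I. bump a (4 ^ i) x) \<le> M' / real m * real m"
      using M' by (intro mult_left_mono) auto
    then show ?thesis using m(5) by (simp add: h_def)
  qed
  have K: "h x = 0" if "x \<notin> cube a (4 ^ m)" for x
  proof -
    have "x \<notin> cube a (4 ^ i)" if "i \<in> I" for i
      using \<open>x \<notin> cube a (4 ^ m)\<close> that cube_mono[of "4 ^ m" "4 ^ i" a] by (auto simp: I_def)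
    then show ?thesis by (simp add: h_def bump_eq_0)
  qed
  \<comment> \<open>This lies in the plateau of the finest bump, whose scale is 4^(2m-1), so all m
    summands equal 1 there.\<close>
  let ?B = "cube a (2 * 4 ^ (2 * m))"
  have B: "h x = M'" if "x \<in> ?B" for x
  proof -
    have "x \<in> cube a (2 * 4 ^ i)" if "i \<in> I" for i
      using \<open>x \<in> ?B\<close> that cube_mono[of "2 * 4 ^ i" "2 * 4 ^ (2 * m)" a] by (auto simp: I_def)
    then have "(\<Sum>i\<in>I. bump a (4 ^ i) x) = (\<Sum>i\<in>I. 1)" by (intro sum.cong bump_eq_1) auto
    then show ?thesis using I m(5) by (simp add: h_def)
  qed
  \<comment> \<open>The finer bump is supported where the coarser one is already locally
    constant.\<close>
  have disj: "iter_partial bs (bump a (4 ^ i)) x = 0 \<or> iter_partial bs (bump a (4 ^ j)) x = 0"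
    if "bs \<noteq> []" "i < j" for bs i j x
  proof (cases "x \<in> cube a (4 ^ j)")
    case True
    have "(4::real) ^ Suc i \<le> 4 ^ j" using that by (intro power_increasing) auto
    then have "x \<in> cube a (4 * 4 ^ i)" using True cube_mono[of "4 ^ Suc i" "4 ^ j" a] by auto
    then show ?thesis using iter_partial_bump_eq_0_inner[of "4 ^ i" x a bs] that by auto
  qed (simp add: iter_partial_bump_eq_0)
  have "peak l p 0 U \<epsilon> M h (cube a (4 ^ m)) ?B M'"
    unfolding peak_def
  proof (intro conjI allI impI ballI)
    show "smooth h" unfolding h_def by (rule smooth_cmult[OF sm])
    show "measure lebesgue (cube a (4 ^ m)) \<le> \<epsilon>" using m by (simp add: measure_cube)
    have "(4::real) ^ m \<le> 2 * 4 ^ (2 * m)"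
      using power_increasing[of m "2 * m" "4::real"] zero_le_power[of "4::real" "2 * m"] by linarith
    then show "?B \<subseteq> U" using m(4) cube_mono[of "4 ^ m" "2 * 4 ^ (2 * m)" a] by auto
    show "0 < measure lebesgue ?B" by (simp add: measure_cube)
    show "measure lebesgue ?B \<le> 1" by (simp add: measure_cube power_le_one)
    then show "M \<le> M' * measure lebesgue ?B powr 0" by (simp add: measure_cube M'_def)
    fix bs :: "'a list" assume bs: "set bs \<subseteq> Basis" "length bs \<le> l"
    show "(LINT x|lborel. \<bar>iter_partial bs h x\<bar> powr p) \<le> \<epsilon>"
    \<comment> \<open>At order zero the summands overlap, but there the bound h \<le> M' on a small
      cube suffices.\<close>
    proof (cases "bs = []")
      case True
      have "h \<in> borel_measurable borel" using iter_partial_measurable[OF \<open>smooth h\<close>, of "[]"] by simp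
      then have "(LINT x|lborel. \<bar>h x\<bar> powr p) \<le> M' powr p * (2 / 4 ^ m) ^ DIM('a)"
        using h0 hM K p0 by (intro integral_powr_le_on_cube(1)) auto
      then show ?thesis using True m(3) by simp
    next
      case False
      let ?g = "\<lambda>i x. \<bar>iter_partial bs (bump a (4 ^ i)) x\<bar> powr p"
      have gi: "integrable lborel (?g i)" for i
      proof -
        have "test_function UNIV (bump a (4 ^ i))"
        proof -
          have "closure {x. bump a (4 ^ i) x \<noteq> 0} \<subseteq> cube a (4 ^ i)"
            using bump_eq_0[of "4 ^ i" _ a] by (intro closure_minimal) (auto simp: cube_def)
          then show ?thesis
            using compact_cube[of a "4 ^ i"] smooth_bump
            by (auto simp: test_function_def compact_eq_bounded_closed intro: bounded_subset)
        qed
        from test_function_iter_partial(1)[OF this bs(1), of p] p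
        have "integrable lebesgue (?g i)" by simp
        moreover have "?g i \<in> borel_measurable lborel"
          using iter_partial_measurable[OF smooth_bump bs(1), of a "4 ^ i"] by simp
        ultimately show ?thesis using integrable_completion by blast
      qed
      have pt: "\<bar>iter_partial bs h x\<bar> powr p \<le> (M' / real m) powr p * (\<Sum>i\<in>I. ?g i x)" for x
      proof -
        have eq: "iter_partial bs h x = M' / real m * (\<Sum>i\<in>I. iter_partial bs (bump a (4 ^ i)) x)"
          unfolding h_def iter_partial_cmult[OF sm bs(1)]
          using iter_partial_sum[where I=I and f="\<lambda>i. bump a (4 ^ i)", OF smooth_bump bs(1)] by simp
        have "\<bar>\<Sum>i\<in>I. iter_partial bs (bump a (4 ^ i)) x\<bar> powr p \<le> (\<Sum>i\<in>I. ?g i x)"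
        proof (cases "\<exists>j\<in>I. iter_partial bs (bump a (4 ^ j)) x \<noteq> 0")
          case True
          then obtain j where j: "j \<in> I" "iter_partial bs (bump a (4 ^ j)) x \<noteq> 0" by blast
          have "iter_partial bs (bump a (4 ^ i)) x = 0" if "i \<noteq> j" for i
            using disj[OF False, of i j x] disj[OF False, of j i x] that j by (cases "i < j") auto
          then have "(\<Sum>i\<in>I. iter_partial bs (bump a (4 ^ i)) x) = (\<Sum>i\<in>{j}. iter_partial bs (bump a (4 ^ i)) x)"
            using j I by (intro sum.mono_neutral_right) auto
          then show ?thesis using j I by (auto intro: member_le_sum)
        qed (auto intro: sum_nonneg)
        then have "(M' / real m) powr p * \<bar>\<Sum>i\<in>I. iter_partial bs (bump a (4 ^ i)) x\<bar> powr p
            \<le> (M' / real m) powr p * (\<Sum>i\<in>I. ?g i x)" by (rule mult_left_mono) simp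
        also have "(M' / real m) powr p * \<bar>\<Sum>i\<in>I. iter_partial bs (bump a (4 ^ i)) x\<bar> powr p
            = \<bar>iter_partial bs h x\<bar> powr p"
          unfolding eq abs_mult using M' by (subst powr_mult[symmetric]) auto
        finally show ?thesis .
      qed
      have "(LINT x|lborel. \<bar>iter_partial bs h x\<bar> powr p) \<le> (LINT x|lborel. (M' / real m) powr p * (\<Sum>i\<in>I. ?g i x))"
      proof (rule integral_mono[OF _ _ pt])
        show i: "integrable lborel (\<lambda>x. (M' / real m) powr p * (\<Sum>i\<in>I. ?g i x))"
          by (intro integrable_mult_right Bochner_Integration.integrable_sum gi)
        show "integrable lborel (\<lambda>x. \<bar>iter_partial bs h x\<bar> powr p)"
          by (rule Bochner_Integration.integrable_bound[OF i])
            (use pt iter_partial_measurable[OF \<open>smooth h\<close> bs(1)] in \<open>auto intro: order_trans[OF pt abs_ge_self]\<close>)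
      qed
      also have "\<dots> = (M' / real m) powr p * (\<Sum>i\<in>I. LINT x|lborel. ?g i x)"
        using gi by simp
      \<comment> \<open>In the critical case the exponent l p - N of the scale is 0, so every bump
        costs at most \<open>C\<close>, however fine it is.\<close>
      also have "\<dots> \<le> (M' / real m) powr p * (\<Sum>i\<in>I. C)"
        using C(2)[of "4 ^ _" bs a] bs crit by (intro mult_left_mono sum_mono) auto
      also have "\<dots> = M' powr p * C * real m powr (1 - p)"
        using I M' m(5) by (simp add: powr_divide powr_diff)
      finally show ?thesis using m(1) by simp
    qed
  qed (use M' h0 K B m(4) in \<open>auto simp: compact_cube\<close>)
  then show ?thesis by blast
qed

section \<open>Choosing bumps and peaks\<close>

lemma test_functionI:
  assumes "smooth f" "compact K" "K \<subseteq> \<Omega>" "\<And>x. x \<notin> K \<Longrightarrow> f x = 0"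
  shows "test_function \<Omega> f"
proof -
  have "closure {x. f x \<noteq> 0} \<subseteq> K"
    using assms(2,4) by (intro closure_minimal) (auto simp: compact_imp_closed)
  then show ?thesis
    using assms(1-3) by (auto simp: test_function_def compact_eq_bounded_closed intro: bounded_subset)
qed

text \<open>A test function is a series with one nonzero term, so
  \<open>sobolev_space_suminf\<close> applies. The factor 2^(p+1) in \<kappa> cancels the decay
  factor at m = 0.\<close>

lemma sobolev_space_test_function:
  assumes \<Omega>: "\<Omega> \<in> sets lebesgue" and p: "1 \<le> p" and f: "test_function UNIV f"
  shows "f \<in> sobolev_space l (ereal p) \<Omega>"
proof -
  let ?L = "{bs :: 'a list. set bs \<subseteq> Basis \<and> length bs \<le> l}"
  let ?I = "\<lambda>bs. LINT x|lborel. \<bar>iter_partial bs f x\<bar> powr p"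
  define \<kappa> where "\<kappa> = 2 powr (p + 1) * (\<Sum>bs\<in>?L. ?I bs)"
  have I0: "0 \<le> ?I bs" for bs by (simp add: integral_nonneg_AE)
  have \<kappa>0: "0 \<le> \<kappa>" unfolding \<kappa>_def using I0 by (intro mult_nonneg_nonneg sum_nonneg) auto
  have zero: "test_function UNIV (\<lambda>_. 0)" by (simp add: test_function_def smooth_zero)
  have "(\<lambda>x. \<Sum>m. (if m = 0 then f else (\<lambda>_. 0)) x) \<in> sobolev_space l (ereal p) \<Omega>"
  proof (rule sobolev_space_suminf[OF \<Omega> p \<kappa>0])
    fix m :: nat and bs :: "'a list" assume bs: "set bs \<subseteq> Basis" "length bs \<le> l"
    show "(LINT x|lborel. \<bar>iter_partial bs (if m = 0 then f else (\<lambda>_. 0)) x\<bar> powr p)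
      \<le> \<kappa> * 2 powr (- (real m + 1) * (p + 1))"
    proof (cases "m = 0")
      case True
      have "?I bs \<le> (\<Sum>bs\<in>?L. ?I bs)"
        using bs I0 by (intro member_le_sum finite_index_lists) auto
      also have "\<dots> = \<kappa> * 2 powr (- (real m + 1) * (p + 1))"
        using True by (simp add: \<kappa>_def powr_add[symmetric] mult.commute mult.left_commute)
      finally show ?thesis using True by simp
    qed (use \<kappa>0 in \<open>simp add: iter_partial_zero\<close>)
  qed (use f zero in auto)
  also have "(\<lambda>x. \<Sum>m. (if m = 0 then f else (\<lambda>_. 0)) x) = f"
  proof
    fix x
    show "(\<Sum>m. (if m = 0 then f else (\<lambda>_. 0)) x) = f x"
      using suminf_finite[of "{0}" "\<lambda>m. (if m = 0 then f else (\<lambda>_. 0)) x"] by simp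
  qed
  finally show ?thesis .
qed

text \<open>The supports shrink geometrically along a coordinate direction towards a single point.\<close>

lemma ex_disjoint_normalized_bumps:
  fixes \<Omega> :: "'a::euclidean_space set"
  assumes \<Omega>: "open \<Omega>" "\<Omega> \<noteq> {}" and p: "1 \<le> p"
  obtains e :: "nat \<Rightarrow> 'a \<Rightarrow> real" and K :: "nat \<Rightarrow> 'a set"
  where "\<And>k. smooth (e k)" "\<And>k x. 0 \<le> e k x" "\<And>k. compact (K k)" "\<And>k. K k \<subseteq> \<Omega>"
    "\<And>k x. x \<notin> K k \<Longrightarrow> e k x = 0" "\<And>j k. j \<noteq> k \<Longrightarrow> K j \<inter> K k = {}"
    "\<And>k. (LINT x|lborel. \<bar>e k x\<bar> powr p) = 1"
    "\<And>U. open U \<Longrightarrow> U \<noteq> {} \<Longrightarrow> \<exists>U' S. open U' \<and> U' \<noteq> {} \<and> U' \<subseteq> U \<and> 0 \<le> S \<and> (\<forall>k. \<forall>x\<in>U'. e k x \<le> S)"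
proof -
  obtain z where z: "z \<in> \<Omega>" using \<Omega> by auto
  obtain b :: 'a where b: "b \<in> Basis" using nonempty_Basis by blast
  have "\<forall>\<^sub>F c in at_top. cube z c \<subseteq> \<Omega> \<and> 1 \<le> c"
    using cube_subset_open[OF \<Omega>(1) z] eventually_ge_at_top[of 1] by eventually_elim auto
  then obtain c0 where c0: "cube z c0 \<subseteq> \<Omega>" "1 \<le> c0" by (auto simp: eventually_at_top_linorder)
  \<comment> \<open>The k-th support lies in the slab where the coordinate along \<open>b\<close>,
    measured from \<open>z\<close>, is between d k and 3 d k. The factor 3 keeps it inside the cube
    around \<open>z\<close>, and the ratio 4 > 3 separates the slabs.\<close>
  define d where "d k = 1 / (3 * c0 * 4 ^ k)" for k :: nat
  have d: "0 < d k" "3 * d k \<le> 1 / c0" for k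
    using c0(2) by (auto simp: d_def field_simps)
  have dS: "4 * d (Suc k) = d k" for k by (simp add: d_def)
  have d_less: "4 * d j \<le> d k" if "k < j" for j k
    using that
  proof (induction j)
    case (Suc j)
    then show ?case using dS[of j] d(1)[of j] by (cases "k = j") auto
  qed simp
  define a where "a k = z + (2 * d k) *\<^sub>R b" for k
  define K where "K k = cube (a k) (1 / d k)" for k
  have mK: "\<bar>(x - a k) \<bullet> i\<bar> \<le> d k" if "x \<in> K k" "i \<in> Basis" for x k i
    using that d(1)[of k] by (auto simp: K_def mem_cube field_simps)
  have ai: "(a k - z) \<bullet> i = (if i = b then 2 * d k else 0)" if "i \<in> Basis" for i k
    using that b by (auto simp: a_def inner_Basis)
  have coord: "d k \<le> (x - z) \<bullet> b \<and> (x - z) \<bullet> b \<le> 3 * d k" if "x \<in> K k" for x k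
    using mK[OF that b] ai[OF b, of k] by (auto simp: abs_le_iff inner_diff_left)
  have K\<Omega>: "K k \<subseteq> \<Omega>" for k
  proof
    fix x assume x: "x \<in> K k"
    have "c0 * \<bar>(x - z) \<bullet> i\<bar> \<le> 1" if i: "i \<in> Basis" for i
    proof -
      have "\<bar>(x - z) \<bullet> i\<bar> \<le> 3 * d k"
        using mK[OF x i] ai[OF i, of k] d(1)[of k] by (auto simp: abs_le_iff inner_diff_left split: if_splits)
      also have "\<dots> \<le> 1 / c0" by (rule d(2))
      finally show ?thesis using c0(2) by (simp add: field_simps)
    qed
    then show "x \<in> \<Omega>" using c0 by (auto simp: mem_cube)
  qed
  have disj: "K j \<inter> K k = {}" if "j \<noteq> k" for j k
  proof -
    have "False" if "x \<in> K j" "x \<in> K k" "k < j" for x j k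
      using coord[OF that(1)] coord[OF that(2)] d_less[OF that(3)] d(1)[of j] by linarith
    then show ?thesis using that by (meson disjoint_iff linorder_neqE_nat)
  qed
  \<comment> \<open>These normalising heights tend to infinity, since the supports shrink; a common
    bound for the bumps can only be local.\<close>
  define q where "q k = (LINT x|lborel. \<bar>bump (a k) (1 / d k) x\<bar> powr p) powr (- 1 / p)" for k
  define e where "e k x = q k * bump (a k) (1 / d k) x" for k x
  have e0: "e k x = 0" if "x \<notin> K k" for k x
    using that d(1)[of k] by (simp add: e_def K_def bump_eq_0)
  have sm: "smooth (e k)" for k unfolding e_def by (intro smooth_cmult smooth_bump)
  have norm: "(LINT x|lborel. \<bar>e k x\<bar> powr p) = 1" for k
  proof -
    let ?b = "bump (a k) (1 / d k)"
    let ?B = "cube (a k) (2 * (1 / d k))"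
    have m: "?b \<in> borel_measurable borel" using iter_partial_measurable[OF smooth_bump, of "[]"] by simp
    have i: "integrable lborel (\<lambda>x. \<bar>?b x\<bar> powr p)"
      using d(1)[of k] p bump_bounds
      by (intro integral_powr_le_on_cube(2)[OF m _ _ bump_eq_0, where C=1]) (auto simp: abs_le_iff intro: order_trans[OF _ bump_bounds(1)])
    have fin: "emeasure lborel ?B < \<infinity>" by (simp add: cube_def emeasure_lborel_cbox_eq)
    have "0 < measure lborel ?B"
      using measure_cube[of "2 * (1 / d k)" "a k"] d(1)[of k] by (simp add: cube_def)
    also have "measure lborel ?B = (LINT x|lborel. indicator ?B x)" by simp
    also have "\<dots> \<le> (LINT x|lborel. \<bar>?b x\<bar> powr p)"
    proof (rule integral_mono[OF _ i])
      show "integrable lborel (indicator ?B :: 'a \<Rightarrow> real)"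
        using fin by (intro integrable_real_indicator) (auto simp: cube_def)
      show "indicator ?B x \<le> \<bar>?b x\<bar> powr p" for x
        using bump_eq_1[of "1 / d k" x "a k"] d(1)[of k] by (auto simp: indicator_def)
    qed
    finally have pos: "0 < (LINT x|lborel. \<bar>?b x\<bar> powr p)" .
    have "(LINT x|lborel. \<bar>e k x\<bar> powr p) = q k powr p * (LINT x|lborel. \<bar>?b x\<bar> powr p)"
      by (simp add: e_def abs_mult powr_mult q_def)
    also have "q k powr p = (LINT x|lborel. \<bar>?b x\<bar> powr p) powr (- 1)"
      using p by (simp add: q_def powr_powr)
    also have "\<dots> * (LINT x|lborel. \<bar>?b x\<bar> powr p) = 1"
      using pos by (simp add: powr_minus)
    finally show ?thesis .
  qed
  have loc: "\<exists>U' S. open U' \<and> U' \<noteq> {} \<and> U' \<subseteq> U \<and> 0 \<le> S \<and> (\<forall>k. \<forall>x\<in>U'. e k x \<le> S)"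
    if U: "open U" "U \<noteq> {}" for U
  proof -
    obtain y0 where y0: "y0 \<in> U" using U by auto
    obtain r where r: "r > 0" "ball y0 r \<subseteq> U" using U(1) y0 openE by blast
    \<comment> \<open>At a positive distance from the hyperplane through \<open>z\<close> orthogonal
      to \<open>b\<close> there are only finitely many supports, and every non-empty open set has
      points off this hyperplane.\<close>
    obtain y where y: "y \<in> U" "y \<bullet> b \<noteq> z \<bullet> b"
    proof (cases "y0 \<bullet> b = z \<bullet> b")
      case True
      have "y0 + (r / 2) *\<^sub>R b \<in> U" using r b by (intro subsetD[OF r(2)]) (simp add: dist_norm)
      moreover have "(y0 + (r / 2) *\<^sub>R b) \<bullet> b \<noteq> z \<bullet> b" using True r b by (simp add: inner_add_left)
      ultimately show ?thesis using that by blast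
    qed (use that y0 in blast)
    define \<delta> where "\<delta> = \<bar>(y - z) \<bullet> b\<bar> / 2"
    have \<delta>: "\<delta> > 0" using y by (simp add: \<delta>_def inner_diff_left)
    define U' where "U' = U \<inter> {x. \<delta> < \<bar>(x - z) \<bullet> b\<bar>}"
    have "open {x. \<delta> < \<bar>(x - z) \<bullet> b\<bar>}"
      by (intro open_Collect_less continuous_intros)
    then have U': "open U'" "U' \<subseteq> U" "y \<in> U'" using U y \<delta> by (auto simp: U'_def \<delta>_def)
    have "(\<lambda>k. 3 * d k) \<longlonglongrightarrow> 0"
    proof -
      have "3 * d k = (1 / c0) * (1 / 4) ^ k" for k by (simp add: d_def power_one_over)
      moreover have "(\<lambda>k. (1 / c0) * (1 / 4) ^ k) \<longlonglongrightarrow> (1 / c0) * 0"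
        by (intro tendsto_mult tendsto_const LIMSEQ_power_zero) simp
      ultimately show ?thesis by simp
    qed
    then have "\<forall>\<^sub>F k in sequentially. 3 * d k < \<delta>" using \<delta> by (rule order_tendstoD(2))
    then obtain k0 where k0: "\<And>k. k \<ge> k0 \<Longrightarrow> 3 * d k < \<delta>" by (auto simp: eventually_sequentially)
    have late: "e k x = 0" if "x \<in> U'" "k \<ge> k0" for x k
    proof (rule e0, rule notI)
      assume "x \<in> K k"
      then show False using coord[of x k] k0[OF that(2)] that(1) d(1)[of k] by (auto simp: U'_def)
    qed
    define S where "S = (\<Sum>k<k0. q k)"
    have q0: "0 \<le> q k" for k by (simp add: q_def)
    have "e k x \<le> S" if "x \<in> U'" for k x
    proof (cases "k < k0")
      case True
      have "e k x \<le> q k * 1" unfolding e_def by (intro mult_left_mono bump_bounds q0)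
      also have "\<dots> \<le> S" unfolding S_def using True q0 by (auto intro: member_le_sum)
      finally show ?thesis .
    next
      case False
      then show ?thesis using late[OF that, of k] q0 by (auto simp: S_def intro: sum_nonneg)
    qed
    moreover have "0 \<le> S" unfolding S_def using q0 by (rule sum_nonneg)
    ultimately show ?thesis using U' by blast
  qed
  show thesis
  proof (rule that[of e K])
    show "0 \<le> e k x" for k x by (simp add: e_def q_def bump_bounds)
    show "compact (K k)" for k by (simp add: K_def compact_cube)
  qed (use sm K\<Omega> e0 disj norm loc in auto)
qed

text \<open>Every open set has to contain some \<open>W n\<close>, but need not be a union of them.
  Hence the members of a countable basis may be shrunk to where \<open>P\<close> holds; in the
  application \<open>P\<close> is the common bound for the bumps.\<close>

lemma ex_countable_pi_base:
  fixes \<Omega> :: "'a::second_countable_topology set"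
  assumes \<Omega>: "open \<Omega>" "\<Omega> \<noteq> {}"
    and P: "\<And>U. open U \<Longrightarrow> U \<noteq> {} \<Longrightarrow> \<exists>U' S. open U' \<and> U' \<noteq> {} \<and> U' \<subseteq> U \<and> P U' S"
  obtains W :: "nat \<Rightarrow> 'a set" and S where
    "\<And>n. open (W n)" "\<And>n. W n \<noteq> {}" "\<And>n. W n \<subseteq> \<Omega>" "\<And>n. P (W n) (S n)"
    "\<And>U. open U \<Longrightarrow> U \<noteq> {} \<Longrightarrow> U \<subseteq> \<Omega> \<Longrightarrow> \<exists>n. W n \<subseteq> U"
proof -
  obtain \<B> :: "'a set set" where \<B>: "countable \<B>" "topological_basis \<B>"
    using ex_countable_basis by blast
  define \<U> where "\<U> = {U \<in> \<B>. U \<noteq> {} \<and> U \<subseteq> \<Omega>}"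
  have c: "countable \<U>" using \<B>(1) by (simp add: \<U>_def)
  have base: "\<exists>X\<in>\<U>. X \<subseteq> U" if "open U" "U \<noteq> {}" "U \<subseteq> \<Omega>" for U
  proof -
    obtain x where "x \<in> U" using \<open>U \<noteq> {}\<close> by auto
    then obtain X where "X \<in> \<B>" "x \<in> X" "X \<subseteq> U"
      using topological_basisE[OF \<B>(2) \<open>open U\<close>] by metis
    then show ?thesis using that by (intro bexI[of _ X]) (auto simp: \<U>_def)
  qed
  then have ne: "\<U> \<noteq> {}" using \<Omega> by blast
  have "\<exists>U' S. open U' \<and> U' \<noteq> {} \<and> U' \<subseteq> from_nat_into \<U> n \<and> P U' S" for n
    using from_nat_into[OF ne, of n] topological_basis_open[OF \<B>(2)] by (intro P) (auto simp: \<U>_def)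
  then obtain W S where W: "\<And>n. open (W n) \<and> W n \<noteq> {} \<and> W n \<subseteq> from_nat_into \<U> n \<and> P (W n) (S n)"
    by metis
  show thesis
  proof (rule that[of W S])
    show "W n \<subseteq> \<Omega>" for n using W[of n] from_nat_into[OF ne, of n] by (auto simp: \<U>_def)
    show "\<exists>n. W n \<subseteq> U" if U: "open U" "U \<noteq> {}" "U \<subseteq> \<Omega>" for U
    proof -
      obtain X where "X \<in> \<U>" "X \<subseteq> U" using base[OF U] by blast
      then obtain n where "from_nat_into \<U> n = X" using from_nat_into_surj[OF c] by blast
      then show ?thesis using W[of n] \<open>X \<subseteq> U\<close> by blast
    qed
  qed (use W in auto)
qed

text \<open>Gliding hump: each peak dominates everything chosen before it, and the supports of the later
  ones cover at most half of its plateau.\<close>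

lemma ex_peak_sequence:
  fixes w :: "nat \<Rightarrow> 'a::euclidean_space set" and \<epsilon> \<sigma> :: "nat \<Rightarrow> real"
  assumes peaks: "\<And>m \<epsilon> M. 0 < \<epsilon> \<Longrightarrow> \<exists>h K B t. peak l p s (w m) \<epsilon> M h K B t"
    and \<epsilon>: "\<And>m. 0 < \<epsilon> m"
  obtains h :: "nat \<Rightarrow> 'a \<Rightarrow> real" and K B :: "nat \<Rightarrow> 'a set" and t Q :: "nat \<Rightarrow> real"
  where "\<And>m. \<exists>\<epsilon>' M. \<epsilon>' \<le> \<epsilon> m \<and> peak l p s (w m) \<epsilon>' M (h m) (K m) (B m) (t m)"
    "\<And>j m. j < m \<Longrightarrow> measure lebesgue (K m) \<le> measure lebesgue (B j) / 2 ^ (m + 2)"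
    "\<And>m x. (\<Sum>j<m. h j x) \<le> Q m" "\<And>m. 0 \<le> Q m"
    "\<And>m. (real m + 1) * (1 + \<sigma> m + Q m) \<le> t m * measure lebesgue (B m) powr s"
proof -
  text \<open>In a state \<open>(h, K, B, t, q, \<tau>)\<close>, \<open>q\<close> bounds the sum of all peaks so far and \<open>\<tau>\<close> the measures
    of all plateaus so far, from below.\<close>
  define P where "P m = (\<lambda>(h :: 'a \<Rightarrow> real, K :: 'a set, B :: 'a set, t :: real, q :: real, \<tau> :: real).
      (\<exists>\<epsilon>' M. \<epsilon>' \<le> \<epsilon> m \<and> peak l p s (w m) \<epsilon>' M h K B t) \<and> 0 < \<tau> \<and> \<tau> \<le> measure lebesgue B \<and> 0 \<le> q \<and>
      (\<forall>x. h x \<le> q) \<and> (m = 0 \<longrightarrow> 1 + \<sigma> 0 \<le> t * measure lebesgue B powr s))" for m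
  \<comment> \<open>The step from m to m + 1: the constants m + 3 and m + 2 are the m + 2 and m + 1
    of the conclusion at the new index, and \<open>q\<close> bounds the sum of all predecessors of
    the new peak. The first peak has no step before it, hence the clause for m = 0 in
    \<open>P\<close>.\<close>
  define R where "R m = (\<lambda>(h :: 'a \<Rightarrow> real, K :: 'a set, B :: 'a set, t :: real, q :: real, \<tau> :: real)
      (h' :: 'a \<Rightarrow> real, K' :: 'a set, B' :: 'a set, t' :: real, q' :: real, \<tau>' :: real).
      measure lebesgue K' \<le> \<tau> / 2 ^ (m + 3) \<and> (\<forall>x. q + h' x \<le> q') \<and> \<tau>' \<le> \<tau> \<and>
      (real m + 2) * (1 + \<sigma> (Suc m) + q) \<le> t' * measure lebesgue B' powr s)" for m
  have bnd: "\<exists>q\<ge>0. \<forall>x. h x \<le> q" if "peak l p s U \<epsilon>' M h K B t" for U \<epsilon>' M h K B t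
  proof -
    have "continuous_on UNIV h" using that continuous_iter_partial[of h "[]"] by (simp add: peak_def)
    moreover have "compact K" "\<And>x. x \<notin> K \<Longrightarrow> h x = 0" using that by (auto simp: peak_def)
    ultimately obtain C where "C \<ge> 0" "\<And>x. \<bar>h x\<bar> \<le> C" using bounded_compact_support by metis
    then show ?thesis by (intro exI[of _ C]) (auto simp: abs_le_iff)
  qed
  have "\<exists>f. \<forall>m. P m (f m) \<and> R m (f m) (f (Suc m))"
  proof (rule dependent_nat_choice)
    obtain h K B t where pk: "peak l p s (w 0) (\<epsilon> 0) (1 + \<sigma> 0) h K B t" using peaks[OF \<epsilon>] by blast
    obtain q where "q \<ge> 0" "\<forall>x. h x \<le> q" using bnd[OF pk] by blast
    moreover have "0 < measure lebesgue B" "1 + \<sigma> 0 \<le> t * measure lebesgue B powr s"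
      using pk by (auto simp: peak_def)
    ultimately have "P 0 (h, K, B, t, q, measure lebesgue B)" unfolding P_def using pk by auto
    then show "\<exists>x. P 0 x" by blast
  next
    fix st m assume "P m st"
    then obtain h K B t q \<tau> where st: "st = (h, K, B, t, q, \<tau>)" "0 < \<tau>" "0 \<le> q"
      by (cases st) (auto simp: P_def)
    define \<epsilon>' where "\<epsilon>' = min (\<epsilon> (Suc m)) (\<tau> / 2 ^ (m + 3))"
    define M' where "M' = (real m + 2) * (1 + \<sigma> (Suc m) + q)"
    have "0 < \<epsilon>'" using \<epsilon> st by (simp add: \<epsilon>'_def)
    then obtain h' K' B' t' where pk: "peak l p s (w (Suc m)) \<epsilon>' M' h' K' B' t'"
      using peaks by blast
    obtain q' where q': "q' \<ge> 0" "\<forall>x. h' x \<le> q'" using bnd[OF pk] by blast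
    have B': "0 < measure lebesgue B'" "M' \<le> t' * measure lebesgue B' powr s" "measure lebesgue K' \<le> \<epsilon>'"
      using pk by (auto simp: peak_def)
    have "P (Suc m) (h', K', B', t', q + q', min \<tau> (measure lebesgue B'))"
    proof -
      have "\<exists>\<epsilon>'' M. \<epsilon>'' \<le> \<epsilon> (Suc m) \<and> peak l p s (w (Suc m)) \<epsilon>'' M h' K' B' t'"
        using pk by (intro exI[of _ \<epsilon>'] exI[of _ M'] conjI) (auto simp: \<epsilon>'_def)
      then show ?thesis unfolding P_def using q' st B' by (auto intro: add_increasing)
    qed
    moreover have "R m st (h', K', B', t', q + q', min \<tau> (measure lebesgue B'))"
      unfolding R_def st(1) using B' q' by (auto simp: \<epsilon>'_def M'_def)
    ultimately show "\<exists>y. P (Suc m) y \<and> R m st y" by blast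
  qed
  then obtain f where f: "\<And>m. P m (f m)" "\<And>m. R m (f m) (f (Suc m))" by blast
  define h where "h m = fst (f m)" for m
  define K where "K m = fst (snd (f m))" for m
  define B where "B m = fst (snd (snd (f m)))" for m
  define t where "t m = fst (snd (snd (snd (f m))))" for m
  define q where "q m = fst (snd (snd (snd (snd (f m)))))" for m
  define \<tau> where "\<tau> m = snd (snd (snd (snd (snd (f m)))))" for m
  have f_eq: "f m = (h m, K m, B m, t m, q m, \<tau> m)" for m
    by (simp add: h_def K_def B_def t_def q_def \<tau>_def)
  have Pm: "\<exists>\<epsilon>' M. \<epsilon>' \<le> \<epsilon> m \<and> peak l p s (w m) \<epsilon>' M (h m) (K m) (B m) (t m)" "\<tau> m \<le> measure lebesgue (B m)"
    "0 \<le> q m" "h m x \<le> q m" "m = 0 \<Longrightarrow> 1 + \<sigma> 0 \<le> t m * measure lebesgue (B m) powr s" for m x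
    using f(1)[of m] unfolding f_eq P_def by auto
  have Rm: "measure lebesgue (K (Suc m)) \<le> \<tau> m / 2 ^ (m + 3)" "q m + h (Suc m) x \<le> q (Suc m)" "\<tau> (Suc m) \<le> \<tau> m"
    "(real m + 2) * (1 + \<sigma> (Suc m) + q m) \<le> t (Suc m) * measure lebesgue (B (Suc m)) powr s" for m x
    using f(2)[of m] unfolding f_eq R_def by auto
  have \<tau>_mono: "\<tau> m \<le> \<tau> j" if "j \<le> m" for j m
    using Rm(3) that by (rule lift_Suc_antimono_le)
  have sum_le: "(\<Sum>j<Suc m. h j x) \<le> q m" for m x
  proof (induction m)
    case 0 then show ?case using Pm(4)[of 0 x] by simp
  next
    case (Suc m) then show ?case using Rm(2)[of m x] by simp
  qed
  \<comment> \<open>A shift by one: \<open>q j\<close> includes the peak j, whereas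
    \<open>Q m\<close> is to bound the peaks strictly before m.\<close>
  define Q where "Q m = (case m of 0 \<Rightarrow> 0 | Suc j \<Rightarrow> q j)" for m
  show thesis
  proof (rule that[of h K B t Q])
    show "measure lebesgue (K m) \<le> measure lebesgue (B j) / 2 ^ (m + 2)" if "j < m" for j m
    proof -
      obtain i where i: "m = Suc i" "j \<le> i" using \<open>j < m\<close> by (cases m) auto
      have "measure lebesgue (K m) \<le> \<tau> i / 2 ^ (m + 2)" using Rm(1)[of i] i by (simp add: power_add)
      also have "\<dots> \<le> measure lebesgue (B j) / 2 ^ (m + 2)"
        using \<tau>_mono[OF i(2)] Pm(2)[of j] by (intro divide_right_mono) auto
      finally show ?thesis .
    qed
    show "(\<Sum>j<m. h j x) \<le> Q m" for m x using sum_le by (cases m) (auto simp: Q_def simp del: sum.lessThan_Suc)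
    show "0 \<le> Q m" for m using Pm(3) by (cases m) (auto simp: Q_def)
    show "(real m + 1) * (1 + \<sigma> m + Q m) \<le> t m * measure lebesgue (B m) powr s" for m
      using Pm(5)[of m] Rm(4)[of "m - 1"] by (cases m) (auto simp: Q_def add.commute)
  qed (use Pm in blast)
qed

section \<open>The subspace\<close>

text \<open>Chebyshev's inequality: A \<mu>(G)^(1/r) is at most the norm of v in L^r(U), so these
  products stay bounded for v in L^r(U). For r = \<infinity> the exponent is 0, and positivity of
  \<mu>(G) makes the power equal to 1.\<close>

lemma not_Lp_space_if_large:
  fixes v :: "'a::euclidean_space \<Rightarrow> real"
  assumes r: "r = \<infinity> \<and> s = 0 \<or> (\<exists>\<rho>>0. r = ereal \<rho> \<and> s = 1 / \<rho>)" and U: "U \<in> sets lebesgue"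
    and large: "\<And>D. \<exists>G A. G \<in> lmeasurable \<and> G \<subseteq> U \<and> 0 < measure lebesgue G \<and> 0 \<le> A \<and>
      (AE x in lebesgue_on U. x \<in> G \<longrightarrow> A \<le> \<bar>v x\<bar>) \<and> D < A * measure lebesgue G powr s"
  shows "v \<notin> Lp_space r U"
  using r
proof (elim disjE conjE exE)
  assume r: "r = \<infinity>" "s = 0"
  show ?thesis
  proof
    assume "v \<in> Lp_space r U"
    then have ess: "esssup (lebesgue_on U) (\<lambda>x. ereal \<bar>v x\<bar>) < \<infinity>" using r by (simp add: Lp_space_def)
    then obtain D :: real where D: "esssup (lebesgue_on U) (\<lambda>x. ereal \<bar>v x\<bar>) \<le> ereal D"
      by (cases "esssup (lebesgue_on U) (\<lambda>x. ereal \<bar>v x\<bar>)") auto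
    obtain G A where G: "G \<in> lmeasurable" "G \<subseteq> U" "0 < measure lebesgue G"
      "AE x in lebesgue_on U. x \<in> G \<longrightarrow> A \<le> \<bar>v x\<bar>" "D < A * measure lebesgue G powr s"
      using large by blast
    have DA: "D < A" using G(3,5) r by simp
    have "AE x in lebesgue_on U. ereal \<bar>v x\<bar> \<le> esssup (lebesgue_on U) (\<lambda>x. ereal \<bar>v x\<bar>)"
      by (rule esssup_AE)
    then have "AE x in lebesgue_on U. x \<notin> G"
      using G(4)
    proof eventually_elim
      case (elim x)
      then have "ereal \<bar>v x\<bar> \<le> ereal D" using D by (meson order_trans)
      then show ?case using elim(2) DA by auto
    qed
    then have "AE x in lebesgue. x \<notin> G"
      using U G(2) by (auto simp: AE_restrict_space_iff elim!: eventually_mono)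
    then have "G \<in> null_sets lebesgue"
      using G(1) by (simp add: AE_iff_null_sets fmeasurableD)
    then have "measure lebesgue G = 0" by (simp add: measure_eq_0_null_sets)
    then show False using G(3) by simp
  qed
next
  fix \<rho> assume \<rho>: "0 < \<rho>" "r = ereal \<rho>" "s = 1 / \<rho>"
  show ?thesis
  proof
    assume "v \<in> Lp_space r U"
    then have i: "integrable (lebesgue_on U) (\<lambda>x. \<bar>v x\<bar> powr \<rho>)"
      using \<rho> by (simp add: Lp_space_ereal)
    define I where "I = (LINT x|lebesgue_on U. \<bar>v x\<bar> powr \<rho>)"
    have I0: "0 \<le> I" by (simp add: I_def integral_nonneg_AE)
    obtain G A where G: "G \<in> lmeasurable" "G \<subseteq> U" "0 < measure lebesgue G" "0 \<le> A"
      "AE x in lebesgue_on U. x \<in> G \<longrightarrow> A \<le> \<bar>v x\<bar>" "I powr s < A * measure lebesgue G powr s"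
      using large[of "I powr s"] by blast
    have iG: "integrable (lebesgue_on U) (\<lambda>x. A powr \<rho> * indicator G x)"
      and eq: "(LINT x|lebesgue_on U. A powr \<rho> * indicator G x) = A powr \<rho> * measure lebesgue G"
    proof -
      have "integrable lebesgue (\<lambda>x. A powr \<rho> * indicator G x)"
        using G(1) by (intro integrable_mult_right integrable_real_indicator) (auto simp: fmeasurable_def)
      moreover have "x \<notin> U \<Longrightarrow> A powr \<rho> * indicator G x = 0" for x using G(2) by (auto simp: indicator_def)
      ultimately show "integrable (lebesgue_on U) (\<lambda>x. A powr \<rho> * indicator G x)"
        "(LINT x|lebesgue_on U. A powr \<rho> * indicator G x) = A powr \<rho> * measure lebesgue G"
        using lebesgue_on_integral_eq[OF U, of "\<lambda>x. A powr \<rho> * indicator G x"] by auto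
    qed
    have "(LINT x|lebesgue_on U. A powr \<rho> * indicator G x) \<le> I"
      unfolding I_def
    proof (rule integral_mono_AE[OF iG i])
      show "AE x in lebesgue_on U. A powr \<rho> * indicator G x \<le> \<bar>v x\<bar> powr \<rho>"
        using G(5) by eventually_elim (use G(4) \<rho> in \<open>auto simp: indicator_def intro: powr_mono2\<close>)
    qed
    then have "A powr \<rho> * measure lebesgue G \<le> I" by (simp only: eq)
    then have "(A powr \<rho> * measure lebesgue G) powr s \<le> I powr s"
      using \<rho> by (intro powr_mono2) auto
    also have "(A powr \<rho> * measure lebesgue G) powr s = A * measure lebesgue G powr s"
      using \<rho> G(4) by (simp add: powr_mult powr_powr)
    finally show False using G(6) by simp
  qed
qed

section \<open>Linear dependence of real sequences\<close>

text \<open>Gaussian elimination by induction on the equations: one with a nonzero coefficient is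
  solved for that unknown and substituted into the others, which lowers both counts by one.\<close>

lemma ex_nontrivial_solution:
  fixes a :: "'b \<Rightarrow> nat \<Rightarrow> real"
  assumes "finite B" "finite J" "card B < card J"
  shows "\<exists>d. (\<exists>j\<in>J. d j \<noteq> 0) \<and> (\<forall>b\<in>B. (\<Sum>j\<in>J. d j * a b j) = 0)"
  using assms
proof (induction B arbitrary: J a rule: finite_induct)
  case empty
  then have "J \<noteq> {}" by auto
  then show ?case by (intro exI[of _ "\<lambda>_. 1"]) auto
next
  case (insert b B)
  show ?case
  proof (cases "\<forall>j\<in>J. a b j = 0")
    case True
    have "card B < card J" using insert by simp
    from insert.IH[OF insert.prems(1) this, of a]
    obtain d where "\<exists>j\<in>J. d j \<noteq> 0" "\<forall>b\<in>B. (\<Sum>j\<in>J. d j * a b j) = 0" by blast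
    then show ?thesis using True by (intro exI[of _ d]) auto
  next
    case False
    then obtain q where q: "q \<in> J" "a b q \<noteq> 0" by auto
    let ?J = "J - {q}"
    have "card B < card ?J" using insert q by simp
    then obtain d where d: "\<exists>j\<in>?J. d j \<noteq> 0"
      "\<And>b'. b' \<in> B \<Longrightarrow> (\<Sum>j\<in>?J. d j * (a b' j - a b' q * (a b j / a b q))) = 0"
      using insert.IH[of ?J "\<lambda>b' j. a b' j - a b' q * (a b j / a b q)"] insert.prems(1) by auto
    define dq where "dq = - (\<Sum>j\<in>?J. d j * a b j) / a b q"
    have s: "(\<Sum>j\<in>J. (d(q := dq)) j * a b' j) = dq * a b' q + (\<Sum>j\<in>?J. d j * a b' j)" for b'
      using q insert.prems(1) by (subst sum.remove[of _ q]) (auto intro!: arg_cong2[where f="(+)"] sum.cong)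
    have "(\<Sum>j\<in>J. (d(q := dq)) j * a b' j) = 0" if "b' \<in> insert b B" for b'
    proof (cases "b' = b")
      case True
      then show ?thesis unfolding s using q by (simp add: dq_def)
    next
      case False
      then have "0 = (\<Sum>j\<in>?J. d j * (a b' j - a b' q * (a b j / a b q)))" using d(2) that by auto
      also have "\<dots> = (\<Sum>j\<in>?J. d j * a b' j - (a b' q / a b q) * (d j * a b j))"
        by (intro sum.cong) (auto simp: algebra_simps)
      also have "\<dots> = (\<Sum>j\<in>?J. d j * a b' j) - (a b' q / a b q) * (\<Sum>j\<in>?J. d j * a b j)"
        by (simp add: sum_subtractf sum_distrib_left)
      also have "\<dots> = dq * a b' q + (\<Sum>j\<in>?J. d j * a b' j)" by (simp add: dq_def)
      finally show ?thesis unfolding s by simp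
    qed
    moreover have "\<exists>j\<in>J. (d(q := dq)) j \<noteq> 0" using d(1) by auto
    ultimately show ?thesis by blast
  qed
qed

text \<open>On the first card B + 1 coordinates some nonzero \<open>d\<close> is orthogonal to all
  rows, hence to every unit vector in their span; so its entries would all vanish.\<close>

lemma unit_vectors_not_finitely_spanned:
  fixes a :: "'b \<Rightarrow> nat \<Rightarrow> real"
  assumes "finite B" "\<And>k. \<exists>g. \<forall>j. of_bool (j = k) = (\<Sum>b\<in>B. g b * a b j)"
  shows False
proof -
  let ?J = "{..card B}"
  obtain d where d: "\<exists>k\<in>?J. d k \<noteq> 0" "\<And>b. b \<in> B \<Longrightarrow> (\<Sum>j\<in>?J. d j * a b j) = 0"
    using ex_nontrivial_solution[OF assms(1), of ?J a] by auto
  then obtain k where k: "k \<in> ?J" "d k \<noteq> 0" by blast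
  obtain g where g: "\<And>j. of_bool (j = k) = (\<Sum>b\<in>B. g b * a b j)" using assms(2) by blast
  have "d k = (\<Sum>j\<in>?J. d j * of_bool (j = k))" using k by simp
  also have "\<dots> = (\<Sum>j\<in>?J. \<Sum>b\<in>B. g b * (d j * a b j))"
    unfolding g by (simp add: sum_distrib_left mult.left_commute)
  also have "\<dots> = (\<Sum>b\<in>B. g b * (\<Sum>j\<in>?J. d j * a b j))"
    by (subst sum.swap) (simp add: sum_distrib_left)
  also have "\<dots> = 0" using d(2) by simp
  finally show False using k by simp
qed

section \<open>The series of bumps and peaks with given coefficients\<close>

text \<open>\<nu> m names the open set that receives the peak m, and \<kappa> m is its label;
  \<open>index\<close> makes every pair recur infinitely often. In \<open>h_small\<close> the second
  factor gives convergence in the Sobolev space, the first the smallness in \<open>L^p\<close> used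
  for the coefficient estimate.\<close>

locale peak_sequence =
  fixes \<Omega> :: "'a::euclidean_space set" and l :: nat and p s :: real
    and e :: "nat \<Rightarrow> 'a \<Rightarrow> real" and Ke :: "nat \<Rightarrow> 'a set"
    and W :: "nat \<Rightarrow> 'a set" and S :: "nat \<Rightarrow> real"
    and h :: "nat \<Rightarrow> 'a \<Rightarrow> real" and K B :: "nat \<Rightarrow> 'a set" and t Q :: "nat \<Rightarrow> real"
    and \<nu> \<kappa> :: "nat \<Rightarrow> nat"
  assumes \<Omega>: "open \<Omega>" and p: "1 \<le> p" and s: "0 \<le> s"
    and e_smooth: "smooth (e k)" and e_nonneg: "0 \<le> e k x"
    and Ke: "compact (Ke k)" "Ke k \<subseteq> \<Omega>" "x \<notin> Ke k \<Longrightarrow> e k x = 0"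
    and Ke_disjoint: "j \<noteq> k \<Longrightarrow> Ke j \<inter> Ke k = {}"
    and e_norm: "(LINT x|lborel. \<bar>e k x\<bar> powr p) = 1"
    and W: "open U \<Longrightarrow> U \<noteq> {} \<Longrightarrow> U \<subseteq> \<Omega> \<Longrightarrow> \<exists>n. W n \<subseteq> U"
    and S: "x \<in> W n \<Longrightarrow> e k x \<le> S n" "0 \<le> S n"
    and h_smooth: "smooth (h m)" and h_nonneg: "0 \<le> h m x"
    and K: "compact (K m)" "x \<notin> K m \<Longrightarrow> h m x = 0"
    and B: "compact (B m)" "B m \<subseteq> W (\<nu> m)" "0 < measure lebesgue (B m)" "measure lebesgue (B m) \<le> 1"
    and t: "x \<in> B m \<Longrightarrow> t m \<le> h m x" "0 \<le> t m"
    and Q: "(\<Sum>j<m. h j x) \<le> Q m" "0 \<le> Q m"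
    and K_small: "j < m \<Longrightarrow> measure lebesgue (K m) \<le> measure lebesgue (B j) / 2 ^ (m + 2)"
    and t_large: "(real m + 1) * (1 + S (\<nu> m) + Q m) \<le> t m * measure lebesgue (B m) powr s"
    and h_small: "set bs \<subseteq> Basis \<Longrightarrow> length bs \<le> l \<Longrightarrow>
      (LINT x|lborel. \<bar>iter_partial bs (h m) x\<bar> powr p) \<le> 2 powr (- (p + 1)) * 2 powr (- (real m + 1) * (p + 1))"
    and index: "\<exists>m\<ge>N. \<nu> m = n \<and> \<kappa> m = k"
begin

lemma lebesgue_\<Omega>: "\<Omega> \<in> sets lebesgue" using \<Omega> by auto

lemma p_pos: "0 < p" "0 \<le> p" using p by auto

lemma e_test: "test_function \<Omega> (e k)" "test_function UNIV (e k)"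
  using test_functionI[OF e_smooth Ke] test_functionI[OF e_smooth Ke(1) subset_UNIV Ke(3)] by auto

lemma h_test: "test_function UNIV (h m)"
  by (rule test_functionI[OF h_smooth K(1) subset_UNIV K(2)])

lemma h_measurable [measurable]: "h m \<in> borel_measurable lebesgue"
  using test_function_iter_partial(3)[OF h_test _ p_pos(1), of "[]"] by simp

lemma e_measurable [measurable]: "e k \<in> borel_measurable lebesgue"
  using test_function_iter_partial(3)[OF e_test(2) _ p_pos(1), of "[]"] by simp

definition H :: "'a \<Rightarrow> real" where "H x = (\<Sum>m. h m x)"

definition F :: "(nat \<Rightarrow> real) \<Rightarrow> 'a \<Rightarrow> real" where
  "F c x = (\<Sum>k. c k * e k x) + (\<Sum>m. c (\<kappa> m) * h m x)"

lemma H_props: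
  "AE x in lebesgue. summable (\<lambda>m. h m x)"
  "integrable lebesgue (\<lambda>x. H x powr p)"
  "(LINT x|lebesgue. H x powr p) \<le> 2 powr (- (p + 1))"
proof -
  have i: "integrable lebesgue (\<lambda>x. \<bar>h m x\<bar> powr p)"
    "(LINT x|lebesgue. \<bar>h m x\<bar> powr p) \<le> 2 powr (- (p + 1)) * 2 powr (- (real m + 1) * (p + 1))" for m
    using test_function_iter_partial(1,2)[OF h_test _ p_pos(1), of "[]" m] h_small[of "[]" m] by simp_all
  have "0 \<le> 2 powr (- (p + 1))" by simp
  note * = p this h_measurable i
  show "AE x in lebesgue. summable (\<lambda>m. h m x)" using AE_summable_Lp[OF *] h_nonneg by simp
  show "integrable lebesgue (\<lambda>x. H x powr p)" using integrable_suminf_Lp[OF *] h_nonneg by (simp add: H_def)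
  show "(LINT x|lebesgue. H x powr p) \<le> 2 powr (- (p + 1))" using integral_suminf_Lp_le[OF *] h_nonneg by (simp add: H_def)
qed

lemma e_zero_outside: "x \<in> Ke j \<Longrightarrow> k \<noteq> j \<Longrightarrow> e k x = 0"
  using Ke_disjoint[of k j] Ke(3)[of x k] by blast

lemma suminf_e: "x \<in> Ke j \<Longrightarrow> (\<Sum>k. c k * e k x) = c j * e j x"
  using suminf_finite[of "{j}" "\<lambda>k. c k * e k x"] e_zero_outside[of x j] by simp

lemma summable_e: "summable (\<lambda>k. c k * e k x)"
proof (cases "\<exists>j. x \<in> Ke j")
  case True
  then obtain j where "x \<in> Ke j" by blast
  then show ?thesis using summable_finite[of "{j}" "\<lambda>k. c k * e k x"] e_zero_outside[of x j] by simp
next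
  case False
  then show ?thesis using Ke(3)[of x] by simp
qed

lemma abs_suminf_e_le:
  assumes "\<And>k. \<bar>c k\<bar> \<le> C" "\<And>k. e k x \<le> A" "0 \<le> A"
  shows "\<bar>\<Sum>k. c k * e k x\<bar> \<le> C * A"
proof -
  have C: "0 \<le> C" using assms(1)[of 0] by linarith
  show ?thesis
  proof (cases "\<exists>j. x \<in> Ke j")
    case True
    then obtain j where j: "x \<in> Ke j" by blast
    have "\<bar>c j\<bar> * e j x \<le> C * A" using assms e_nonneg C by (intro mult_mono) auto
    then show ?thesis using j e_nonneg[of j x] by (simp add: suminf_e abs_mult)
  next
    case False
    then show ?thesis using Ke(3)[of x] C assms(3) by simp
  qed
qed

lemma summable_h:
  assumes "summable (\<lambda>m. h m x)" "\<And>k. \<bar>c k\<bar> \<le> C"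
  shows "summable (\<lambda>m. c (\<kappa> m) * h m x)" "\<bar>\<Sum>m. c (\<kappa> m) * h m x\<bar> \<le> C * H x"
proof -
  have le: "\<bar>c (\<kappa> m) * h m x\<bar> \<le> C * h m x" for m
    using assms(2) h_nonneg by (simp add: abs_mult mult_right_mono)
  have s: "summable (\<lambda>m. C * h m x)" using assms(1) by (rule summable_mult)
  show s1: "summable (\<lambda>m. c (\<kappa> m) * h m x)"
    by (rule summable_comparison_test'[OF s, of 0]) (use le in simp)
  have s2: "summable (\<lambda>m. \<bar>c (\<kappa> m) * h m x\<bar>)"
    by (rule summable_comparison_test'[OF s, of 0]) (use le in simp)
  have "\<bar>\<Sum>m. c (\<kappa> m) * h m x\<bar> \<le> (\<Sum>m. \<bar>c (\<kappa> m) * h m x\<bar>)" by (rule summable_rabs[OF s2])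
  also have "\<dots> \<le> (\<Sum>m. C * h m x)" by (rule suminf_le[OF le s2 s])
  also have "\<dots> = C * H x" using suminf_mult[OF assms(1), of C] by (simp add: H_def)
  finally show "\<bar>\<Sum>m. c (\<kappa> m) * h m x\<bar> \<le> C * H x" .
qed

text \<open>Where \<Sum>m. h m x converges, boundedness of the coefficients gives absolute
  convergence of the weighted series; elsewhere linearity of \<open>suminf\<close> may fail. By
  \<open>H_props\<close> the exceptional points form a null set.\<close>

lemma F_lincomb:
  assumes x: "summable (\<lambda>m. h m x)" and c: "bounded (range c)" and d: "bounded (range d)"
  shows "F (\<lambda>k. a * c k + b * d k) x = a * F c x + b * F d x"
proof -
  obtain C D where CD: "\<And>k. \<bar>c k\<bar> \<le> C" "\<And>k. \<bar>d k\<bar> \<le> D"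
    using c d by (auto simp: bounded_iff)
  have e: "(\<Sum>k. (a * c k + b * d k) * e k x) = a * (\<Sum>k. c k * e k x) + b * (\<Sum>k. d k * e k x)"
    using suminf_add[OF summable_mult[OF summable_e[of c x], of a] summable_mult[OF summable_e[of d x], of b]]
      suminf_mult[OF summable_e[of c x], of a] suminf_mult[OF summable_e[of d x], of b]
    by (simp add: algebra_simps)
  note sc = summable_h(1)[of x c C, OF x CD(1)] and sd = summable_h(1)[of x d D, OF x CD(2)]
  have "(\<Sum>m. (a * c (\<kappa> m) + b * d (\<kappa> m)) * h m x) = a * (\<Sum>m. c (\<kappa> m) * h m x) + b * (\<Sum>m. d (\<kappa> m) * h m x)"
    using suminf_add[OF summable_mult[OF sc, of a] summable_mult[OF sd, of b]]
      suminf_mult[OF sc, of a] suminf_mult[OF sd, of b]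
    by (simp add: algebra_simps)
  then show ?thesis using e by (simp add: F_def algebra_simps)
qed

lemma AE_lebesgue_on: "AE x in lebesgue. P x \<Longrightarrow> AE x in lebesgue_on \<Omega>. P x"
  using lebesgue_\<Omega> by (auto simp: AE_restrict_space_iff elim!: eventually_mono)

lemma F_measurable [measurable]: "F c \<in> borel_measurable lebesgue"
  unfolding F_def[abs_def] by measurable

section \<open>Recovering the coefficients from the L^p norm\<close>

text \<open>On the support of \<open>e k\<close> the other bumps vanish, so \<open>c k * e k\<close>
  equals \<open>F c\<close> up to the peaks, whose sum is at most C H with C = sup |c|. Integration
  gives |c k|^p \<le> 2^p I + C^p / 2. The supremum over \<open>k\<close> replaces the left side by
  C^p, and as C is finite, C^p / 2 can be subtracted.\<close>

lemma coefficient_powr_le: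
  assumes c: "bounded (range c)" and i: "integrable (lebesgue_on \<Omega>) (\<lambda>x. \<bar>F c x\<bar> powr p)"
  shows "\<bar>c k\<bar> powr p \<le> 2 powr (p + 1) * (LINT x|lebesgue_on \<Omega>. \<bar>F c x\<bar> powr p)"
proof -
  define I where "I = (LINT x|lebesgue_on \<Omega>. \<bar>F c x\<bar> powr p)"
  define C where "C = (SUP k. \<bar>c k\<bar>)"
  have bdd: "bdd_above (range (\<lambda>k. \<bar>c k\<bar>))"
  proof -
    obtain M where "\<And>k. \<bar>c k\<bar> \<le> M" using c by (auto simp: bounded_iff)
    then show ?thesis by (intro bdd_aboveI[of _ M]) auto
  qed
  have C: "\<bar>c k\<bar> \<le> C" for k unfolding C_def by (rule cSUP_upper[OF _ bdd]) simp
  have C0: "0 \<le> C" using C[of 0] by linarith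
  have I0: "0 \<le> I" by (simp add: I_def integral_nonneg_AE)
  have i': "integrable lebesgue (\<lambda>x. indicator \<Omega> x * \<bar>F c x\<bar> powr p)"
    and I': "(LINT x|lebesgue. indicator \<Omega> x * \<bar>F c x\<bar> powr p) = I"
    using i lebesgue_\<Omega> by (auto simp: integrable_restrict_space integral_restrict_space I_def)
  have *: "\<bar>c k\<bar> powr p \<le> 2 powr p * I + C powr p / 2" for k
  proof -
    have ie: "integrable lebesgue (\<lambda>x. \<bar>e k x\<bar> powr p)" "(LINT x|lebesgue. \<bar>e k x\<bar> powr p) = 1"
      using test_function_iter_partial(1,2)[OF e_test(2) _ p_pos(1), of "[]" k] e_norm[of k] by simp_all
    have ir: "integrable lebesgue (\<lambda>x. 2 powr p * (indicator \<Omega> x * \<bar>F c x\<bar> powr p + C powr p * H x powr p))"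
      using i' H_props(2) by (intro integrable_mult_right Bochner_Integration.integrable_add) auto
    have "\<bar>c k\<bar> powr p = (LINT x|lebesgue. \<bar>c k\<bar> powr p * \<bar>e k x\<bar> powr p)"
      using ie by simp
    also have "\<dots> \<le> (LINT x|lebesgue. 2 powr p * (indicator \<Omega> x * \<bar>F c x\<bar> powr p + C powr p * H x powr p))"
    proof (rule integral_mono_AE[OF _ ir])
      show "integrable lebesgue (\<lambda>x. \<bar>c k\<bar> powr p * \<bar>e k x\<bar> powr p)" using ie by simp
      show "AE x in lebesgue. \<bar>c k\<bar> powr p * \<bar>e k x\<bar> powr p \<le> 2 powr p * (indicator \<Omega> x * \<bar>F c x\<bar> powr p + C powr p * H x powr p)"
        using H_props(1)
      proof eventually_elim
        case (elim x)
        show ?case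
        proof (cases "x \<in> Ke k")
          case True
          let ?G = "\<Sum>m. c (\<kappa> m) * h m x"
          have "c k * e k x = F c x + (- ?G)" using suminf_e[OF True, of c] by (simp add: F_def)
          then have "\<bar>c k * e k x\<bar> powr p \<le> 2 powr p * (\<bar>F c x\<bar> powr p + \<bar>- ?G\<bar> powr p)"
            using powr_abs_add_le[OF p_pos(2), of "F c x" "- ?G"] by simp
          also have "\<dots> \<le> 2 powr p * (\<bar>F c x\<bar> powr p + (C * H x) powr p)"
            using summable_h(2)[of x c C, OF elim C] p_pos by (intro mult_left_mono add_left_mono powr_mono2) auto
          finally show ?thesis using True Ke(2)[of k] by (auto simp: abs_mult powr_mult)
        qed (use Ke(3)[of x k] p_pos in \<open>auto intro!: mult_nonneg_nonneg add_nonneg_nonneg\<close>)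
      qed
    qed
    also have "\<dots> = 2 powr p * (I + C powr p * (LINT x|lebesgue. H x powr p))"
      using i' H_props(2) I' by simp
    also have "\<dots> \<le> 2 powr p * (I + C powr p * 2 powr (- (p + 1)))"
      using H_props(3) by (intro mult_left_mono add_left_mono) auto
    also have "\<dots> = 2 powr p * I + C powr p * (2 powr p * 2 powr (- (p + 1)))"
      by (simp add: algebra_simps)
    also have "2 powr p * 2 powr (- (p + 1)) = (1 / 2 :: real)"
      by (simp only: powr_add[symmetric]) (simp add: powr_minus)
    finally show ?thesis by simp
  qed
  have "C \<le> (2 powr p * I + C powr p / 2) powr (1 / p)"
    unfolding C_def
  proof (rule cSUP_least)
    fix k
    have "\<bar>c k\<bar> = (\<bar>c k\<bar> powr p) powr (1 / p)" using p_pos by (simp add: powr_powr)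
    also have "\<dots> \<le> (2 powr p * I + C powr p / 2) powr (1 / p)"
      using * p_pos by (intro powr_mono2) auto
    finally show "\<bar>c k\<bar> \<le> (2 powr p * I + (SUP k. \<bar>c k\<bar>) powr p / 2) powr (1 / p)"
      by (simp add: C_def)
  qed simp
  then have "C powr p \<le> ((2 powr p * I + C powr p / 2) powr (1 / p)) powr p"
    using p_pos C0 by (intro powr_mono2) auto
  also have "\<dots> = 2 powr p * I + C powr p / 2"
    using p_pos I0 by (simp add: powr_powr)
  finally have "C powr p \<le> 2 powr (p + 1) * I" by (simp add: powr_add)
  moreover have "\<bar>c k\<bar> powr p \<le> C powr p" using C p_pos by (intro powr_mono2) auto
  ultimately show ?thesis by (simp add: I_def)
qed

section \<open>Linearity and dimension of the subspace\<close>

text \<open>Equality almost everywhere makes \<open>V\<close> a union of equivalence classes, as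
  \<open>sobolev_closed\<close> demands. Membership in the Sobolev space is a real restriction on
  \<open>c\<close>: if all coefficients are 1, the disjoint bumps of norm one already prevent
  \<open>F c\<close> from lying in \<open>L^p\<close>.\<close>

definition V :: "('a \<Rightarrow> real) set" where
  "V = {v \<in> sobolev_space l (ereal p) \<Omega>.
     \<exists>c. bounded (range c) \<and> (AE x in lebesgue_on \<Omega>. v x = F c x)}"

lemma bounded_range_lincomb:
  fixes c d :: "nat \<Rightarrow> real"
  assumes "bounded (range c)" "bounded (range d)"
  shows "bounded (range (\<lambda>k. a * c k + b * d k))"
proof -
  obtain C D where "\<And>k. \<bar>c k\<bar> \<le> C" "\<And>k. \<bar>d k\<bar> \<le> D" using assms by (auto simp: bounded_iff)
  then have "\<bar>a * c k + b * d k\<bar> \<le> \<bar>a\<bar> * C + \<bar>b\<bar> * D" for k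
    by (intro order_trans[OF abs_triangle_ineq] add_mono) (auto simp: abs_mult intro: mult_left_mono)
  then show ?thesis by (auto simp: bounded_iff)
qed

lemma AE_F_lincomb:
  assumes "bounded (range c)" "bounded (range d)"
    "AE x in lebesgue_on \<Omega>. u x = F c x" "AE x in lebesgue_on \<Omega>. v x = F d x"
  shows "AE x in lebesgue_on \<Omega>. a * u x + b * v x = F (\<lambda>k. a * c k + b * d k) x"
  using assms(3,4) AE_lebesgue_on[OF H_props(1)]
  by eventually_elim (simp add: F_lincomb[OF _ assms(1,2)])

lemma V_lincomb:
  assumes "u \<in> V" "v \<in> V"
  shows "(\<lambda>x. a * u x + b * v x) \<in> V"
proof -
  obtain c d where "bounded (range c)" "AE x in lebesgue_on \<Omega>. u x = F c x"
    "bounded (range d)" "AE x in lebesgue_on \<Omega>. v x = F d x"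
    using assms by (auto simp: V_def)
  then show ?thesis
    using assms sobolev_space_lincomb[OF lebesgue_\<Omega> p_pos(2), of u l v a b]
      bounded_range_lincomb[of c d a b] AE_F_lincomb[of c d u v a b]
    by (auto simp: V_def)
qed

text \<open>Unit coefficients leave one bump and a subseries of the peaks; with the omitted peaks
  replaced by 0 the bounds of the full series still hold.\<close>

lemma F_unit_in_V: "F (\<lambda>j. of_bool (j = k)) \<in> V"
proof -
  define g where "g m x = of_bool (\<kappa> m = k) * h m x" for m x
  have "smooth (g m)" for m
    using smooth_cmult[OF h_smooth, of "of_bool (\<kappa> m = k)" m] by (simp only: g_def[abs_def])
  then have "test_function UNIV (g m)" for m
    by (rule test_functionI[OF _ K(1)[of m] subset_UNIV]) (simp add: g_def K(2))
  moreover have "(LINT x|lborel. \<bar>iter_partial bs (g m) x\<bar> powr p) \<le> 2 powr (- (p + 1)) * 2 powr (- (real m + 1) * (p + 1))"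
    if bs: "set bs \<subseteq> Basis" "length bs \<le> l" for m bs
  proof (cases "\<kappa> m = k")
    case True
    then show ?thesis using h_small[OF bs, of m] by (simp add: g_def[abs_def])
  next
    case False
    then show ?thesis by (simp add: g_def[abs_def] iter_partial_zero)
  qed
  ultimately have "(\<lambda>x. \<Sum>m. g m x) \<in> sobolev_space l (ereal p) \<Omega>"
    by (intro sobolev_space_suminf[OF lebesgue_\<Omega> p, of "2 powr (- (p + 1))"]) auto
  moreover have "e k \<in> sobolev_space l (ereal p) \<Omega>"
    by (rule sobolev_space_test_function[OF lebesgue_\<Omega> p e_test(2)])
  ultimately have "(\<lambda>x. 1 * e k x + 1 * (\<Sum>m. g m x)) \<in> sobolev_space l (ereal p) \<Omega>"
    by (intro sobolev_space_lincomb[OF lebesgue_\<Omega> p_pos(2)])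
  also have "(\<lambda>x. 1 * e k x + 1 * (\<Sum>m. g m x)) = F (\<lambda>j. of_bool (j = k))"
  proof
    fix x
    have "(\<Sum>j. of_bool (j = k) * e j x) = e k x"
      using suminf_finite[of "{k}" "\<lambda>j. of_bool (j = k) * e j x"] by simp
    then show "1 * e k x + 1 * (\<Sum>m. g m x) = F (\<lambda>j. of_bool (j = k)) x"
      by (simp add: F_def g_def)
  qed
  finally show ?thesis
    by (auto simp: V_def bounded_iff intro!: exI[of _ "\<lambda>j. of_bool (j = k)"] exI[of _ 1])
qed

lemma linear_subspace_V: "linear_subspace V"
  unfolding linear_subspace_def
proof (intro conjI ballI allI)
  show "(\<lambda>x. 0) \<in> V" using V_lincomb[OF F_unit_in_V F_unit_in_V, of 0 0 0 0] by simp
  show "(\<lambda>x. u x + v x) \<in> V" if "u \<in> V" "v \<in> V" for u v using V_lincomb[OF that, of 1 1] by simp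
  show "(\<lambda>x. c * v x) \<in> V" if "v \<in> V" for c v using V_lincomb[OF that that, of c 0] by simp
qed

text \<open>The coefficient estimate with right side 0. Coefficients are thereby determined by the
  function, which turns linear dependence in \<open>V\<close> into linear dependence of
  sequences.\<close>

lemma V_coefficients_unique:
  assumes c: "bounded (range c)" and 0: "AE x in lebesgue_on \<Omega>. F c x = 0"
  shows "c k = 0"
proof -
  have m: "(\<lambda>x. \<bar>F c x\<bar> powr p) \<in> borel_measurable (lebesgue_on \<Omega>)"
    by (intro measurable_restrict_space1) measurable
  have z: "AE x in lebesgue_on \<Omega>. \<bar>F c x\<bar> powr p = 0" using 0 by eventually_elim (use p_pos in simp)
  have "integrable (lebesgue_on \<Omega>) (\<lambda>x. \<bar>F c x\<bar> powr p)"
    using integrable_cong_AE[OF m borel_measurable_const z] by simp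
  moreover have "(LINT x|lebesgue_on \<Omega>. \<bar>F c x\<bar> powr p) = 0"
    using integral_cong_AE[OF m borel_measurable_const z] by simp
  ultimately show ?thesis using coefficient_powr_le[OF c, of k] by simp
qed

lemma infinite_dimensional_V: "infinite_dimensional \<Omega> V"
  unfolding infinite_dimensional_def
proof
  assume "\<exists>B. finite B \<and> B \<subseteq> V \<and> (\<forall>v\<in>V. \<exists>c. ae_zero \<Omega> (\<lambda>x. v x - (\<Sum>b\<in>B. c b * b x)))"
  then obtain D where D: "finite D" "D \<subseteq> V"
    "\<And>v. v \<in> V \<Longrightarrow> \<exists>g. ae_zero \<Omega> (\<lambda>x. v x - (\<Sum>b\<in>D. g b * b x))" by blast
  have "\<forall>b\<in>D. \<exists>c. bounded (range c) \<and> (AE x in lebesgue_on \<Omega>. b x = F c x)"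
    using D(2) by (auto simp: V_def)
  from bchoice[OF this] obtain cf
    where cf: "\<And>b. b \<in> D \<Longrightarrow> bounded (range (cf b))" "\<And>b. b \<in> D \<Longrightarrow> AE x in lebesgue_on \<Omega>. b x = F (cf b) x"
    by blast
  have comb: "bounded (range (\<lambda>j. \<Sum>b\<in>D'. g b * cf b j)) \<and>
      (AE x in lebesgue_on \<Omega>. (\<Sum>b\<in>D'. g b * b x) = F (\<lambda>j. \<Sum>b\<in>D'. g b * cf b j) x)"
    if "D' \<subseteq> D" for D' g
    using finite_subset[OF that D(1)] that
  proof (induction D' rule: finite_induct)
    case empty
    show ?case by (simp add: F_def)
  next
    case (insert b D')
    then show ?case
      using bounded_range_lincomb[of "cf b" "\<lambda>j. \<Sum>b\<in>D'. g b * cf b j" "g b" 1]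
        AE_F_lincomb[of "cf b" "\<lambda>j. \<Sum>b\<in>D'. g b * cf b j" b "\<lambda>x. \<Sum>b\<in>D'. g b * b x" "g b" 1] cf[of b]
      by simp
  qed
  show False
  proof (rule unit_vectors_not_finitely_spanned[OF D(1), of cf])
    fix k
    let ?u = "\<lambda>j :: nat. of_bool (j = k) :: real"
    have u: "bounded (range ?u)" by (auto simp: bounded_iff intro!: exI[of _ 1])
    obtain g where "ae_zero \<Omega> (\<lambda>x. F ?u x - (\<Sum>b\<in>D. g b * b x))"
      using D(3)[OF F_unit_in_V] by blast
    then have z: "AE x in lebesgue_on \<Omega>. F ?u x - (\<Sum>b\<in>D. g b * b x) = 0" by (simp add: ae_zero_def)
    let ?c = "\<lambda>j. 1 * ?u j + (-1) * (\<Sum>b\<in>D. g b * cf b j)"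
    have cg: "bounded (range (\<lambda>j. \<Sum>b\<in>D. g b * cf b j))"
      "AE x in lebesgue_on \<Omega>. (\<Sum>b\<in>D. g b * b x) = F (\<lambda>j. \<Sum>b\<in>D. g b * cf b j) x"
      using comb[of D g] by auto
    have "AE x in lebesgue_on \<Omega>. 1 * F ?u x + (-1) * (\<Sum>b\<in>D. g b * b x) = F ?c x"
      by (rule AE_F_lincomb[OF u cg(1) _ cg(2)]) simp
    then have "AE x in lebesgue_on \<Omega>. F ?c x = 0" using z by eventually_elim simp
    then have "?c j = 0" for j
      by (rule V_coefficients_unique[OF bounded_range_lincomb[OF u cg(1)]])
    then show "\<exists>g. \<forall>j. of_bool (j = k) = (\<Sum>b\<in>D. g b * cf b j)" by (intro exI[of _ g]) simp
  qed
qed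

lemma abs_F_le:
  assumes "summable (\<lambda>m. h m x)" "\<And>k. \<bar>c k\<bar> \<le> C"
  shows "\<bar>F c x\<bar> \<le> C * ((\<Sum>k. e k x) + H x)"
proof -
  have e: "summable (\<lambda>k. e k x)" using summable_e[of "\<lambda>_. 1" x] by simp
  have "e k x \<le> (\<Sum>k. e k x)" for k using sum_le_suminf[OF e, of "{k}"] e_nonneg by simp
  then have "\<bar>\<Sum>k. c k * e k x\<bar> \<le> C * (\<Sum>k. e k x)"
    using assms(2) e e_nonneg by (intro abs_suminf_e_le suminf_nonneg) auto
  then show ?thesis using summable_h(2)[of x c C, OF assms] by (simp add: F_def distrib_left)
qed

section \<open>Closedness\<close>

text \<open>The coefficient estimate turns \<open>L^p\<close> convergence into a uniform Cauchy
  condition on the coefficients. With their uniform limit c', \<open>F (c j)\<close> tends to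
  \<open>F c'\<close> almost everywhere, while a subsequence of the approximants tends to
  \<open>v\<close> almost everywhere; hence v = F c'.\<close>

lemma sobolev_closed_V: "sobolev_closed l (ereal p) \<Omega> V"
  unfolding sobolev_closed_def
proof (intro ballI impI)
  fix v assume v: "v \<in> sobolev_space l (ereal p) \<Omega>"
    and approx: "\<forall>\<epsilon>>0. \<exists>u\<in>V. sobolev_norm l (ereal p) \<Omega> (\<lambda>x. u x - v x) < \<epsilon>"
  have vL: "v \<in> Lp_space (ereal p) \<Omega>" using v by (simp add: sobolev_space_def)
  have VL: "u \<in> Lp_space (ereal p) \<Omega>" if "u \<in> V" for u using that by (simp add: V_def sobolev_space_def)
  have diff: "(\<lambda>x. u x - w x) \<in> Lp_space (ereal p) \<Omega>"
    if "u \<in> Lp_space (ereal p) \<Omega>" "w \<in> Lp_space (ereal p) \<Omega>" for u w :: "'a \<Rightarrow> real"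
    using Lp_space_lincomb[OF p_pos(2) that, of 1 "-1"] by simp
  have "\<exists>u. u \<in> V \<and> (LINT x|lebesgue_on \<Omega>. \<bar>u x - v x\<bar> powr p) < 1 / real (Suc j)" for j
  proof -
    obtain u where u: "u \<in> V" "sobolev_norm l (ereal p) \<Omega> (\<lambda>x. u x - v x) < (1 / real (Suc j)) powr (1 / p)"
      using approx[rule_format, of "(1 / real (Suc j)) powr (1 / p)"] by auto
    have "(LINT x|lebesgue_on \<Omega>. \<bar>u x - v x\<bar> powr p) < ((1 / real (Suc j)) powr (1 / p)) powr p"
      by (rule integral_powr_less_if_sobolev_norm_less[OF \<Omega> p diff[OF VL[OF u(1)] vL] u(2)])
    also have "\<dots> = 1 / real (Suc j)" using p_pos by (simp add: powr_powr)
    finally show ?thesis using u by blast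
  qed
  then obtain u where u: "\<And>j. u j \<in> V"
    "\<And>j. (LINT x|lebesgue_on \<Omega>. \<bar>u j x - v x\<bar> powr p) < 1 / real (Suc j)" by metis
  have "\<exists>c. bounded (range c) \<and> (AE x in lebesgue_on \<Omega>. u j x = F c x)" for j
    using u(1)[of j] by (simp add: V_def)
  then obtain c where c: "\<And>j. bounded (range (c j))" "\<And>j. AE x in lebesgue_on \<Omega>. u j x = F (c j) x" by metis
  have ui: "integrable (lebesgue_on \<Omega>) (\<lambda>x. \<bar>u j x - v x\<bar> powr p)" for j
    using diff[OF VL[OF u(1)] vL, of j] by (simp add: Lp_space_ereal)
  have Cauchy: "\<bar>c i k - c j k\<bar> powr p \<le> 2 powr (p + 1) * (2 powr p * (1 / real (Suc i) + 1 / real (Suc j)))" for i j k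
  proof -
    let ?d = "\<lambda>k. 1 * c i k + (-1) * c j k"
    have bd: "bounded (range ?d)" by (rule bounded_range_lincomb[OF c(1) c(1)])
    have ae: "AE x in lebesgue_on \<Omega>. 1 * u i x + (-1) * u j x = F ?d x"
      by (rule AE_F_lincomb[OF c(1) c(1) c(2) c(2)])
    have m: "(\<lambda>x. \<bar>F ?d x\<bar> powr p) \<in> borel_measurable (lebesgue_on \<Omega>)"
      by (intro measurable_restrict_space1) measurable
    have ir: "integrable (lebesgue_on \<Omega>) (\<lambda>x. 2 powr p * (\<bar>u i x - v x\<bar> powr p + \<bar>u j x - v x\<bar> powr p))"
      using ui by simp
    have le: "AE x in lebesgue_on \<Omega>. \<bar>F ?d x\<bar> powr p \<le> 2 powr p * (\<bar>u i x - v x\<bar> powr p + \<bar>u j x - v x\<bar> powr p)"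
      using ae
    proof eventually_elim
      case (elim x)
      have "F ?d x = (u i x - v x) + (v x - u j x)" using elim by simp
      then show ?case using powr_abs_add_le[OF p_pos(2), of "u i x - v x" "v x - u j x"]
        by (simp add: abs_minus_commute)
    qed
    have i: "integrable (lebesgue_on \<Omega>) (\<lambda>x. \<bar>F ?d x\<bar> powr p)"
      by (rule Bochner_Integration.integrable_bound[OF ir m]) (use le in \<open>auto elim!: eventually_mono\<close>)
    have "\<bar>?d k\<bar> powr p \<le> 2 powr (p + 1) * (LINT x|lebesgue_on \<Omega>. \<bar>F ?d x\<bar> powr p)"
      by (rule coefficient_powr_le[OF bd i])
    also have "\<dots> \<le> 2 powr (p + 1) * (LINT x|lebesgue_on \<Omega>. 2 powr p * (\<bar>u i x - v x\<bar> powr p + \<bar>u j x - v x\<bar> powr p))"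
      by (intro mult_left_mono integral_mono_AE i ir le) auto
    also have "\<dots> = 2 powr (p + 1) * (2 powr p * ((LINT x|lebesgue_on \<Omega>. \<bar>u i x - v x\<bar> powr p) + (LINT x|lebesgue_on \<Omega>. \<bar>u j x - v x\<bar> powr p)))"
      using ui by simp
    also have "\<dots> \<le> 2 powr (p + 1) * (2 powr p * (1 / real (Suc i) + 1 / real (Suc j)))"
      using u(2)[of i] u(2)[of j] by (intro mult_left_mono add_mono) auto
    finally show ?thesis by simp
  qed
  have "uniformly_Cauchy_on UNIV c"
    unfolding uniformly_Cauchy_on_def
  proof (intro allI impI)
    fix \<epsilon> :: real assume \<epsilon>: "0 < \<epsilon>"
    let ?C = "2 powr (p + 1) * (2 powr p * 2)"
    obtain N :: nat where "?C / \<epsilon> powr p < real N" using reals_Archimedean2 by blast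
    then have N: "?C / \<epsilon> powr p < real (Suc N)" by simp
    have "dist (c i k) (c j k) < \<epsilon>" if "i \<ge> N" "j \<ge> N" for i j k
    proof (rule ccontr)
      assume "\<not> dist (c i k) (c j k) < \<epsilon>"
      then have "\<epsilon> powr p \<le> \<bar>c i k - c j k\<bar> powr p"
        using \<epsilon> p_pos by (intro powr_mono2) (auto simp: dist_real_def)
      also have "\<dots> \<le> 2 powr (p + 1) * (2 powr p * (1 / real (Suc i) + 1 / real (Suc j)))" by (rule Cauchy)
      also have "\<dots> \<le> 2 powr (p + 1) * (2 powr p * (1 / real (Suc N) + 1 / real (Suc N)))"
        using that by (intro mult_left_mono add_mono divide_left_mono) auto
      also have "\<dots> = ?C / real (Suc N)" by simp
      also have "\<dots> < \<epsilon> powr p" using N \<epsilon> by (simp add: divide_less_eq mult.commute)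
      finally show False by simp
    qed
    then show "\<exists>M. \<forall>x\<in>UNIV. \<forall>m\<ge>M. \<forall>n\<ge>M. dist (c m x) (c n x) < \<epsilon>" by blast
  qed
  then have "uniformly_convergent_on UNIV c" by (simp add: uniformly_convergent_eq_Cauchy)
  then obtain c' where c': "uniform_limit UNIV c c' sequentially" by (auto simp: uniformly_convergent_on_def)
  have near: "\<forall>\<^sub>F j in sequentially. \<forall>k. \<bar>c j k - c' k\<bar> < \<delta>" if "0 < \<delta>" for \<delta>
    using uniform_limitD[OF c' that] by (simp add: dist_real_def)
  have bc': "bounded (range c')"
  proof -
    obtain j where j: "\<And>k. \<bar>c j k - c' k\<bar> < 1" using near[of 1] by (auto simp: eventually_sequentially)
    obtain M where M: "\<And>k. \<bar>c j k\<bar> \<le> M" using c(1)[of j] by (auto simp: bounded_iff)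
    have "\<bar>c' k\<bar> \<le> M + 1" for k using j[of k] M[of k] by linarith
    then show ?thesis by (auto simp: bounded_iff)
  qed
  have "(\<lambda>j. LINT x|lebesgue_on \<Omega>. norm (\<bar>u j x - v x\<bar> powr p)) \<longlonglongrightarrow> 0"
  proof (rule tendsto_sandwich[OF _ _ tendsto_const LIMSEQ_inverse_real_of_nat])
    show "\<forall>\<^sub>F j in sequentially. 0 \<le> (LINT x|lebesgue_on \<Omega>. norm (\<bar>u j x - v x\<bar> powr p))"
      by (simp add: integral_nonneg_AE)
    show "\<forall>\<^sub>F j in sequentially. (LINT x|lebesgue_on \<Omega>. norm (\<bar>u j x - v x\<bar> powr p)) \<le> inverse (real (Suc j))"
      using u(2) by (intro always_eventually allI) (simp add: inverse_eq_divide less_imp_le)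
  qed
  from tendsto_L1_AE_subseq[OF ui this]
  obtain r where r: "strict_mono r" "AE x in lebesgue_on \<Omega>. (\<lambda>n. \<bar>u (r n) x - v x\<bar> powr p) \<longlonglongrightarrow> 0" by blast
  have "AE x in lebesgue_on \<Omega>. \<forall>j. u j x = F (c j) x" using c(2) by (simp add: AE_all_countable)
  then have "AE x in lebesgue_on \<Omega>. v x = F c' x"
    using AE_lebesgue_on[OF H_props(1)] r(2)
  proof eventually_elim
    case (elim x)
    have "(\<lambda>n. (\<bar>u (r n) x - v x\<bar> powr p) powr (1 / p)) \<longlonglongrightarrow> 0"
      using p_pos by (intro tendsto_zero_powrI[OF elim(3) tendsto_const]) auto
    then have "(\<lambda>n. \<bar>u (r n) x - v x\<bar>) \<longlonglongrightarrow> 0" using p_pos by (simp add: powr_powr)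
    then have 1: "(\<lambda>n. F (c (r n)) x) \<longlonglongrightarrow> v x"
      using elim(1) by (simp add: tendsto_rabs_zero_iff LIM_zero_iff)
    \<comment> \<open>By \<open>abs_F_le\<close> a change of the coefficients by at most \<delta>
      changes the value at \<open>x\<close> by at most \<delta> A, so uniform convergence of the
      coefficients carries over to the values.\<close>
    define A where "A = (\<Sum>k. e k x) + H x"
    have A: "0 \<le> A"
      unfolding A_def H_def using summable_e[of "\<lambda>_. 1" x] elim(2) e_nonneg h_nonneg
      by (intro add_nonneg_nonneg suminf_nonneg) auto
    have "(\<lambda>j. F (c j) x) \<longlonglongrightarrow> F c' x"
    proof (rule tendstoI)
      fix \<epsilon> :: real assume \<epsilon>: "0 < \<epsilon>"
      \<comment> \<open>The added 1 admits A = 0 and makes the final inequality strict.\<close>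
      have "0 < \<epsilon> / (A + 1)" using \<epsilon> A by simp
      from near[OF this] show "\<forall>\<^sub>F j in sequentially. dist (F (c j) x) (F c' x) < \<epsilon>"
      proof eventually_elim
        case (elim j)
        have "F (c j) x - F c' x = F (\<lambda>k. 1 * c j k + (-1) * c' k) x"
          using F_lincomb[OF \<open>summable (\<lambda>m. h m x)\<close> c(1) bc', of 1 j "-1"] by simp
        also have "\<bar>\<dots>\<bar> \<le> \<epsilon> / (A + 1) * A"
          unfolding A_def using \<open>summable (\<lambda>m. h m x)\<close> elim
          by (intro abs_F_le) (auto simp: A_def less_imp_le)
        also have "\<dots> < \<epsilon>" using \<epsilon> A by (simp add: field_simps)
        finally show ?case by (simp add: dist_real_def)
      qed
    qed
    then have "(\<lambda>n. F (c (r n)) x) \<longlonglongrightarrow> F c' x"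
      using LIMSEQ_subseq_LIMSEQ[OF _ r(1)] by (auto simp: o_def)
    then show ?case using 1 LIMSEQ_unique by blast
  qed
  then show "v \<in> V" using v bc' by (auto simp: V_def)
qed

section \<open>Failure of integrability on every open set\<close>

text \<open>On \<open>G m\<close> all later peaks vanish, so the series of peaks is a finite sum
  there. The support of index m + 1 + i takes at most the fraction 2^(-(i+2)) of the plateau, and
  these fractions add up to 1/2.\<close>

lemma plateau_rest:
  defines "G m \<equiv> B m - (\<Union>j\<in>{m<..}. K j)"
  shows "G m \<in> lmeasurable" "measure lebesgue (B m) / 2 \<le> measure lebesgue (G m)"
proof -
  let ?\<mu> = "measure lebesgue (B m)"
  define T where "T = (\<Union>i. K (Suc (m + i)))"
  have T_eq: "(\<Union>j\<in>{m<..}. K j) = T"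
  proof -
    have "{m<..} = range (\<lambda>i. Suc (m + i))" by (auto simp: image_iff less_iff_Suc_add)
    then show ?thesis by (simp add: T_def)
  qed
  have Kl: "K j \<in> lmeasurable" for j using K(1) by (rule lmeasurable_compact)
  have Bl: "B m \<in> lmeasurable" using B(1) by (rule lmeasurable_compact)
  have T: "T \<in> sets lebesgue" unfolding T_def using Kl by (intro sets.countable_UN) (auto dest: fmeasurableD)
  have geo: "(\<lambda>i. ?\<mu> / 2 * (1 / 2) ^ Suc i) sums (?\<mu> / 2)"
    using sums_mult[OF power_half_series, of "?\<mu> / 2"] by simp
  have "emeasure lebesgue T \<le> (\<Sum>i. emeasure lebesgue (K (Suc (m + i))))"
    unfolding T_def using Kl by (intro emeasure_subadditive_countably) (auto dest: fmeasurableD)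
  also have "\<dots> \<le> (\<Sum>i. ennreal (?\<mu> / 2 * (1 / 2) ^ Suc i))"
  proof (rule suminf_le)
    fix i
    have "measure lebesgue (K (Suc (m + i))) \<le> ?\<mu> / 2 ^ (Suc (m + i) + 2)" by (rule K_small) simp
    also have "\<dots> \<le> ?\<mu> / 2 ^ (i + 2)" using B(3)[of m] by (intro divide_left_mono power_increasing) auto
    also have "\<dots> = ?\<mu> / 2 * (1 / 2) ^ Suc i" by (simp add: power_one_over field_simps)
    finally show "emeasure lebesgue (K (Suc (m + i))) \<le> ennreal (?\<mu> / 2 * (1 / 2) ^ Suc i)"
      using Kl[of "Suc (m + i)"] by (simp add: emeasure_eq_measure2 ennreal_leI del: power_Suc)
  qed auto
  also have "\<dots> = ennreal (?\<mu> / 2)" by (rule suminf_ennreal_eq[OF _ geo]) (use B(3)[of m] in auto)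
  finally have eT: "emeasure lebesgue T \<le> ennreal (?\<mu> / 2)" .
  have "emeasure lebesgue (B m \<inter> T) \<le> ennreal (?\<mu> / 2)"
    using emeasure_mono[of "B m \<inter> T" T lebesgue] T eT by (auto intro: order_trans)
  then have mT: "measure lebesgue (B m \<inter> T) \<le> ?\<mu> / 2"
    unfolding measure_def[of _ "B m \<inter> T"] using B(3)[of m] by (intro enn2real_leI) auto
  show "G m \<in> lmeasurable" unfolding G_def T_eq by (rule fmeasurable_Diff[OF Bl T])
  have "B m = (B m - T) \<union> (B m \<inter> T)" by blast
  then have "?\<mu> \<le> measure lebesgue (B m - T) + measure lebesgue (B m \<inter> T)"
    using measure_Un_le[of "B m - T" lebesgue "B m \<inter> T"] T fmeasurableD[OF Bl] by auto
  then show "?\<mu> / 2 \<le> measure lebesgue (G m)" using mT by (simp add: G_def T_eq)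
qed

text \<open>On what is left of a plateau in \<open>U\<close> with label \<open>k\<close>, the term
  |c k| t m stands against the bumps, at most C S n, and the earlier peaks, at most C Q m.
  \<open>t_large\<close> beats both with the growing factor m + 1, while |c k| > 0 and C are
  fixed.\<close>

lemma nowhere_Lp_V:
  assumes r: "r = \<infinity> \<and> s = 0 \<or> (\<exists>\<rho>>0. r = ereal \<rho> \<and> s = 1 / \<rho>)"
    and v: "v \<in> V" "\<not> ae_zero \<Omega> v"
  shows "nowhere_Lp r \<Omega> v"
  unfolding nowhere_Lp_def
proof (intro allI impI)
  fix U assume U: "open U \<and> U \<noteq> {} \<and> U \<subseteq> \<Omega>"
  obtain c where c: "bounded (range c)" and vF: "AE x in lebesgue_on \<Omega>. v x = F c x"
    using v by (auto simp: V_def)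
  obtain k where k: "c k \<noteq> 0"
  proof (cases "\<exists>k. c k \<noteq> 0")
    case False
    then have "F c x = 0" for x by (simp add: F_def)
    then have "ae_zero \<Omega> v" using vF by (simp add: ae_zero_def)
    then show ?thesis using v(2) by simp
  qed (use that in blast)
  obtain C where C: "\<And>k. \<bar>c k\<bar> \<le> C" using c by (auto simp: bounded_iff)
  have C0: "0 \<le> C" using C[of 0] by linarith
  obtain n where n: "W n \<subseteq> U" using W U by blast
  show "v \<notin> Lp_space r U"
  proof (rule not_Lp_space_if_large[OF r])
    show "U \<in> sets lebesgue" using U by auto
    fix D :: real
    \<comment> \<open>The factor 2^s compensates for the loss of half the plateau, and
      \<open>C\<close> pays for the bumps and the earlier peaks.\<close>
    obtain N :: nat where N: "(\<bar>D\<bar> * 2 powr s + C + 1) / \<bar>c k\<bar> < real N" using reals_Archimedean2 by blast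
    obtain m where m: "m \<ge> N" "\<nu> m = n" "\<kappa> m = k" using index by blast
    have "\<bar>D\<bar> * 2 powr s + C + 1 < real N * \<bar>c k\<bar>" using N k by (simp add: divide_less_eq)
    also have "\<dots> \<le> (real m + 1) * \<bar>c k\<bar>" using m(1) by (intro mult_right_mono) auto
    finally have big: "\<bar>D\<bar> * 2 powr s + 1 < (real m + 1) * \<bar>c k\<bar> - C" by linarith
    define \<mu> where "\<mu> = measure lebesgue (B m)"
    define G where "G = B m - (\<Union>j\<in>{m<..}. K j)"
    define A where "A = \<bar>c k\<bar> * t m - C * (S n + Q m)"
    have \<mu>: "0 < \<mu>" "\<mu> \<le> 1" using B(3,4) by (auto simp: \<mu>_def)
    have G: "G \<in> lmeasurable" "\<mu> / 2 \<le> measure lebesgue G" using plateau_rest[of m] by (auto simp: G_def \<mu>_def)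
    have GU: "G \<subseteq> W n" "G \<subseteq> U" using B(2)[of m] n m(2) by (auto simp: G_def)
    have \<mu>s: "0 < \<mu> powr s" "\<mu> powr s \<le> 1" using \<mu> s by (auto intro: powr_le1)
    \<comment> \<open>Multiplying by Z \<ge> 1 does not lower the nonnegative factor (m+1) |c k| -
      C; then (m+1) Z is the left side of \<open>t_large\<close>, and C Z covers the disturbance C
      (S n + Q m).\<close>
    define Z where "Z = 1 + S n + Q m"
    have Z: "1 \<le> Z" using S(2)[of n] Q(2)[of m] by (simp add: Z_def)
    have "\<bar>D\<bar> * 2 powr s + 1 < ((real m + 1) * \<bar>c k\<bar> - C) * 1" using big by simp
    also have "\<dots> \<le> ((real m + 1) * \<bar>c k\<bar> - C) * Z"
    proof (rule mult_left_mono[OF Z])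
      have "0 \<le> \<bar>D\<bar> * 2 powr s" by simp
      then show "0 \<le> (real m + 1) * \<bar>c k\<bar> - C" using big by linarith
    qed
    also have "\<dots> = \<bar>c k\<bar> * ((real m + 1) * Z) - C * Z" by (simp add: algebra_simps)
    also have "\<dots> \<le> \<bar>c k\<bar> * (t m * \<mu> powr s) - C * (S n + Q m) * \<mu> powr s"
    proof (rule diff_mono)
      show "\<bar>c k\<bar> * ((real m + 1) * Z) \<le> \<bar>c k\<bar> * (t m * \<mu> powr s)"
        using t_large[of m] m(2) by (intro mult_left_mono) (auto simp: Z_def \<mu>_def)
      have "C * (S n + Q m) * \<mu> powr s \<le> C * (S n + Q m) * 1"
        using \<mu>s C0 S(2)[of n] Q(2)[of m] by (intro mult_left_mono) auto
      also have "\<dots> \<le> C * Z" using C0 by (simp add: Z_def mult_left_mono)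
      finally show "C * (S n + Q m) * \<mu> powr s \<le> C * Z" .
    qed
    also have "\<dots> = A * \<mu> powr s" by (simp add: A_def algebra_simps)
    finally have AD: "\<bar>D\<bar> * 2 powr s + 1 < A * \<mu> powr s" .
    then have "0 < A * \<mu> powr s" by (smt (verit) mult_nonneg_nonneg abs_ge_zero powr_ge_zero)
    then have A: "0 \<le> A" using \<mu>s by (simp add: zero_less_mult_iff)
    have pt: "A \<le> \<bar>F c x\<bar>" if x: "x \<in> G" for x
    proof -
      have 0: "h j x = 0" if "j > m" for j using x that K(2)[of x j] by (auto simp: G_def)
      have "(\<Sum>j. c (\<kappa> j) * h j x) = (\<Sum>j\<le>m. c (\<kappa> j) * h j x)"
        by (rule suminf_finite) (use 0 in auto)
      also have "\<dots> = (\<Sum>j<m. c (\<kappa> j) * h j x) + c k * h m x"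
        using m(3) by (simp add: lessThan_Suc_atMost[symmetric])
      finally have sum: "(\<Sum>j. c (\<kappa> j) * h j x) = (\<Sum>j<m. c (\<kappa> j) * h j x) + c k * h m x" .
      have "\<bar>\<Sum>j<m. c (\<kappa> j) * h j x\<bar> \<le> (\<Sum>j<m. \<bar>c (\<kappa> j) * h j x\<bar>)" by (rule sum_abs)
      also have "\<dots> \<le> (\<Sum>j<m. C * h j x)"
        using C h_nonneg by (intro sum_mono) (simp add: abs_mult mult_right_mono)
      also have "\<dots> \<le> C * Q m" using Q(1)[where m=m and x=x] C0 by (simp add: sum_distrib_left[symmetric] mult_left_mono)
      finally have early: "\<bar>\<Sum>j<m. c (\<kappa> j) * h j x\<bar> \<le> C * Q m" .
      have es: "\<bar>\<Sum>k. c k * e k x\<bar> \<le> C * S n"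
        using C S GU x by (intro abs_suminf_e_le) auto
      have "\<bar>c k\<bar> * t m \<le> \<bar>c k * h m x\<bar>"
        using t(1)[where m=m and x=x] x h_nonneg[of m x] by (auto simp: G_def abs_mult intro: mult_left_mono)
      then show ?thesis using early es by (simp add: F_def sum A_def distrib_left)
    qed
    have "AE x in lebesgue. x \<in> \<Omega> \<longrightarrow> v x = F c x"
      using vF lebesgue_\<Omega> by (simp add: AE_restrict_space_iff)
    then have "AE x in lebesgue_on U. x \<in> G \<longrightarrow> A \<le> \<bar>v x\<bar>"
      using U pt by (auto simp: AE_restrict_space_iff elim!: eventually_mono)
    moreover have "D < A * measure lebesgue G powr s"
    proof -
      have "\<bar>D\<bar> * 2 powr s < A * \<mu> powr s" using AD by linarith
      then have "\<bar>D\<bar> < A * (\<mu> / 2) powr s" using \<mu> by (simp add: powr_divide field_simps)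
      also have "\<dots> \<le> A * measure lebesgue G powr s"
        using G(2) \<mu> s A by (intro mult_left_mono powr_mono2) auto
      finally show ?thesis by linarith
    qed
    ultimately show "\<exists>G A. G \<in> lmeasurable \<and> G \<subseteq> U \<and> 0 < measure lebesgue G \<and> 0 \<le> A \<and>
      (AE x in lebesgue_on U. x \<in> G \<longrightarrow> A \<le> \<bar>v x\<bar>) \<and> D < A * measure lebesgue G powr s"
      using G \<mu> GU A by (intro exI[of _ G] exI[of _ A]) auto
  qed
qed

end

section \<open>The construction, given a supply of peaks\<close>

theorem ex_nowhere_Lp_subspace:
  fixes \<Omega> :: "'a::euclidean_space set"
  assumes \<Omega>: "open \<Omega>" "\<Omega> \<noteq> {}" and p: "1 \<le> p" and s: "0 \<le> s"
    and r: "r = \<infinity> \<and> s = 0 \<or> (\<exists>\<rho>>0. r = ereal \<rho> \<and> s = 1 / \<rho>)"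
    and peaks: "\<And>(U :: 'a set) \<epsilon> M. open U \<Longrightarrow> U \<noteq> {} \<Longrightarrow> 0 < \<epsilon> \<Longrightarrow> \<exists>h K B t. peak l p s U \<epsilon> M h K B t"
  shows "\<exists>V. V \<subseteq> sobolev_space l (ereal p) \<Omega> \<and> linear_subspace V \<and>
     sobolev_closed l (ereal p) \<Omega> V \<and> infinite_dimensional \<Omega> V \<and>
     (\<forall>v\<in>V. \<not> ae_zero \<Omega> v \<longrightarrow> nowhere_Lp r \<Omega> v)"
proof (rule ex_disjoint_normalized_bumps[OF \<Omega> p])
  fix e :: "nat \<Rightarrow> 'a \<Rightarrow> real" and Ke
  assume e: "\<And>k. smooth (e k)" "\<And>k x. 0 \<le> e k x" "\<And>k. compact (Ke k)" "\<And>k. Ke k \<subseteq> \<Omega>"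
      "\<And>k x. x \<notin> Ke k \<Longrightarrow> e k x = 0" "\<And>j k. j \<noteq> k \<Longrightarrow> Ke j \<inter> Ke k = {}"
      "\<And>k. (LINT x|lborel. \<bar>e k x\<bar> powr p) = 1"
    and loc: "\<And>U. open U \<Longrightarrow> U \<noteq> {} \<Longrightarrow> \<exists>U' S. open U' \<and> U' \<noteq> {} \<and> U' \<subseteq> U \<and> 0 \<le> S \<and> (\<forall>k. \<forall>x\<in>U'. e k x \<le> S)"
  show ?thesis
  proof (rule ex_countable_pi_base[OF \<Omega> loc])
    fix W :: "nat \<Rightarrow> 'a set" and S
    assume W: "\<And>n. open (W n)" "\<And>n. W n \<noteq> {}" "\<And>n. W n \<subseteq> \<Omega>"
        "\<And>n. 0 \<le> S n \<and> (\<forall>k. \<forall>x\<in>W n. e k x \<le> S n)"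
        "\<And>U. open U \<Longrightarrow> U \<noteq> {} \<Longrightarrow> U \<subseteq> \<Omega> \<Longrightarrow> \<exists>n. W n \<subseteq> U"
    \<comment> \<open>The index m encodes a triple (n, k, N). The third entry is padding: it lets
      each pair (n, k) recur at arbitrarily large m.\<close>
    define \<nu> where "\<nu> m = fst (prod_decode m)" for m
    define \<kappa> where "\<kappa> m = fst (prod_decode (snd (prod_decode m)))" for m
    define \<epsilon> where "\<epsilon> m = 2 powr (- (p + 1)) * 2 powr (- (real m + 1) * (p + 1))" for m
    have peaks': "\<exists>h K B t. peak l p s (W (\<nu> m)) \<epsilon> M h K B t" if "0 < \<epsilon>" for m \<epsilon> M
      using peaks[OF W(1,2) that] .
    have \<epsilon>: "0 < \<epsilon> m" for m by (simp add: \<epsilon>_def)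
    show ?thesis
    proof (rule ex_peak_sequence[where w="\<lambda>m. W (\<nu> m)" and \<sigma>="\<lambda>m. S (\<nu> m)", OF peaks' \<epsilon>])
      fix h :: "nat \<Rightarrow> 'a \<Rightarrow> real" and K B t Q
      assume h: "\<And>m. \<exists>\<epsilon>' M. \<epsilon>' \<le> \<epsilon> m \<and> peak l p s (W (\<nu> m)) \<epsilon>' M (h m) (K m) (B m) (t m)"
          "\<And>j m. j < m \<Longrightarrow> measure lebesgue (K m) \<le> measure lebesgue (B j) / 2 ^ (m + 2)"
          "\<And>m x. (\<Sum>j<m. h j x) \<le> Q m" "\<And>m. 0 \<le> Q m"
          "\<And>m. (real m + 1) * (1 + S (\<nu> m) + Q m) \<le> t m * measure lebesgue (B m) powr s"
      have hm: "smooth (h m)" "\<And>x. 0 \<le> h m x" "compact (K m)" "\<And>x. x \<notin> K m \<Longrightarrow> h m x = 0"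
        "compact (B m)" "B m \<subseteq> W (\<nu> m)" "0 < measure lebesgue (B m)" "measure lebesgue (B m) \<le> 1"
        "\<And>x. x \<in> B m \<Longrightarrow> t m \<le> h m x" "0 \<le> t m" for m
        using h(1)[of m] by (auto simp: peak_def)
      have small: "(LINT x|lborel. \<bar>iter_partial bs (h m) x\<bar> powr p) \<le> \<epsilon> m"
        if "set bs \<subseteq> Basis" "length bs \<le> l" for bs m
        using h(1)[of m] that unfolding peak_def by (meson order_trans)
      have index: "\<exists>m\<ge>N. \<nu> m = n \<and> \<kappa> m = k" for N n k
      proof (intro exI conjI)
        let ?m = "prod_encode (n, prod_encode (k, N))"
        show "N \<le> ?m" using le_prod_encode_2[of N k] le_prod_encode_2[of "prod_encode (k, N)" n] by linarith
      qed (simp_all add: \<nu>_def \<kappa>_def)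
      interpret peak_sequence \<Omega> l p s e Ke W S h K B t Q \<nu> \<kappa>
        by unfold_locales (use \<Omega> p s e W hm h(2-5) small[unfolded \<epsilon>_def] index in auto)
      show ?thesis
        using linear_subspace_V sobolev_closed_V infinite_dimensional_V nowhere_Lp_V[OF r]
        by (intro exI[of _ V]) (auto simp: V_def)
    qed
  qed
qed

theorem theorem1:
  fixes \<Omega> :: "'a::euclidean_space set" and l :: nat and p :: real
  assumes "open \<Omega>" and "\<Omega> \<noteq> {}" and "1 \<le> l" and "1 \<le> p"
  shows
    "(p * real l < real DIM('a) \<longrightarrow>
       (\<forall>r :: ereal.
          ereal (real l * (real DIM('a) * p / (real DIM('a) - p * real l))) < r \<longrightarrow>
          (\<exists>V. V \<subseteq> sobolev_space l (ereal p) \<Omega> \<and> linear_subspace V \<and>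
             sobolev_closed l (ereal p) \<Omega> V \<and> infinite_dimensional \<Omega> V \<and>
             (\<forall>v\<in>V. \<not> ae_zero \<Omega> v \<longrightarrow> nowhere_Lp r \<Omega> v)))) \<and>
     (p * real l = real DIM('a) \<and> p \<noteq> 1 \<longrightarrow>
       (\<exists>V. V \<subseteq> sobolev_space l (ereal p) \<Omega> \<and> linear_subspace V \<and>
          sobolev_closed l (ereal p) \<Omega> V \<and> infinite_dimensional \<Omega> V \<and>
          (\<forall>v\<in>V. \<not> ae_zero \<Omega> v \<longrightarrow> nowhere_bounded \<Omega> v)))"
proof (intro conjI impI allI)
  fix r :: ereal
  let ?N = "real DIM('a)"
  assume sub: "p * real l < ?N" and r: "ereal (real l * (?N * p / (?N - p * real l))) < r"
  define q where "q = ?N * p / (?N - p * real l)"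
  have q: "0 < q" unfolding q_def using sub assms(4) by (intro divide_pos_pos mult_pos_pos) auto
  define s where "s = (if r = \<infinity> then 0 else 1 / real_of_ereal r)"
  \<comment> \<open>The scaling of peaks is governed by the Sobolev exponent \<open>q\<close>; as l
    \<ge> 1, the assumed lower bound for \<open>r\<close> is at least \<open>q\<close>.\<close>
  have "q \<le> real l * q" using q assms(3) by (simp add: mult_le_cancel_right1)
  then have rq: "ereal q < r" using r by (fold q_def) (metis ereal_less_eq(3) order_le_less_trans)
  have rs: "r = \<infinity> \<and> s = 0 \<or> (\<exists>\<rho>>0. r = ereal \<rho> \<and> s = 1 / \<rho>)"
    using rq q by (cases r) (auto simp: s_def)
  then have s: "0 \<le> s" by auto
  \<comment> \<open>For finite \<open>r\<close> this is r > q multiplied out with s = 1/r; for r =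
    \<infinity> it is the assumption p l < N.\<close>
  have "?N * s * p + real l * p < ?N"
    using rs
  proof (elim disjE conjE exE)
    fix \<rho> assume \<rho>: "0 < \<rho>" "r = ereal \<rho>" "s = 1 / \<rho>"
    have "?N * p < \<rho> * (?N - p * real l)"
      using rq \<rho>(2) sub by (simp add: q_def divide_less_eq)
    then show ?thesis using \<rho>(1) by (simp add: \<rho>(3) field_simps)
  qed (use sub in \<open>simp add: mult.commute\<close>)
  then show "\<exists>V. V \<subseteq> sobolev_space l (ereal p) \<Omega> \<and> linear_subspace V \<and>
      sobolev_closed l (ereal p) \<Omega> V \<and> infinite_dimensional \<Omega> V \<and>
      (\<forall>v\<in>V. \<not> ae_zero \<Omega> v \<longrightarrow> nowhere_Lp r \<Omega> v)"
    using ex_peak_subcritical[OF assms(4) s] by (intro ex_nowhere_Lp_subspace[OF assms(1,2,4) s rs]) auto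
next
  assume crit: "p * real l = real DIM('a) \<and> p \<noteq> 1"
  then have "1 < p" "real l * p = real DIM('a)" using assms(4) by (auto simp: mult.commute)
  then show "\<exists>V. V \<subseteq> sobolev_space l (ereal p) \<Omega> \<and> linear_subspace V \<and>
      sobolev_closed l (ereal p) \<Omega> V \<and> infinite_dimensional \<Omega> V \<and>
      (\<forall>v\<in>V. \<not> ae_zero \<Omega> v \<longrightarrow> nowhere_bounded \<Omega> v)"
    by (intro ex_nowhere_Lp_subspace[OF assms(1,2,4), of 0] ex_peak_critical) auto
qed

end
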